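(* Let $\mu_a$ be the fair measure of the tent map $f_a$, $a\in[\sqrt2,2]$, and let $\dim_H(\mu_a)=\dfrac{h_{\mu_a}(f_a)}{\log a}$ be its Hausdorff dimension. Then the function $a\mapsto\dim_H(\mu_a)$ is not monotone on any subinterval of $[\sqrt2,2]$ of positive length.
   Context: Tent maps: for $a\in[\sqrt2,2]$ let $I_a=[1-a,1]$ and $f_a:I_a\to I_a$, $f_a(x)=1-a|x|$. Put $c_2(a)=1-a$ and $\hat c_2(a)=a-1$. Fair measure: let $j_a(x)=\#f_a^{-1}(f_a(x))$, i.e. $j_a(x)=2$ for $x\in[c_2(a),\hat c_2(a)]\setminus\{0\}$ and $j_a(x)=1$ for $x\in\{0\}\cup(\hat c_2(a),1]$. The fair measure $\mu_a$ of $f_a$ is the unique atomless $f_a$-invariant Borel probability measure on $I_a$ such that $\mu_a(f_aE)=\int_E j_a\,d\mu_a$ for every Borel set $E\subset I_a$ on which $f_a$ is injective (existence and uniqueness are known). $h_{\mu_a}(f_a)$ is its measure-theoretic entropy. It is standard that $\mu_a$ is exact dimensional, i.e. $\lim_{\delta\to0^+}\frac{\log\mu_a((x-\delta,x+\delta))}{\log\delta}=\frac{h_{\mu_a}(f_a)}{\log a}$ for $\mu_a$-a.e. $x$, so that $\dim_H(\mu_a)=\frac{h_{\mu_a}(f_a)}{\log a}$. *)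

theory Defs
  imports "HOL-Analysis.Analysis"
begin

section \<open>Tent maps and their fair measures\<close>

definition tent_interval :: "real \<Rightarrow> real set" where
  "tent_interval a = {1 - a..1}"

text \<open>The dynamical system is the restriction to \<^term>\<open>tent_interval a\<close>; the values of
  \<^term>\<open>tent a\<close> outside this interval play no role below.\<close>

definition tent :: "real \<Rightarrow> real \<Rightarrow> real" where
  "tent a x = 1 - a * \<bar>x\<bar>"

definition preimage_count :: "real \<Rightarrow> real \<Rightarrow> nat" where
  "preimage_count a x = card {y \<in> tent_interval a. tent a y = tent a x}"

definition fair_measure :: "real \<Rightarrow> real measure \<Rightarrow> bool" where
  "fair_measure a M \<longleftrightarrow>
     sets M = sets (restrict_space borel (tent_interval a)) \<and>
     emeasure M (space M) = 1 \<and>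
     (\<forall>x\<in>space M. emeasure M {x} = 0) \<and>
     tent a \<in> measurable M M \<and> distr M M (tent a) = M \<and>
     (\<forall>E\<in>sets M. inj_on (tent a) E \<longrightarrow>
        emeasure M (tent a ` E) = (\<integral>\<^sup>+x\<in>E. of_nat (preimage_count a x) \<partial>M))"

section \<open>Measure-theoretic (Kolmogorov-Sinai) entropy\<close>

definition finite_partition :: "'a measure \<Rightarrow> 'a set set \<Rightarrow> bool" where
  "finite_partition M P \<longleftrightarrow> finite P \<and> P \<subseteq> sets M \<and> partition_on (space M) P"

text \<open>The common refinement of the preimages of \<open>P\<close> under \<open>T ^^ i\<close> for \<open>i < n\<close>. It may contain the
  empty set, which contributes nothing to the entropy because \<open>0 * ln 0 = 0\<close>.\<close>

definition dynamical_join :: "'a measure \<Rightarrow> ('a \<Rightarrow> 'a) \<Rightarrow> 'a set set \<Rightarrow> nat \<Rightarrow> 'a set set" where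
  "dynamical_join M T P n =
     {{x \<in> space M. \<forall>i<n. (T ^^ i) x \<in> A i} | A. \<forall>i<n. A i \<in> P}"

definition partition_entropy :: "'a measure \<Rightarrow> 'a set set \<Rightarrow> real" where
  "partition_entropy M P = - (\<Sum>A\<in>P. measure M A * ln (measure M A))"

definition entropy_wrt_partition :: "'a measure \<Rightarrow> ('a \<Rightarrow> 'a) \<Rightarrow> 'a set set \<Rightarrow> real" where
  "entropy_wrt_partition M T P =
     lim (\<lambda>n. partition_entropy M (dynamical_join M T P n) / real n)"

definition measure_entropy :: "'a measure \<Rightarrow> ('a \<Rightarrow> 'a) \<Rightarrow> ereal" where
  "measure_entropy M T =
     (SUP P\<in>{P. finite_partition M P}. ereal (entropy_wrt_partition M T P))"

section \<open>Hausdorff dimension of sets and measures\<close>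

definition hausdorff_premeasure :: "real \<Rightarrow> real \<Rightarrow> 'a::metric_space set \<Rightarrow> ennreal" where
  "hausdorff_premeasure s \<delta> S =
     (INF U\<in>{U :: nat \<Rightarrow> 'a set. S \<subseteq> (\<Union>i. U i) \<and> (\<forall>i. bounded (U i) \<and> diameter (U i) \<le> \<delta>)}.
        \<Sum>i. ennreal (diameter (U i) powr s))"

definition hausdorff_measure :: "real \<Rightarrow> 'a::metric_space set \<Rightarrow> ennreal" where
  "hausdorff_measure s S = (SUP \<delta>\<in>{0<..}. hausdorff_premeasure s \<delta> S)"

text \<open>Only exponents \<open>s > 0\<close> are used, since \<open>0 powr 0 = 0\<close> makes the case \<open>s = 0\<close> differ from
  counting measure; this does not affect the infimum.\<close>

definition hausdorff_dim :: "'a::metric_space set \<Rightarrow> ereal" where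
  "hausdorff_dim S = (INF s\<in>{s. 0 < s \<and> hausdorff_measure s S = 0}. ereal s)"

definition hausdorff_dim_measure :: "'a::metric_space measure \<Rightarrow> ereal" where
  "hausdorff_dim_measure M =
     (INF A\<in>{A \<in> sets M. emeasure M (space M - A) = 0}. hausdorff_dim A)"

end

theory Submission
  imports Defs "HOL-Probability.Probability" "HOL-Library.Discrete_Functions"
begin

text \<open>
  A point of the core \<^term>\<open>{1 - a..a - 1}\<close> has two preimages of its image, and the fair measure doubles the mass
  of short intervals there and preserves it elsewhere. So if \<open>b\<close> is the mass of the core, the distribution function
  of the fair measure conjugates the tent map to a piecewise linear map of slopes \<open>\<plusminus>2\<close> and \<open>-1\<close> which depends on
  \<open>b\<close> only. Entropy is \<open>b * ln 2\<close> and dimension is \<open>b * ln 2 / ln a\<close>; both are only needed for the dense set of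
  parameters with finite critical orbit, where the maps are Markov.

  The orbit of the critical point has derivatives of order \<open>a ^ n\<close> with respect to \<open>a\<close> and of order \<open>2 ^ N\<close> with
  respect to \<open>b\<close>, where \<open>N\<close> counts the visits to the core. Near a parameter whose critical orbit ends in a
  cycle, \<open>b\<close> is therefore a power-like function of \<open>a\<close> with exponent \<open>\<nu> * ln 2 / (q * ln a)\<close>, where \<open>q\<close> is the
  period and \<open>\<nu>\<close> the number of visits to the core per period. For the fixed point the exponent exceeds 1, so \<open>b\<close>
  is flat and the dimension, being divided by \<open>ln a\<close>, decreases. For the cycle which follows the left branch as long as
  possible between two visits to the complement of the core the exponent is smaller than 1 and the dimension
  increases. Both kinds of parameters are dense.
\<close>

section \<open>Critical orbits and their dependence on the parameter\<close>

text \<open>Two difficulties shape the proof. The derivative of the critical orbit with respect to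
  \<open>a\<close> is multiplied by \<open>a\<close> in each step up to a bounded error, so errors
  might cancel the growth; this is excluded by finding one early time at which the difference
  quotient exceeds 1/(a - 1), the value where growth and worst error balance. And
  \<open>core_mass\<close> is an implicit function of \<open>a\<close>: its variation is read off by
  comparing the orbits of two parameters up to the time at which they separate. For an upper bound
  it is enough that masses are at most 1. A lower bound needs intervals of a given length to have
  mass bounded below uniformly in the parameter, and it compares two times one period apart, at
  which the orbit of the preperiodic parameter is at the same point. At Markov parameters the mass
  of a cylinder is comparable to 2^(-visits to the core), so entropy only needs the mean number of
  visits. Dimension needs their almost sure frequency; it comes from an explicit Poisson equation
  and a law of large numbers for orthogonal functions.\<close>

definition crit :: "real \<Rightarrow> nat \<Rightarrow> real" where
  "crit a n = (tent a ^^ n) 0"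

lemma crit_0 [simp]: "crit a 0 = 0"
  by (simp add: crit_def)

lemma crit_Suc: "crit a (Suc n) = 1 - a * \<bar>crit a n\<bar>"
  by (simp add: crit_def tent_def)

lemma crit_Suc_tent: "crit a (Suc n) = tent a (crit a n)"
  by (simp add: crit_def)

lemma crit_add: "crit a (m + n) = (tent a ^^ m) (crit a n)"
  by (simp add: crit_def funpow_add)

lemma crit_1 [simp]: "crit a 1 = 1" "crit a (Suc 0) = 1"
  by (simp_all add: crit_Suc)

lemma crit_2: "crit a 2 = 1 - a"
  by (simp add: numeral_2_eq_2 crit_Suc)

lemma crit_3: "1 \<le> a \<Longrightarrow> crit a 3 = 1 + a - a\<^sup>2"
  using crit_Suc[of a 2] by (simp add: crit_2 algebra_simps power2_eq_square)

lemma tent_mem: "1 < a \<Longrightarrow> a \<le> 2 \<Longrightarrow> x \<in> {1 - a..1} \<Longrightarrow> tent a x \<in> {1 - a..1}"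
  using mult_left_mono[of "\<bar>x\<bar>" 1 a] by (auto simp: tent_def)

lemma tent_funpow_mem:
  "1 < a \<Longrightarrow> a \<le> 2 \<Longrightarrow> x \<in> {1 - a..1} \<Longrightarrow> (tent a ^^ n) x \<in> {1 - a..1}"
proof (induction n)
  case (Suc n)
  then show ?case using tent_mem[of a "(tent a ^^ n) x"] by simp
qed simp

lemma crit_mem: "1 < a \<Longrightarrow> a \<le> 2 \<Longrightarrow> crit a n \<in> {1 - a..1}"
  unfolding crit_def by (rule tent_funpow_mem) auto

lemma abs_crit_le_1: "1 < a \<Longrightarrow> a \<le> 2 \<Longrightarrow> \<bar>crit a n\<bar> \<le> 1"
  using crit_mem[of a n] by auto

lemma continuous_on_crit: "continuous_on S (\<lambda>a. crit a n)"
proof (induction n)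
  case (Suc n)
  have "continuous_on S (\<lambda>a. 1 - a * \<bar>crit a n\<bar>)" by (intro continuous_intros Suc)
  then show ?case by (simp add: crit_Suc)
qed simp

lemma sqrt2_bounds: "sqrt 2 > (1.41::real)" "sqrt 2 < (1.42::real)"
  by (rule real_less_rsqrt, simp add: power2_eq_square)
    (rule real_less_lsqrt, simp_all add: power2_eq_square)

text \<open>A step stretches differences by at most \<open>u\<close>, also across the fold, and adds
  at most |u - v|. Measuring in units of |u - v| / (u - 1) solves this affine recursion by u^n -
  1.\<close>

lemma crit_diff_le:
  assumes "1 < u" "1 < v" "v \<le> 2"
  shows "\<bar>crit u n - crit v n\<bar> \<le> u ^ n / (u - 1) * \<bar>u - v\<bar>"
proof -
  define e where "e = \<bar>u - v\<bar> / (u - 1)"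
  have e: "e \<ge> 0" "\<bar>u - v\<bar> = (u - 1) * e" using assms by (auto simp: e_def)
  have "\<bar>crit u n - crit v n\<bar> \<le> (u ^ n - 1) * e"
  proof (induction n)
    case (Suc n)
    let ?A = "\<bar>crit u n\<bar>" and ?B = "\<bar>crit v n\<bar>"
    have "crit u (Suc n) - crit v (Suc n) = - (u * (?A - ?B) + (u - v) * ?B)"
      by (simp only: crit_Suc) argo
    then have "\<bar>crit u (Suc n) - crit v (Suc n)\<bar> \<le> \<bar>u * (?A - ?B)\<bar> + \<bar>(u - v) * ?B\<bar>"
      by linarith
    moreover have "\<bar>u * (?A - ?B)\<bar> \<le> u * ((u ^ n - 1) * e)"
    proof -
      have "\<bar>?A - ?B\<bar> \<le> (u ^ n - 1) * e"
        using abs_triangle_ineq3[of "crit u n" "crit v n"] Suc by linarith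
      then have "\<bar>u\<bar> * \<bar>?A - ?B\<bar> \<le> u * ((u ^ n - 1) * e)"
        using assms by (intro mult_mono) auto
      then show ?thesis by (simp only: abs_mult)
    qed
    moreover have "\<bar>(u - v) * ?B\<bar> \<le> (u - 1) * e"
      using mult_left_mono[OF abs_crit_le_1[of v n], of "\<bar>u - v\<bar>"] assms
      unfolding e(2)[symmetric] by (simp add: abs_mult)
    ultimately show ?case by (simp add: algebra_simps)
  qed simp
  also have "\<dots> \<le> u ^ n * e"
    using e by (intro mult_right_mono) auto
  finally show ?thesis by (simp add: e_def)
qed

section \<open>Signs along critical orbits and transversality\<close>

definition sg :: "real \<Rightarrow> real" where
  "sg x = (if x \<le> 0 then 1 else - 1)"

text \<open>The product starts at 3 because every orbit begins with 0, 1, 1 - a. The minus sign that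
  accompanies \<open>orient\<close> below is the sign of 1 - 2 a, the derivative of
  \<open>crit a 3\<close> with respect to \<open>a\<close>.\<close>

definition orient :: "real \<Rightarrow> nat \<Rightarrow> real" where
  "orient a n = (\<Prod>i = 3..<n. sg (crit a i))"

lemma abs_eq_sg: "\<bar>x\<bar> = - sg x * x"
  by (simp add: sg_def)

lemma sg_squared [simp]: "sg x * sg x = 1"
  by (simp add: sg_def)

lemma orient_Suc: "3 \<le> n \<Longrightarrow> orient a (Suc n) = orient a n * sg (crit a n)"
  by (simp add: orient_def)

lemma orient_3 [simp]: "orient a 3 = 1"
  by (simp add: orient_def)

lemma abs_orient [simp]: "\<bar>orient a n\<bar> = 1"
  unfolding orient_def by (simp add: abs_prod) (rule prod.neutral, simp add: sg_def)

lemma orient_cases: "orient a n = 1 \<or> orient a n = - 1"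
  using abs_orient[of a n] by linarith

text \<open>From one time to the next a difference quotient X becomes at least v X - 1. The
  repelling fixed point of this map is 1 / (v - 1), so a quotient is certain to keep growing once it
  exceeds that value by some \<eta>. Pairs of parameters are used instead of derivatives.\<close>

definition transversal :: "real \<Rightarrow> real \<Rightarrow> nat \<Rightarrow> real \<Rightarrow> bool" where
  "transversal l r m \<eta> \<longleftrightarrow> 3 \<le> m \<and> 0 < \<eta> \<and>
     (\<forall>i\<in>{3..<m}. \<forall>u\<in>{l..r}. \<forall>v\<in>{l..r}. sg (crit u i) = sg (crit v i)) \<and>
     (\<forall>u\<in>{l..r}. \<forall>v\<in>{l..r}. v < u \<longrightarrow>
        (1 / (v - 1) + \<eta>) * (u - v) \<le> - orient v m * (crit u m - crit v m))"

lemma transversalD: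
  assumes "transversal l r m \<eta>"
  shows "3 \<le> m" "0 < \<eta>"
    "3 \<le> i \<Longrightarrow> i < m \<Longrightarrow> u \<in> {l..r} \<Longrightarrow> v \<in> {l..r} \<Longrightarrow> sg (crit u i) = sg (crit v i)"
    "u \<in> {l..r} \<Longrightarrow> v \<in> {l..r} \<Longrightarrow> v < u \<Longrightarrow>
       (1 / (v - 1) + \<eta>) * (u - v) \<le> - orient v m * (crit u m - crit v m)"
proof -
  note A = assms[unfolded transversal_def]
  show "3 \<le> m" "0 < \<eta>" by (rule A[THEN conjunct1], rule A[THEN conjunct2, THEN conjunct1])
  show "3 \<le> i \<Longrightarrow> i < m \<Longrightarrow> u \<in> {l..r} \<Longrightarrow> v \<in> {l..r} \<Longrightarrow> sg (crit u i) = sg (crit v i)"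
    by (rule A[THEN conjunct2, THEN conjunct2, THEN conjunct1, rule_format]) simp
  show "u \<in> {l..r} \<Longrightarrow> v \<in> {l..r} \<Longrightarrow> v < u \<Longrightarrow>
       (1 / (v - 1) + \<eta>) * (u - v) \<le> - orient v m * (crit u m - crit v m)"
    by (rule A[THEN conjunct2, THEN conjunct2, THEN conjunct2, rule_format])
qed

text \<open>Equal signs mean equal branches, so the quotient is multiplied by \<open>v\<close> up to
  an error of at most 1. The part 1 / (v - 1) absorbs the error and reproduces itself; the excess
  \<eta> is multiplied by \<open>v\<close>.\<close>

lemma transversal_growth:
  assumes T: "transversal l r m \<eta>" and l: "sqrt 2 < l" "r < 2"
    and uv: "v \<in> {l..r}" "u \<in> {l..r}" "v < u" and n: "m \<le> n"
    and s: "\<And>i. 3 \<le> i \<Longrightarrow> i < n \<Longrightarrow> sg (crit u i) = sg (crit v i)"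
  shows "(1 / (v - 1) + \<eta> * v ^ (n - m)) * (u - v) \<le> - orient v n * (crit u n - crit v n)"
  using n s
proof (induction n rule: dec_induct)
  case base
  then show ?case using transversalD(4)[OF T uv(2,1,3)] by simp
next
  case (step n)
  have v1: "1 < v" "u \<le> 2" "1 < u" using l uv sqrt2_bounds by auto
  have n3: "3 \<le> n" using step.hyps transversalD(1)[OF T] by simp
  define s where "s = sg (crit v n)"
  have ss: "s * s = 1" by (simp add: s_def)
  have su: "sg (crit u n) = s" using step.prems[of n] n3 by (simp add: s_def)
  define X where "X = - orient v n * (crit u n - crit v n)"
  have IH: "(1 / (v - 1) + \<eta> * v ^ (n - m)) * (u - v) \<le> X"
    unfolding X_def by (rule step.IH) (rule step.prems, auto)
  have "- orient v (Suc n) * (crit u (Suc n) - crit v (Suc n)) =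
      - orient v n * (s * s) * (u * crit u n - v * crit v n)"
    unfolding orient_Suc[OF n3] crit_Suc abs_eq_sg[of "crit u n"] abs_eq_sg[of "crit v n"] su
      s_def[symmetric] by argo
  also have "\<dots> = v * X - orient v n * crit u n * (u - v)"
    unfolding ss X_def by argo
  finally have eq: "- orient v (Suc n) * (crit u (Suc n) - crit v (Suc n)) =
    v * X - orient v n * crit u n * (u - v)" .
  define Y where "Y = orient v n * crit u n * (u - v)"
  have "orient v n * crit u n \<le> \<bar>orient v n * crit u n\<bar>" by (rule abs_ge_self)
  also have "\<dots> \<le> 1" using abs_crit_le_1[of u n] v1 by (simp add: abs_mult)
  finally have "Y \<le> 1 * (u - v)"
    unfolding Y_def using uv(3) by (intro mult_right_mono) auto
  moreover define Z where "Z = v * X"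
  moreover have "v * ((1 / (v - 1) + \<eta> * v ^ (n - m)) * (u - v)) \<le> Z"
    unfolding Z_def using IH v1 by (intro mult_left_mono) auto
  moreover have "v * ((1 / (v - 1) + \<eta> * v ^ (n - m)) * (u - v)) - (u - v) =
      (1 / (v - 1) + \<eta> * v ^ (Suc n - m)) * (u - v)"
  proof -
    have 1: "v * (1 / (v - 1)) = 1 / (v - 1) + 1" using v1 by (simp add: field_simps)
    have 2: "v ^ (Suc n - m) = v * v ^ (n - m)" using step.hyps by (simp add: Suc_diff_le)
    have "v * ((1 / (v - 1) + \<eta> * v ^ (n - m)) * (u - v)) =
      (v * (1 / (v - 1)) + \<eta> * (v * v ^ (n - m))) * (u - v)" by argo
    then show ?thesis unfolding 1 2 by argo
  qed
  moreover define W where "W = v * ((1 / (v - 1) + \<eta> * v ^ (n - m)) * (u - v))"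
  ultimately have "(1 / (v - 1) + \<eta> * v ^ (Suc n - m)) * (u - v) = W - (u - v)" "W \<le> Z" "Y \<le> u - v"
    by simp_all
  then show ?case unfolding eq Z_def[symmetric] Y_def[symmetric] by simp
qed

text \<open>At time 3 the difference quotient is u + v - 1, whose limit 2 v - 1 exceeds 1 / (v - 1)
  if and only if v > 3/2. For smaller parameters \<open>crit a 3\<close> and \<open>crit a 4\<close>
  are positive, and time 5 is late enough.\<close>

lemma exists_transversal:
  assumes "sqrt 2 < l" "l < r" "r < 2"
  shows "\<exists>l' r' m \<eta>. l \<le> l' \<and> l' < r' \<and> r' \<le> r \<and> transversal l' r' m \<eta>"
proof (cases "r \<le> 3/2")
  case False
  define l' where "l' = max l ((3/2 + r)/2)"
  have l': "l \<le> l'" "l' < r" "3/2 < l'" using False assms by (auto simp: l'_def max_def)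
  define \<eta> where "\<eta> = 2 * l' - 1 - 1 / (l' - 1)"
  have "1 / (l' - 1) < 2" using l' by (simp add: field_simps)
  then have \<eta>: "\<eta> > 0" using l' by (simp add: \<eta>_def)
  have "transversal l' r 3 \<eta>"
    unfolding transversal_def
  proof (intro conjI ballI impI)
    fix u v assume uv: "u \<in> {l'..r}" "v \<in> {l'..r}" "v < u"
    have "1 / (v - 1) \<le> 1 / (l' - 1)" using uv l' by (intro divide_left_mono) auto
    then have "1 / (v - 1) + \<eta> \<le> u + v - 1" using uv by (simp add: \<eta>_def)
    then have "(1 / (v - 1) + \<eta>) * (u - v) \<le> (u + v - 1) * (u - v)"
      using uv by (intro mult_right_mono) auto
    also have "\<dots> = - orient v 3 * (crit u 3 - crit v 3)"
      using uv l' by (simp add: crit_3 power2_eq_square algebra_simps)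
    finally show "(1 / (v - 1) + \<eta>) * (u - v) \<le> - orient v 3 * (crit u 3 - crit v 3)" .
  qed (use \<eta> in auto)
  then show ?thesis using l' by blast
next
  case True
  have c: "crit a 3 > 0" "crit a 4 > 0" "crit a 5 = 1 - a + a^2 + a^3 - a^4" if "a \<in> {l..r}" for a
  proof -
    have a: "1.41 < a" "a \<le> 1.5" using that True assms sqrt2_bounds by auto
    have "a * a \<le> 1.5 * a" using a by (intro mult_right_mono) auto
    also have "\<dots> < 1 + a" using a by simp
    finally have "a * a < 1 + a" .
    then show c3: "crit a 3 > 0" using a by (simp add: crit_3 power2_eq_square)
    have c4: "crit a 4 = (a - 1)^2 * (a + 1)"
      using crit_Suc[of a 3] c3 a by (simp add: crit_3 algebra_simps power2_eq_square)
    then show "crit a 4 > 0" using a by simp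
    then show "crit a 5 = 1 - a + a^2 + a^3 - a^4"
      using crit_Suc[of a 4] a unfolding c4
      by (simp add: algebra_simps power2_eq_square power3_eq_cube power4_eq_xxxx)
  qed
  have "transversal l r 5 (1/2)"
    unfolding transversal_def
  proof (intro conjI ballI impI)
    fix i u v assume "i \<in> {3..<5::nat}" and uv: "u \<in> {l..r}" "v \<in> {l..r}"
    then have "i = 3 \<or> i = 4" by auto
    then show "sg (crit u i) = sg (crit v i)" using c(1,2)[OF uv(1)] c(1,2)[OF uv(2)] by (auto simp: sg_def)
  next
    fix u v assume uv: "u \<in> {l..r}" "v \<in> {l..r}" "v < u"
    have b: "1.41 < v" "u \<le> 1.5" using uv True assms sqrt2_bounds by auto
    have o: "orient v 5 = 1"
      using c(1,2)[OF uv(2)] by (simp add: orient_def numeral_eq_Suc sg_def)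
    \<comment> \<open>In these coordinates the difference quotient of \<open>crit a 5\<close> is a
      cubic in s plus a multiple of t^2 whose coefficient is positive here.\<close>
    define s where "s = u + v"
    define t where "t = u - v"
    have s: "2.8 \<le> s" using b uv by (simp add: s_def)
    have "1 / (v - 1) \<le> 1 / 0.41" using b by (intro divide_left_mono) auto
    then have "1 / (v - 1) + 1/2 \<le> 3" by simp
    also have "\<dots> \<le> 1 + s * (- 1 + s * (- 3/4 + s / 2))"
    proof -
      have "s * (- 1 + s * (- 3/4 + s / 2)) \<ge> 2"
      proof -
        have "0.65 \<le> - 3/4 + s / 2" using s by simp
        then have "2.8 * 0.65 \<le> s * (- 3/4 + s / 2)" using s by (intro mult_mono) auto
        then have "2.8 * 0.8 \<le> s * (- 1 + s * (- 3/4 + s / 2))" using s by (intro mult_mono) auto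
        then show ?thesis by linarith
      qed
      then show ?thesis by linarith
    qed
    also have "\<dots> \<le> 1 + s * (- 1 + s * (- 3/4 + s / 2)) + t\<^sup>2 * (s / 2 - 1/4)"
      using s by simp
    finally have "(1 / (v - 1) + 1/2) * t \<le> (1 + s * (- 1 + s * (- 3/4 + s / 2)) + t\<^sup>2 * (s / 2 - 1/4)) * t"
      using uv by (intro mult_right_mono) (auto simp: t_def)
    also have "\<dots> = - (crit u 5 - crit v 5)"
      unfolding c(3)[OF uv(1)] c(3)[OF uv(2)] s_def t_def
      by (simp add: field_simps power2_eq_square power3_eq_cube power4_eq_xxxx)
    finally show "(1 / (v - 1) + 1/2) * (u - v) \<le> - orient v 5 * (crit u 5 - crit v 5)"
      by (simp add: o t_def)
  qed auto
  then show ?thesis using assms by blast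
qed


text \<open>The interval is shrunk once for each time: either the orbit is positive at an interior
  parameter, hence near it, or it is nowhere positive inside. The second case is settled as well
  because \<open>sg\<close> treats 0 like negative numbers.\<close>

lemma exists_sg_const:
  assumes "l < r"
  shows "\<exists>l' r'. l \<le> l' \<and> l' < r' \<and> r' \<le> r \<and>
    (\<forall>i<n. \<forall>u\<in>{l'..r'}. \<forall>v\<in>{l'..r'}. sg (crit u i) = sg (crit v i))"
proof (induction n)
  case 0
  then show ?case using assms by auto
next
  case (Suc n)
  then obtain l' r' where lr: "l \<le> l'" "l' < r'" "r' \<le> r"
    and s: "\<And>i u v. i < n \<Longrightarrow> u \<in> {l'..r'} \<Longrightarrow> v \<in> {l'..r'} \<Longrightarrow> sg (crit u i) = sg (crit v i)"
    by blast
  show ?case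
  proof (cases "\<exists>x\<in>{l'<..<r'}. 0 < crit x n")
    case True
    then obtain x where x: "x \<in> {l'<..<r'}" "0 < crit x n" by blast
    have "open ((\<lambda>a. crit a n) -` {0<..} \<inter> {l'<..<r'})"
      by (intro open_Int open_vimage continuous_on_crit open_greaterThan open_greaterThanLessThan)
    moreover have "x \<in> (\<lambda>a. crit a n) -` {0<..} \<inter> {l'<..<r'}" using x by auto
    ultimately obtain e where e: "e > 0" "cball x e \<subseteq> (\<lambda>a. crit a n) -` {0<..} \<inter> {l'<..<r'}"
      unfolding open_contains_cball by blast
    have "{x - e..x + e} \<subseteq> (\<lambda>a. crit a n) -` {0<..} \<inter> {l'<..<r'}"
      using e(2) by (simp add: cball_eq_atLeastAtMost)
    then have pos: "0 < crit u n" "u \<in> {l'..r'}" if "u \<in> {x - e..x + e}" for u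
      using that by auto
    have sc: "sg (crit u i) = sg (crit v i)"
      if "i < Suc n" "u \<in> {x - e..x + e}" "v \<in> {x - e..x + e}" for i u v
    proof (cases "i = n")
      case True
      show ?thesis using pos(1)[OF that(2)] pos(1)[OF that(3)] by (simp add: sg_def True)
    next
      case False
      then show ?thesis using that(1) by (intro s pos that) auto
    qed
    have "l \<le> x - e" "x - e < x + e" "x + e \<le> r"
      using pos(2)[of "x - e"] pos(2)[of "x + e"] e lr by auto
    with sc show ?thesis by blast
  next
    case False
    define l2 where "l2 = (2 * l' + r') / 3"
    define r2 where "r2 = (l' + 2 * r') / 3"
    have lr2: "l' < l2" "l2 < r2" "r2 < r'" using lr by (auto simp: l2_def r2_def field_simps)
    have sc: "sg (crit u i) = sg (crit v i)"
      if "i < Suc n" "u \<in> {l2..r2}" "v \<in> {l2..r2}" for i u v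
    proof (cases "i = n")
      case True
      have "crit u n \<le> 0" "crit v n \<le> 0" using False that lr2 by (fastforce simp: not_less)+
      then show ?thesis by (simp add: sg_def True)
    next
      case False
      then show ?thesis using that lr2 by (intro s) auto
    qed
    have "l \<le> l2" "l2 < r2" "r2 \<le> r" using lr lr2 by auto
    with sc show ?thesis by blast
  qed
qed

lemma expanding_pair:
  assumes "sqrt 2 < l" "l < r" "r < 2"
  shows "\<exists>u v n. l \<le> v \<and> v < u \<and> u \<le> r \<and> X * (u - v) \<le> \<bar>crit u n - crit v n\<bar>"
proof -
  obtain l' r' m \<eta> where lr: "l \<le> l'" "l' < r'" "r' \<le> r" and T: "transversal l' r' m \<eta>"
    using exists_transversal[OF assms] by blast
  note T' = transversalD[OF T]
  have l'1: "1 < l'" using lr assms sqrt2_bounds by auto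
  obtain k where k: "X / \<eta> < l' ^ k" using real_arch_pow[OF l'1] by blast
  obtain v u where uv: "l' \<le> v" "v < u" "u \<le> r'"
    and s: "\<And>i x y. i < m + k \<Longrightarrow> x \<in> {v..u} \<Longrightarrow> y \<in> {v..u} \<Longrightarrow> sg (crit x i) = sg (crit y i)"
    using exists_sg_const[OF lr(2), of "m + k"] by blast
  have "(1 / (v - 1) + \<eta> * v ^ k) * (u - v) \<le> - orient v (m + k) * (crit u (m + k) - crit v (m + k))"
  proof -
    have "sg (crit u i) = sg (crit v i)" if "i < m + k" for i
      by (rule s) (use that uv in auto)
    then show ?thesis
      using transversal_growth[OF T, of v u "m + k"] uv lr assms by (simp del: mult_minus_left)
  qed
  also have "\<dots> \<le> \<bar>- orient v (m + k) * (crit u (m + k) - crit v (m + k))\<bar>" by (rule abs_ge_self)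
  also have "\<dots> = \<bar>crit u (m + k) - crit v (m + k)\<bar>" by (simp add: abs_mult)
  finally have 1: "(1 / (v - 1) + \<eta> * v ^ k) * (u - v) \<le> \<bar>crit u (m + k) - crit v (m + k)\<bar>" .
  have "X < \<eta> * l' ^ k" using k T'(2) by (simp add: field_simps)
  also have "\<dots> \<le> \<eta> * v ^ k" using T'(2) uv l'1 by (intro mult_left_mono power_mono) auto
  also have "\<dots> \<le> 1 / (v - 1) + \<eta> * v ^ k" using uv l'1 by simp
  finally have "X * (u - v) \<le> (1 / (v - 1) + \<eta> * v ^ k) * (u - v)"
    using uv by (intro mult_right_mono) auto
  with 1 have "X * (u - v) \<le> \<bar>crit u (m + k) - crit v (m + k)\<bar>" by linarith
  then show ?thesis using uv lr by (intro exI[of _ u] exI[of _ v] exI[of _ "m + k"]) auto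
qed

section \<open>Parameters whose critical orbit hits a prescribed point\<close>

definition fixpt :: "real \<Rightarrow> real" where
  "fixpt a = 1 / (1 + a)"

lemma tent_fixpt: "1 < a \<Longrightarrow> tent a (fixpt a) = fixpt a"
  by (simp add: tent_def fixpt_def field_simps)

lemma fixpt_bounds: "1 < a \<Longrightarrow> 0 < fixpt a \<and> fixpt a < 1"
  by (simp add: fixpt_def)

lemma continuous_on_fixpt: "S \<subseteq> {1<..} \<Longrightarrow> continuous_on S fixpt"
  unfolding fixpt_def by (auto intro!: continuous_intros)

lemma crit_diff_ge:
  assumes "1 < u" "1 < v" "v \<le> 2" "crit u n * crit v n \<ge> 0"
  shows "u * \<bar>crit u n - crit v n\<bar> - \<bar>u - v\<bar> \<le> \<bar>crit u (Suc n) - crit v (Suc n)\<bar>"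
proof -
  let ?A = "\<bar>crit u n\<bar>" and ?B = "\<bar>crit v n\<bar>"
  have "\<bar>?A - ?B\<bar> = \<bar>crit u n - crit v n\<bar>"
    using assms(4) by (auto simp: zero_le_mult_iff)
  then have "\<bar>u * (?A - ?B)\<bar> = u * \<bar>crit u n - crit v n\<bar>" using assms by (simp add: abs_mult)
  moreover have "\<bar>(u - v) * ?B\<bar> \<le> \<bar>u - v\<bar>"
    using mult_left_mono[OF abs_crit_le_1[of v n], of "\<bar>u - v\<bar>"] assms by (simp add: abs_mult)
  moreover have "crit u (Suc n) - crit v (Suc n) = - (u * (?A - ?B) + (u - v) * ?B)"
    by (simp only: crit_Suc) argo
  ultimately show ?thesis by linarith
qed

lemma IVT_between:
  fixes f :: "real \<Rightarrow> real"
  assumes "continuous_on {l..r} f" "x \<in> {l..r}" "y \<in> {l..r}" "f x \<le> 0" "0 \<le> f y"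
  shows "\<exists>z\<in>{l..r}. f z = 0"
proof -
  have "is_interval (f ` {l..r})"
    using connected_continuous_image[OF assms(1)] by (simp add: is_interval_connected_1)
  then have "0 \<in> f ` {l..r}"
    unfolding is_interval_1 using assms by blast
  then show ?thesis by auto
qed

text \<open>Otherwise, at each time either all parameters are at the fixed point or none is, and
  differences of orbits would grow without bound. On one side of 0 a step expands by
  \<open>l\<close>. If 0 lies in between, some \<open>z\<close> has \<open>crit z n = 0\<close>, and
  the orbit farther from 0 is compared with that of \<open>z\<close>. As
  \<open>crit z (Suc n) = 1\<close> is beyond the fixed point and no orbit can cross it, all orbits
  are then positive and a second expansion follows: two steps gain l^2 / 2 > 1. The parameter
  \<open>y\<close> guarantees that the hit is not shared by the whole interval.\<close>

lemma hit_fixpt: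
  assumes "sqrt 2 < l" "l < r" "r < 2"
  shows "\<exists>n. \<exists>x\<in>{l..r}. \<exists>y\<in>{l..r}. crit x n = fixpt x \<and> crit y n \<noteq> fixpt y"
proof (rule ccontr)
  assume "\<not> ?thesis"
  then have H: "crit x n = fixpt x \<longleftrightarrow> crit y n = fixpt y" if "x \<in> {l..r}" "y \<in> {l..r}" for x y n
    using that by blast
  have l1: "1 < l" using assms sqrt2_bounds by auto
  define \<theta> where "\<theta> = l\<^sup>2 / 2"
  have \<theta>: "1 < \<theta>" "\<theta> \<le> l"
  proof -
    have "sqrt 2 * sqrt 2 < l * l" using assms l1 by (intro mult_strict_mono) auto
    then show "1 < \<theta>" by (simp add: \<theta>_def power2_eq_square)
    show "\<theta> \<le> l" using assms l1 by (simp add: \<theta>_def power2_eq_square)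
  qed
  obtain u v m where uv: "l \<le> v" "v < u" "u \<le> r"
    and m: "(1 / (\<theta> - 1) + 1) * (u - v) \<le> \<bar>crit u m - crit v m\<bar>"
    using expanding_pair[OF assms] by blast
  define w where "w = u - v"
  have mem: "x \<in> {l..r}" "1 < x" "x \<le> 2" "l \<le> x" if "x \<in> {v..u}" for x using that uv l1 assms by auto
  have near: "\<bar>x - y\<bar> \<le> w" if "x \<in> {v..u}" "y \<in> {v..u}" for x y using that by (auto simp: w_def)
  have step: "l * \<bar>crit x n - crit y n\<bar> - w \<le> \<bar>crit x (Suc n) - crit y (Suc n)\<bar>"
    if "x \<in> {v..u}" "y \<in> {v..u}" "crit x n * crit y n \<ge> 0" for x y n
    using crit_diff_ge[of x y n] mem[OF that(1)] mem[OF that(2)] near[OF that(1,2)] that(3)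
      mult_right_mono[of l x "\<bar>crit x n - crit y n\<bar>"] by linarith
  have grow: "\<exists>n'. \<exists>x'\<in>{v..u}. \<exists>y'\<in>{v..u}. \<theta> * \<bar>crit x n - crit y n\<bar> - w \<le> \<bar>crit x' n' - crit y' n'\<bar>"
    if xy: "x \<in> {v..u}" "y \<in> {v..u}" for x y n
  proof (cases "crit x n * crit y n \<ge> 0")
    case True
    have "\<theta> * \<bar>crit x n - crit y n\<bar> \<le> l * \<bar>crit x n - crit y n\<bar>"
      using \<theta> by (intro mult_right_mono) auto
    then show ?thesis using step[OF xy True] xy by (meson diff_right_mono order_trans)
  next
    case False
    then have "crit x n \<le> 0 \<and> 0 \<le> crit y n \<or> crit y n \<le> 0 \<and> 0 \<le> crit x n"
      by (auto simp: zero_le_mult_iff)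
    then have "\<exists>z\<in>{v..u}. crit z n = 0"
      using IVT_between[OF continuous_on_crit, of x v u y n] IVT_between[OF continuous_on_crit, of y v u x n] xy
      by blast
    then obtain z where z: "z \<in> {v..u}" "crit z n = 0" by blast
    have "\<bar>crit x n - crit y n\<bar> \<le> \<bar>crit x n\<bar> + \<bar>crit y n\<bar>" by (rule abs_triangle_ineq4)
    then have "\<exists>t\<in>{v..u}. \<bar>crit x n - crit y n\<bar> / 2 \<le> \<bar>crit t n\<bar>"
    proof (cases "\<bar>crit x n\<bar> \<le> \<bar>crit y n\<bar>")
      case True
      then show ?thesis using xy \<open>\<bar>crit x n - crit y n\<bar> \<le> _\<close> by (intro bexI[of _ y]) auto
    next
      case False
      then show ?thesis using xy \<open>\<bar>crit x n - crit y n\<bar> \<le> _\<close> by (intro bexI[of _ x]) auto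
    qed
    then obtain t where t: "t \<in> {v..u}" "\<bar>crit x n - crit y n\<bar> / 2 \<le> \<bar>crit t n\<bar>" by blast
    have z1: "crit z (Suc n) = 1" using z by (simp add: crit_Suc)
    have pos: "0 < crit s (Suc n)" if s: "s \<in> {v..u}" for s
    proof (rule ccontr)
      assume "\<not> 0 < crit s (Suc n)"
      then have "crit s (Suc n) - fixpt s \<le> 0" "0 \<le> crit z (Suc n) - fixpt z"
        using fixpt_bounds[of s] fixpt_bounds[of z] mem[OF s] mem[OF z(1)] z1 by auto
      moreover have "continuous_on {v..u} (\<lambda>a. crit a (Suc n) - fixpt a)"
        using mem by (intro continuous_intros continuous_on_crit continuous_on_fixpt) auto
      ultimately obtain s' where s': "s' \<in> {v..u}" "crit s' (Suc n) - fixpt s' = 0"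
        using IVT_between[of v u "\<lambda>a. crit a (Suc n) - fixpt a" s z] s z by blast
      then have "crit z (Suc n) = fixpt z" using H[of z s' "Suc n"] mem[OF z(1)] mem[of s'] by simp
      then show False using z1 fixpt_bounds[of z] mem[OF z(1)] by simp
    qed
    have "l * (\<bar>crit x n - crit y n\<bar> / 2) \<le> t * \<bar>crit t n\<bar>"
      using t mem[OF t(1)] by (intro mult_mono) auto
    also have "\<dots> = \<bar>crit t (Suc n) - crit z (Suc n)\<bar>"
      using mem[OF t(1)] unfolding z1 by (simp add: crit_Suc)
    finally have "l * (l * (\<bar>crit x n - crit y n\<bar> / 2)) \<le> l * \<bar>crit t (Suc n) - crit z (Suc n)\<bar>"
      using l1 by (intro mult_left_mono) auto
    moreover have "l * (l * (\<bar>crit x n - crit y n\<bar> / 2)) = \<theta> * \<bar>crit x n - crit y n\<bar>"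
      by (simp add: \<theta>_def power2_eq_square)
    moreover have "l * \<bar>crit t (Suc n) - crit z (Suc n)\<bar> - w \<le> \<bar>crit t (Suc (Suc n)) - crit z (Suc (Suc n))\<bar>"
      using pos[OF t(1)] pos[OF z(1)] by (intro step t z) auto
    ultimately have "\<theta> * \<bar>crit x n - crit y n\<bar> - w \<le> \<bar>crit t (Suc (Suc n)) - crit z (Suc (Suc n))\<bar>"
      by linarith
    then show ?thesis using t z by blast
  qed
  \<comment> \<open>The map D -> \<theta> D - w has the fixed point w / (\<theta> - 1), and the
    initial difference exceeds it by w.\<close>
  have "\<exists>n. \<exists>x\<in>{v..u}. \<exists>y\<in>{v..u}. (1 / (\<theta> - 1) + \<theta> ^ k) * w \<le> \<bar>crit x n - crit y n\<bar>" for k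
  proof (induction k)
    case 0
    show ?case
      by (rule exI[of _ m], rule bexI[of _ u], rule bexI[of _ v]) (use m uv in \<open>simp_all add: w_def\<close>)
  next
    case (Suc k)
    then obtain n x y where xy: "x \<in> {v..u}" "y \<in> {v..u}"
      "(1 / (\<theta> - 1) + \<theta> ^ k) * w \<le> \<bar>crit x n - crit y n\<bar>" by blast
    obtain n' x' y' where xy': "x' \<in> {v..u}" "y' \<in> {v..u}"
      "\<theta> * \<bar>crit x n - crit y n\<bar> - w \<le> \<bar>crit x' n' - crit y' n'\<bar>" using grow[OF xy(1,2)] by blast
    have "\<theta> * ((1 / (\<theta> - 1) + \<theta> ^ k) * w) \<le> \<theta> * \<bar>crit x n - crit y n\<bar>"
      using xy \<theta> by (intro mult_left_mono) auto
    moreover have "\<theta> * ((1 / (\<theta> - 1) + \<theta> ^ k) * w) = (1 / (\<theta> - 1) + \<theta> ^ Suc k) * w + w"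
    proof -
      have 1: "\<theta> * (1 / (\<theta> - 1)) = 1 / (\<theta> - 1) + 1" using \<theta> by (simp add: field_simps)
      have "\<theta> * ((1 / (\<theta> - 1) + \<theta> ^ k) * w) = (\<theta> * (1 / (\<theta> - 1)) + \<theta> ^ Suc k) * w"
        by (simp add: algebra_simps)
      then show ?thesis unfolding 1 by (simp add: algebra_simps)
    qed
    ultimately have "(1 / (\<theta> - 1) + \<theta> ^ Suc k) * w \<le> \<bar>crit x' n' - crit y' n'\<bar>"
      using xy'(3) by linarith
    then show ?case using xy' by blast
  qed
  note big = this
  obtain k where k: "2 / w < \<theta> ^ k" using real_arch_pow[OF \<theta>(1)] by blast
  obtain n x y where xy: "x \<in> {v..u}" "y \<in> {v..u}"
    "(1 / (\<theta> - 1) + \<theta> ^ k) * w \<le> \<bar>crit x n - crit y n\<bar>" using big by blast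
  have w: "w > 0" using uv by (simp add: w_def)
  have "2 < \<theta> ^ k * w" using k w by (simp add: field_simps)
  also have "\<dots> \<le> (1 / (\<theta> - 1) + \<theta> ^ k) * w" using w \<theta> by (intro mult_right_mono) auto
  finally show False
    using xy abs_crit_le_1[of x n] abs_crit_le_1[of y n] mem[of x] mem[of y] by linarith
qed

text \<open>The orbit of \<open>x\<close> stays at the fixed point, while that of \<open>y\<close>
  is repelled by it as long as it remains positive. It cannot remain positive forever, so some
  parameter \<open>z\<close> has an orbit that hits 0 and is at 1 one step later. At that time the
  orbits of \<open>x\<close> and \<open>z\<close> lie on opposite sides of \<zeta>.\<close>

lemma hit_continuous:
  assumes J: "sqrt 2 < l" "l < r" "r < 2"
    and \<zeta>: "continuous_on {l..r} \<zeta>" "\<And>a. a \<in> {l..r} \<Longrightarrow> fixpt a \<le> \<zeta> a" "\<And>a. a \<in> {l..r} \<Longrightarrow> \<zeta> a \<le> 1"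
  shows "\<exists>n. \<exists>a\<in>{l..r}. crit a n = \<zeta> a"
proof -
  have l1: "1 < l" using J sqrt2_bounds by auto
  obtain n x y where xy: "x \<in> {l..r}" "y \<in> {l..r}" "crit x n = fixpt x" "crit y n \<noteq> fixpt y"
    using hit_fixpt[OF J] by blast
  have x: "crit x (n + k) = fixpt x" for k
    by (induction k) (use xy l1 in \<open>simp_all add: crit_Suc_tent tent_fixpt\<close>)
  have "\<exists>k. \<exists>z\<in>{l..r}. crit z (n + k) = 0"
  proof (rule ccontr)
    assume "\<not> ?thesis"
    then have nz: "crit z (n + k) \<noteq> 0" if "z \<in> {l..r}" for z k using that by blast
    have pos: "0 < crit y (n + k)" for k
    proof (rule ccontr)
      assume "\<not> 0 < crit y (n + k)"
      then have "\<exists>z\<in>{l..r}. crit z (n + k) = 0"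
        using xy x[of k] fixpt_bounds[of x] l1 by (intro IVT_between[OF continuous_on_crit, of y _ _ x]) auto
      then show False using nz by blast
    qed
    have "\<bar>crit y (n + k) - fixpt y\<bar> = y ^ k * \<bar>crit y n - fixpt y\<bar>" for k
    proof (induction k)
      case (Suc k)
      have "crit y (n + Suc k) - fixpt y = tent y (crit y (n + k)) - tent y (fixpt y)"
        using xy l1 by (simp add: crit_Suc_tent tent_fixpt)
      also have "\<dots> = - y * (crit y (n + k) - fixpt y)"
        using pos[of k] fixpt_bounds[of y] xy l1 by (simp add: tent_def algebra_simps)
      also have "\<bar>\<dots>\<bar> = y * \<bar>crit y (n + k) - fixpt y\<bar>" using xy l1 by (simp add: abs_mult)
      finally show ?case unfolding Suc by simp
    qed simp
    moreover obtain k where "2 / \<bar>crit y n - fixpt y\<bar> < y ^ k"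
      using real_arch_pow[of y] xy l1 by auto
    ultimately have "2 < \<bar>crit y (n + k) - fixpt y\<bar>" using xy(4) by (simp add: field_simps)
    moreover have "\<bar>crit y (n + k)\<bar> \<le> 1" using xy J l1 by (intro abs_crit_le_1) auto
    moreover have "0 < fixpt y \<and> fixpt y < 1" using xy l1 by (intro fixpt_bounds) auto
    ultimately show False by linarith
  qed
  then obtain k z where z: "z \<in> {l..r}" "crit z (n + k) = 0" by blast
  have "\<exists>a\<in>{l..r}. crit a (n + Suc k) - \<zeta> a = 0"
  proof (rule IVT_between)
    show "continuous_on {l..r} (\<lambda>a. crit a (n + Suc k) - \<zeta> a)"
      by (intro continuous_intros continuous_on_crit \<zeta>)
    show "crit x (n + Suc k) - \<zeta> x \<le> 0" unfolding x using \<zeta>(2)[OF xy(1)] by simp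
    show "0 \<le> crit z (n + Suc k) - \<zeta> z" using z \<zeta>(3)[OF z(1)] by (simp add: crit_Suc)
  qed (use xy z in auto)
  then show ?thesis by auto
qed

section \<open>Cycles with one positive point\<close>

definition cycle_point :: "nat \<Rightarrow> real \<Rightarrow> real" where
  "cycle_point q a = (a ^ q - 1) / ((a - 1) * (a ^ q + 1))"

text \<open>One step on the right branch is followed by steps x -> 1 + a x, which multiply the
  distance from -1 / (a - 1) by \<open>a\<close>; requiring a return after \<open>q\<close> steps
  yields \<open>cycle_point\<close>. The bound on a^(q - 1) (2 - a) says exactly that the formula is
  negative for i = q - 1, and hence for all smaller i.\<close>

lemma cycle_point_iterate:
  assumes "1 < a" "a ^ (q - 1) * (2 - a) < 1" "1 \<le> i" "i \<le> q"
  shows "(tent a ^^ i) (cycle_point q a) = (2 * a ^ i / (a ^ q + 1) - 1) / (a - 1)"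
  using assms(3,4)
proof (induction i rule: dec_induct)
  case base
  have "a ^ q > 1" using base assms by (intro one_less_power) auto
  then have "cycle_point q a > 0"
    using assms unfolding cycle_point_def by (intro divide_pos_pos mult_pos_pos add_pos_pos) auto
  then have "(tent a ^^ 1) (cycle_point q a) = 1 - a * cycle_point q a" by (simp add: tent_def)
  also have "\<dots> = (2 * a ^ 1 / (a ^ q + 1) - 1) / (a - 1)"
  proof -
    have "a - 1 \<noteq> 0" "a ^ q + 1 \<noteq> 0" using assms(1) \<open>a ^ q > 1\<close> by auto
    then show ?thesis unfolding cycle_point_def by (simp add: divide_simps) (simp add: algebra_simps)
  qed
  finally show ?case .
next
  case (step i)
  have q: "a ^ q = a * a ^ (q - 1)" using step by (cases q) auto
  have "a ^ i \<le> a ^ (q - 1)" using step assms by (intro power_increasing) auto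
  moreover have "2 * a ^ (q - 1) < a ^ q + 1" using assms(2) unfolding q by (simp add: algebra_simps)
  ultimately have lt: "2 * a ^ i < a ^ q + 1" by linarith
  have pos: "a ^ q + 1 > 0" using assms by (simp add: add_pos_pos)
  have "(2 * a ^ i / (a ^ q + 1) - 1) / (a - 1) < 0"
    using lt pos assms by (simp add: divide_less_0_iff)
  moreover have "(tent a ^^ i) (cycle_point q a) = (2 * a ^ i / (a ^ q + 1) - 1) / (a - 1)"
    using step by simp
  ultimately have "(tent a ^^ i) (cycle_point q a) < 0"
    and IH: "(tent a ^^ i) (cycle_point q a) = (2 * a ^ i / (a ^ q + 1) - 1) / (a - 1)"
    by simp_all
  moreover have "tent a x = 1 + a * x" if "x < 0" for x using that by (simp add: tent_def)
  ultimately have "(tent a ^^ Suc i) (cycle_point q a) = 1 + a * (tent a ^^ i) (cycle_point q a)"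
    unfolding funpow.simps o_apply by blast
  also have "\<dots> = 1 + a * ((2 * a ^ i / (a ^ q + 1) - 1) / (a - 1))"
    unfolding IH ..
  also have "\<dots> = (2 * a ^ Suc i / (a ^ q + 1) - 1) / (a - 1)"
  proof -
    have "a - 1 \<noteq> 0" "a ^ q + 1 \<noteq> 0" using assms(1) pos by auto
    then show ?thesis by (simp add: divide_simps) (simp add: algebra_simps)
  qed
  finally show ?case .
qed

lemma cycle_point_neg:
  assumes "1 < a" "a ^ (q - 1) * (2 - a) < 1" "1 \<le> i" "i < q"
  shows "(tent a ^^ i) (cycle_point q a) < 0"
proof -
  have q: "a ^ q = a * a ^ (q - 1)" using assms by (cases q) auto
  have "a ^ i \<le> a ^ (q - 1)" using assms by (intro power_increasing) auto
  moreover have "2 * a ^ (q - 1) < a ^ q + 1" using assms(2) unfolding q by (simp add: algebra_simps)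
  ultimately have lt: "2 * a ^ i < a ^ q + 1" by linarith
  have pos: "a ^ q + 1 > 0" using assms by (simp add: add_pos_pos)
  then have "(2 * a ^ i / (a ^ q + 1) - 1) / (a - 1) < 0"
    using lt assms by (simp add: divide_less_0_iff)
  then show ?thesis using cycle_point_iterate[OF assms(1,2,3)] assms(4) by simp
qed

lemma cycle_point_periodic:
  assumes "1 < a" "a ^ (q - 1) * (2 - a) < 1" "1 \<le> q"
  shows "(tent a ^^ q) (cycle_point q a) = cycle_point q a"
proof -
  have "a ^ q + 1 > 0" using assms by (simp add: add_pos_pos)
  then have "(2 * a ^ q / (a ^ q + 1) - 1) / (a - 1) = cycle_point q a"
    using assms by (simp add: cycle_point_def divide_simps)
  then show ?thesis using cycle_point_iterate[OF assms(1,2,3)] by simp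
qed

lemma cycle_point_pos: "1 < a \<Longrightarrow> 1 \<le> q \<Longrightarrow> 0 < cycle_point q a"
  using one_less_power[of a q] unfolding cycle_point_def
  by (intro divide_pos_pos mult_pos_pos add_pos_pos) auto

lemma cycle_point_1: "1 < a \<Longrightarrow> cycle_point 1 a = fixpt a"
  by (simp add: cycle_point_def fixpt_def add.commute)

lemma cycle_point_ge_fixpt:
  assumes "1 < a" "1 \<le> q"
  shows "fixpt a \<le> cycle_point q a"
proof -
  have "a ^ 1 \<le> a ^ q" using assms by (intro power_increasing) auto
  then have "(a - 1) / (a + 1) \<le> (a ^ q - 1) / (a ^ q + 1)"
    using assms by (simp add: frac_le_eq divide_le_0_iff) (simp add: algebra_simps)
  then have "(a - 1) / (a + 1) / (a - 1) \<le> (a ^ q - 1) / (a ^ q + 1) / (a - 1)"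
    using assms by (intro divide_right_mono) auto
  then show ?thesis using assms by (simp add: fixpt_def cycle_point_def add.commute mult.commute)
qed

lemma cycle_point_less_1:
  assumes "1 < a" "1 \<le> q" "a ^ (q - 1) * (2 - a) < 1"
  shows "cycle_point q a < 1"
proof -
  have q: "a ^ q = a * a ^ (q - 1)" using assms by (cases q) auto
  have "a * (a ^ (q - 1) * (2 - a)) < a * 1" using assms by (intro mult_strict_left_mono) auto
  then have "a ^ q * (2 - a) < a" unfolding q by (simp add: mult.assoc)
  then have "a ^ q - 1 < (a - 1) * (a ^ q + 1)" by (simp add: algebra_simps)
  moreover have "0 < (a - 1) * (a ^ q + 1)" using assms by (simp add: add_pos_pos)
  ultimately show ?thesis by (simp add: cycle_point_def)
qed

lemma cycle_point_gt:
  assumes "1 < a" "a < 2" "1 \<le> q" "1 \<le> a ^ q * (2 - a)"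
  shows "a - 1 < cycle_point q a"
proof -
  have "a \<le> a * (a ^ q * (2 - a))" using assms by simp
  moreover have "0 < (a - 1) * (2 - a)" using assms by simp
  ultimately have "a\<^sup>2 - 2 * a + 2 < a ^ q * (a * (2 - a))" by (simp add: algebra_simps power2_eq_square)
  then have "(a - 1) * ((a - 1) * (a ^ q + 1)) < a ^ q - 1" by (simp add: algebra_simps power2_eq_square)
  moreover have "0 < (a - 1) * (a ^ q + 1)" using assms by (simp add: add_pos_pos)
  ultimately show ?thesis by (simp add: cycle_point_def less_divide_eq)
qed

lemma continuous_on_cycle_point:
  assumes "S \<subseteq> {1<..}"
  shows "continuous_on S (cycle_point q)"
proof -
  have "(a - 1) * (a ^ q + 1) \<noteq> 0" if "a \<in> S" for a
  proof -
    have "0 < a ^ q" using assms that by auto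
    then show ?thesis using assms that by auto
  qed
  then show ?thesis unfolding cycle_point_def by (intro continuous_intros) auto
qed

text \<open>The least exponent with 1 <= a^q (2 - a) is taken. By minimality the cycle of length
  \<open>q\<close> exists, and it is the longest of its kind; \<open>cycle_point_gt\<close> then
  puts its positive point outside the core.\<close>

lemma exists_cycle_length:
  fixes a :: real
  assumes "1 < a" "a < 2"
  shows "\<exists>q\<ge>1. a ^ (q - 1) * (2 - a) < 1 \<and> 1 \<le> a ^ q * (2 - a)"
proof -
  obtain k where "1 / (2 - a) < a ^ k" using real_arch_pow[OF assms(1)] by blast
  then have ex: "1 \<le> a ^ k * (2 - a)" using assms by (simp add: field_simps)
  define q where "q = (LEAST k. 1 \<le> a ^ k * (2 - a))"
  have q: "1 \<le> a ^ q * (2 - a)" unfolding q_def by (rule LeastI[of _ k]) (rule ex)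
  have "q \<noteq> 0" using q assms by (intro notI) simp
  moreover have "\<not> 1 \<le> a ^ (q - 1) * (2 - a)"
    using \<open>q \<noteq> 0\<close> not_less_Least[of "q - 1" "\<lambda>k. 1 \<le> a ^ k * (2 - a)"] by (simp add: q_def)
  ultimately show ?thesis using q by (intro exI[of _ q]) auto
qed

text \<open>This is the exponent smaller than 1: the cycle visits the core q - 1 times per period.
  For q >= 4 the hypothesis forces q (2 - a) < 1, and Bernoulli's inequality gives (a / 2)^q > 1/2.
  Shorter cycles are checked directly.\<close>

lemma two_power_less:
  assumes a: "sqrt 2 < a" "a < 2" and q: "1 \<le> q" "a ^ (q - 1) * (2 - a) < 1"
  shows "2 ^ (q - 1) < a ^ q"
proof -
  have a1: "1 < a" using a sqrt2_bounds by auto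
  have "sqrt 2 * sqrt 2 < a * a" using a a1 by (intro mult_strict_mono) auto
  then have a2: "2 < a * a" by simp
  consider "q = 1" | "q = 2" | "3 \<le> q" using q by linarith
  then show ?thesis
  proof cases
    case 3
    have "a ^ 2 \<le> a ^ (q - 1)" using 3 a1 by (intro power_increasing) auto
    then have "a ^ 2 * (2 - a) \<le> a ^ (q - 1) * (2 - a)" using a by (intro mult_right_mono) auto
    then have "a ^ 2 * (2 - a) < 1" using q by simp
    \<comment> \<open>Thus \<open>a\<close> exceeds the golden mean, hence 1.6. As 1.6^3 > 4, this
      settles q = 3 and starts the induction for q <= 1.6^(q - 1) at q = 4.\<close>
    then have "0 < (a - 1) * (a * a - a - 1)" by (simp add: algebra_simps power2_eq_square)
    then have gold: "a + 1 < a * a" using a1 by (simp add: zero_less_mult_iff)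
    have a16: "1.6 < a"
    proof (rule ccontr)
      assume "\<not> 1.6 < a"
      then have "a * a \<le> 1.6 * a" using a1 by (intro mult_right_mono) auto
      then show False using gold \<open>\<not> 1.6 < a\<close> by simp
    qed
    show ?thesis
    proof (cases "q = 3")
      case True
      have "1.6 ^ 3 < a ^ 3" using a16 by (intro power_strict_mono) auto
      then show ?thesis by (simp add: True power3_eq_cube)
    next
      case False
      then have q4: "4 \<le> q" using 3 by simp
      have "real q \<le> 1.6 ^ (q - 1)" using q4
      proof (induction q rule: dec_induct)
        case (step n)
        have "real (Suc n) \<le> 1.6 * real n" using step by simp
        also have "\<dots> \<le> 1.6 * 1.6 ^ (n - 1)" using step by simp
        also have "\<dots> = 1.6 ^ (Suc n - 1)" using step by (cases n) auto
        finally show ?case .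
      qed (simp add: power3_eq_cube)
      also have "\<dots> < a ^ (q - 1)" using a16 q4 by (intro power_strict_mono) auto
      finally have "real q * (2 - a) < a ^ (q - 1) * (2 - a)" using a by simp
      then have "real q * (2 - a) < 1" using q by simp
      moreover have "1 + real q * (a / 2 - 1) \<le> (a / 2) ^ q"
        using Bernoulli_inequality[of "a / 2 - 1" q] a1 by simp
      ultimately have "1 / 2 < (a / 2) ^ q" by (simp add: algebra_simps)
      then have "2 ^ q < 2 * a ^ q" by (simp add: power_divide field_simps)
      then show ?thesis using q by (cases q) auto
    qed
  qed (use a1 a2 in \<open>auto simp: power2_eq_square\<close>)
qed

section \<open>Entropy and averages of measure-preserving maps\<close>

lemma fekete:
  fixes u :: "nat \<Rightarrow> real"
  assumes nonneg: "\<And>n. 0 \<le> u n" and sub: "\<And>m n. u (m + n) \<le> u m + u n"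
  shows "convergent (\<lambda>n. u n / real n)"
proof -
  define L where "L = (INF n\<in>{1..}. u n / real n)"
  have bdd: "bdd_below ((\<lambda>n. u n / real n) ` {1..})"
    by (intro bdd_belowI[of _ 0]) (auto simp: nonneg)
  have "(\<lambda>n. u n / real n) \<longlonglongrightarrow> L"
  proof (rule LIMSEQ_I)
    fix e :: real assume e: "e > 0"
    have "\<exists>n\<in>{1..}. u n / real n < L + e / 2"
    proof (rule ccontr)
      assume "\<not> ?thesis"
      then have "L + e / 2 \<le> L" unfolding L_def by (intro cINF_greatest) (auto simp: not_less)
      then show False using e by simp
    qed
    then obtain p where p: "1 \<le> p" "u p / real p < L + e / 2" by auto
    have mult: "u (k * p + j) \<le> real k * u p + u j" for k j
    proof (induction k)
      case (Suc k)
      then show ?case using sub[of p "k * p + j"] by (simp add: algebra_simps)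
    qed simp
    define C where "C = (\<Sum>j<p. u j)"
    have C: "u j \<le> C" if "j < p" for j
      unfolding C_def using that by (intro member_le_sum nonneg) auto
    have "\<forall>\<^sub>F n in sequentially. C / real n < e / 2"
      using e by (intro order_tendstoD(2)[OF lim_const_over_n]) auto
    then obtain N where N: "\<And>n. n \<ge> N \<Longrightarrow> C / real n < e / 2"
      unfolding eventually_sequentially by blast
    have "norm (u n / real n - L) < e" if n: "n \<ge> max N 1" for n
    proof -
      have "u n \<le> real (n div p) * u p + u (n mod p)"
        using mult[of "n div p" "n mod p"] by simp
      also have "u (n mod p) \<le> C" using p by (intro C) auto
      also have "real (n div p) * u p \<le> real n / real p * u p"
      proof (rule mult_right_mono[OF _ nonneg])
        have "real (n div p * p) \<le> real n" by (simp only: of_nat_le_iff div_times_less_eq_dividend)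
        then show "real (n div p) \<le> real n / real p" using p by (simp add: field_simps)
      qed
      finally have "u n / real n \<le> (real n / real p * u p + C) / real n"
        by (intro divide_right_mono) auto
      also have "\<dots> = u p / real p + C / real n" using n by (simp add: add_divide_distrib)
      also have "\<dots> < L + e" using p(2) N[of n] n by linarith
      finally have "u n / real n < L + e" .
      moreover have "L \<le> u n / real n" unfolding L_def by (rule cINF_lower[OF bdd]) (use n in auto)
      ultimately show ?thesis by simp
    qed
    then show "\<exists>no. \<forall>n\<ge>no. norm (u n / real n - L) < e" by blast
  qed
  then show ?thesis by (auto simp: convergent_def)
qed

section \<open>Entropy of simple functions and of their itineraries\<close>

definition ent :: "'a measure \<Rightarrow> ('a \<Rightarrow> 'b) \<Rightarrow> real" where
  "ent M X = - (\<Sum>y\<in>X ` space M. measure M (X -` {y} \<inter> space M) * ln (measure M (X -` {y} \<inter> space M)))"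

definition itinerary :: "('a \<Rightarrow> 'a) \<Rightarrow> ('a \<Rightarrow> 'b) \<Rightarrow> nat \<Rightarrow> 'a \<Rightarrow> 'b list" where
  "itinerary T X n x = map (\<lambda>i. X ((T ^^ i) x)) [0..<n]"

lemma length_itinerary [simp]: "length (itinerary T X n x) = n"
  by (simp add: itinerary_def)

lemma itinerary_0 [simp]: "itinerary T X 0 x = []"
  by (simp add: itinerary_def)

lemma map_upt_add: "map f [0..<m + n] = map f [0..<m] @ map (\<lambda>i. f (i + m)) [0..<n]"
  by (rule nth_equalityI) (auto simp: nth_append)

lemma itinerary_add: "itinerary T X (m + n) x = itinerary T X m x @ itinerary T X n ((T ^^ m) x)"
  by (simp add: itinerary_def map_upt_add funpow_add)

lemma itinerary_Suc: "itinerary T X (Suc n) x = itinerary T X n x @ [X ((T ^^ n) x)]"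
  by (simp add: itinerary_def)

lemma take_drop_itinerary:
  assumes "i + m \<le> n"
  shows "take m (drop i (itinerary T X n x)) = itinerary T X m ((T ^^ i) x)"
proof -
  obtain k where k: "n = i + m + k" using assms le_Suc_ex by blast
  show ?thesis unfolding k add.assoc itinerary_add by simp
qed

context prob_space
begin

lemma prob_mult_ln_nonpos: "prob A * ln (prob A) \<le> 0"
proof (cases "prob A = 0")
  case False
  then have "0 < prob A" by (simp add: zero_less_measure_iff)
  then show ?thesis by (intro mult_nonneg_nonpos) (auto simp: prob_le_1)
qed simp

lemma ent_nonneg: "0 \<le> ent M X"
  using prob_mult_ln_nonpos unfolding ent_def by (simp add: sum_nonpos)

lemma ent_eq_entropy:
  assumes "simple_function M X"
  shows "ent M X = entropy (exp 1) (count_space (X ` space M)) X"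
proof -
  interpret information_space M "exp 1" by standard simp
  show ?thesis
    using entropy_simple_distributed[OF simple_distributedI[OF assms measure_nonneg refl]]
    by (simp add: ent_def log_def)
qed

lemma ent_comp_le:
  assumes "simple_function M X"
  shows "ent M (\<lambda>x. f (X x)) \<le> ent M X"
proof -
  interpret information_space M "exp 1" by standard simp
  show ?thesis using entropy_data_processing[OF assms, of f] assms simple_function_compose1[OF assms, of f]
    by (simp add: ent_eq_entropy comp_def)
qed

lemma ent_Pair_le:
  assumes "simple_function M X" "simple_function M Y"
  shows "ent M (\<lambda>x. (X x, Y x)) \<le> ent M X + ent M Y"
proof -
  interpret information_space M "exp 1" by standard simp
  have "entropy (exp 1) (count_space ((\<lambda>x. (X x, Y x)) ` space M)) (\<lambda>x. (X x, Y x))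
    \<le> entropy (exp 1) (count_space (X ` space M)) X + entropy (exp 1) (count_space (Y ` space M)) Y"
    using entropy_chain_rule[OF assms] conditional_entropy_less_eq_entropy[OF assms(2,1)] by simp
  then show ?thesis using assms by (simp add: ent_eq_entropy simple_function_Pair)
qed

lemma ent_le_of_fun:
  assumes "simple_function M X" "\<And>x. x \<in> space M \<Longrightarrow> Y x = f (X x)"
  shows "ent M Y \<le> ent M X"
proof -
  have "Y ` space M = (\<lambda>x. f (X x)) ` space M" using assms(2) by (rule image_cong[OF refl])
  moreover have "Y -` {y} \<inter> space M = (\<lambda>x. f (X x)) -` {y} \<inter> space M" for y using assms(2) by auto
  ultimately have "ent M Y = ent M (\<lambda>x. f (X x))" by (simp add: ent_def)
  then show ?thesis using ent_comp_le[OF assms(1)] by simp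
qed

text \<open>A value \<open>Some z\<close> has probability at most \<epsilon> and -t ln t <= 2 sqrt
  t; the value \<open>None\<close> has probability at least 1 - \<epsilon> and -t ln t <= 1 - t. The
  bound is for a variable that corrects the rare errors of a guess.\<close>

lemma ent_Some_None_le:
  assumes X: "simple_function M X" and B: "B \<in> sets M" and \<epsilon>: "prob B \<le> \<epsilon>" "0 < \<epsilon>"
  shows "ent M (\<lambda>x. if x \<in> B then Some (X x) else None) \<le> \<epsilon> + real (card (X ` space M)) * (2 * sqrt \<epsilon>)"
proof -
  let ?e = "\<lambda>x. if x \<in> B then Some (X x) else None"
  let ?\<eta> = "\<lambda>y. - (prob (?e -` {y} \<inter> space M) * ln (prob (?e -` {y} \<inter> space M)))"
  have fin: "finite (X ` space M)" using X by (rule simple_functionD)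
  have neglog: "- (t * ln t) \<le> 2 * sqrt t" if "0 \<le> t" for t :: real
  proof (cases "t = 0")
    case False
    then have t: "0 < t" using that by simp
    have "ln (1 / sqrt t) \<le> 1 / sqrt t" using t by (intro ln_le_minus_one[THEN order_trans]) auto
    then have "- ln t \<le> 2 / sqrt t" using t by (simp add: ln_div ln_sqrt)
    then have "t * (- ln t) \<le> t * (2 / sqrt t)" using t by (intro mult_left_mono) auto
    also have "\<dots> = 2 * sqrt t" using t by (simp add: real_div_sqrt field_simps)
    finally show ?thesis by simp
  qed simp
  have \<eta>0: "0 \<le> ?\<eta> y" for y
    using prob_mult_ln_nonpos by simp
  have Some: "?\<eta> (Some z) \<le> 2 * sqrt \<epsilon>" for z
  proof -
    have "prob (?e -` {Some z} \<inter> space M) \<le> prob B"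
      by (rule finite_measure_mono) (auto simp: B split: if_splits)
    then show ?thesis using neglog[OF measure_nonneg] \<epsilon> by (smt (verit) real_sqrt_le_iff)
  qed
  have None: "?\<eta> None \<le> \<epsilon>"
  proof -
    define t where "t = prob (?e -` {None} \<inter> space M)"
    have "?e -` {None} \<inter> space M = space M - B" using sets.sets_into_space[OF B] by auto
    then have t: "t = 1 - prob B" by (simp add: t_def prob_compl B)
    show ?thesis
    proof (cases "t = 0")
      case False
      then have t0: "t > 0" using t prob_le_1[of B] by linarith
      have "ln (1 / t) \<le> 1 / t - 1" using t0 by (intro ln_le_minus_one) auto
      then have "t * - ln t \<le> t * (1 / t - 1)" using t0 by (intro mult_left_mono) (auto simp: ln_div)
      also have "\<dots> = 1 - t" using t0 by (simp add: field_simps)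
      finally show ?thesis using t \<epsilon> by (simp add: t_def)
    qed (use \<epsilon> in \<open>simp add: t_def\<close>)
  qed
  have "ent M ?e = (\<Sum>y\<in>?e ` space M. ?\<eta> y)" by (simp add: ent_def sum_negf)
  also have "\<dots> \<le> (\<Sum>y\<in>insert None (Some ` X ` space M). ?\<eta> y)"
    by (rule sum_mono2) (use fin \<eta>0 in auto)
  also have "\<dots> = ?\<eta> None + (\<Sum>y\<in>Some ` X ` space M. ?\<eta> y)" using fin by (subst sum.insert) auto
  also have "\<dots> \<le> \<epsilon> + (\<Sum>y\<in>Some ` X ` space M. 2 * sqrt \<epsilon>)"
    by (intro add_mono None sum_mono) (use Some in blast)
  also have "\<dots> = \<epsilon> + real (card (X ` space M)) * (2 * sqrt \<epsilon>)" by (simp add: card_image)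
  finally show ?thesis .
qed

end

locale measure_preserving = prob_space +
  fixes T
  assumes T_meas [measurable]: "T \<in> measurable M M" and T_inv: "distr M M T = M"
begin

lemma funpow_meas [measurable]: "T ^^ n \<in> measurable M M"
  by (induction n) (auto simp: measurable_comp)

lemma distr_funpow: "distr M M (T ^^ n) = M"
proof (induction n)
  case 0
  then show ?case by (simp add: id_def distr_id2)
next
  case (Suc n)
  have "distr (distr M M (T ^^ n)) M T = distr M M (T \<circ> T ^^ n)"
    by (rule distr_distr) auto
  then show ?case using Suc T_inv by (simp add: comp_def)
qed

lemma measure_vimage_funpow:
  "A \<in> sets M \<Longrightarrow> measure M ((T ^^ n) -` A \<inter> space M) = measure M A"
  using measure_distr[OF funpow_meas, of A n] by (simp add: distr_funpow)

lemma integral_funpow: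
  fixes f :: "_ \<Rightarrow> real"
  assumes [measurable]: "f \<in> borel_measurable M"
  shows "(\<integral>x. f ((T ^^ n) x) \<partial>M) = (\<integral>x. f x \<partial>M)"
  using integral_distr[OF funpow_meas assms, of n] by (simp add: distr_funpow)

lemma funpow_space: "x \<in> space M \<Longrightarrow> (T ^^ n) x \<in> space M"
  using measurable_space[OF funpow_meas] .

lemma simple_function_funpow:
  assumes "simple_function M X"
  shows "simple_function M (\<lambda>x. X ((T ^^ n) x))"
  unfolding simple_function_def
proof safe
  show "finite ((\<lambda>x. X ((T ^^ n) x)) ` space M)"
    using simple_functionD(1)[OF assms] by (rule rev_finite_subset) (auto simp: funpow_space)
  fix x assume "x \<in> space M"
  have "(\<lambda>x. X ((T ^^ n) x)) -` {X ((T ^^ n) x)} \<inter> space M = (T ^^ n) -` (X -` {X ((T ^^ n) x)} \<inter> space M) \<inter> space M"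
    by (auto simp: funpow_space)
  then show "(\<lambda>x. X ((T ^^ n) x)) -` {X ((T ^^ n) x)} \<inter> space M \<in> sets M"
    using measurable_sets[OF funpow_meas simple_functionD(2)[OF assms]] by simp
qed

lemma ent_funpow:
  assumes "simple_function M X"
  shows "ent M (\<lambda>x. X ((T ^^ n) x)) = ent M X"
proof -
  let ?Y = "\<lambda>x. X ((T ^^ n) x)"
  have m: "prob (?Y -` {y} \<inter> space M) = prob (X -` {y} \<inter> space M)" for y
  proof -
    have "?Y -` {y} \<inter> space M = (T ^^ n) -` (X -` {y} \<inter> space M) \<inter> space M"
      by (auto simp: funpow_space)
    then show ?thesis using measure_vimage_funpow[OF simple_functionD(2)[OF assms]] by simp
  qed
  have "(\<Sum>y\<in>?Y ` space M. prob (X -` {y} \<inter> space M) * ln (prob (X -` {y} \<inter> space M)))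
    = (\<Sum>y\<in>X ` space M. prob (X -` {y} \<inter> space M) * ln (prob (X -` {y} \<inter> space M)))"
  proof (rule sum.mono_neutral_left)
    show "\<forall>y\<in>X ` space M - ?Y ` space M. prob (X -` {y} \<inter> space M) * ln (prob (X -` {y} \<inter> space M)) = 0"
    proof
      fix y assume "y \<in> X ` space M - ?Y ` space M"
      then have "?Y -` {y} \<inter> space M = {}" by (force simp: image_iff)
      then have "prob (X -` {y} \<inter> space M) = 0" using m[of y] by simp
      then show "prob (X -` {y} \<inter> space M) * ln (prob (X -` {y} \<inter> space M)) = 0" by simp
    qed
  qed (use simple_functionD(1)[OF assms] funpow_space in auto)
  then show ?thesis by (simp add: ent_def m)
qed

lemma simple_function_itinerary:
  assumes "simple_function M X"
  shows "simple_function M (itinerary T X n)"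
proof (induction n)
  case 0
  have "itinerary T X 0 = (\<lambda>x. [])" by auto
  then show ?case by simp
next
  case (Suc n)
  have "itinerary T X (Suc n) = (\<lambda>x. itinerary T X n x @ [X ((T ^^ n) x)])"
    by (auto simp: itinerary_Suc)
  then show ?case
    using simple_function_compose2[OF Suc simple_function_funpow[OF assms], of "\<lambda>w y. w @ [y]"] by simp
qed

lemma ent_itinerary_subadd:
  assumes "simple_function M X"
  shows "ent M (itinerary T X (m + n)) \<le> ent M (itinerary T X m) + ent M (itinerary T X n)"
proof -
  note S = simple_function_itinerary[OF assms]
  have "ent M (itinerary T X (m + n)) \<le> ent M (\<lambda>x. (itinerary T X m x, itinerary T X n ((T ^^ m) x)))"
    by (rule ent_le_of_fun[where f = "\<lambda>(a, b). a @ b"])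
      (auto intro!: simple_function_Pair S simple_function_funpow simp: itinerary_add)
  also have "\<dots> \<le> ent M (itinerary T X m) + ent M (\<lambda>x. itinerary T X n ((T ^^ m) x))"
    by (intro ent_Pair_le S simple_function_funpow)
  also have "ent M (\<lambda>x. itinerary T X n ((T ^^ m) x)) = ent M (itinerary T X n)"
    by (intro ent_funpow S)
  finally show ?thesis .
qed

lemma ent_itinerary_le:
  assumes "simple_function M X"
  shows "ent M (itinerary T X n) \<le> real n * ent M X"
proof (induction n)
  case 0
  have "itinerary T X 0 ` space M = {[]}" using not_empty by auto
  moreover have "itinerary T X 0 -` {[]} \<inter> space M = space M" by auto
  ultimately show ?case by (simp add: ent_def prob_space)
next
  case (Suc n)
  have "ent M (itinerary T X 1) \<le> ent M X"
    by (rule ent_le_of_fun[where f = "\<lambda>y. [y]"]) (auto simp: assms itinerary_def)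
  then show ?case using Suc ent_itinerary_subadd[OF assms, of n 1] by (simp add: algebra_simps)
qed

definition label :: "'a set set \<Rightarrow> 'a \<Rightarrow> 'a set" where
  "label P x = (THE A. A \<in> P \<and> x \<in> A)"

context
  fixes P assumes P: "finite_partition M P"
begin

lemma label_eq: "A \<in> P \<Longrightarrow> x \<in> A \<Longrightarrow> label P x = A"
  using P unfolding label_def finite_partition_def partition_on_def disjoint_def
  by (intro the_equality) blast+

lemma label_mem: "x \<in> space M \<Longrightarrow> label P x \<in> P \<and> x \<in> label P x"
proof -
  assume "x \<in> space M"
  then obtain A where "A \<in> P" "x \<in> A" using P unfolding finite_partition_def partition_on_def by blast
  then show ?thesis using label_eq by simp
qed

lemma label_image_subset: "label P ` space M \<subseteq> P"
  using label_mem by blast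

lemma label_fibre: "A \<in> P \<Longrightarrow> label P -` {A} \<inter> space M = A"
  using label_mem label_eq P unfolding finite_partition_def partition_on_def by blast

lemma simple_function_label: "simple_function M (label P)"
  unfolding simple_function_def
proof safe
  show "finite (label P ` space M)"
    using P label_image_subset finite_subset unfolding finite_partition_def by blast
  fix x assume "x \<in> space M"
  then show "label P -` {label P x} \<inter> space M \<in> sets M"
    using label_fibre label_mem P unfolding finite_partition_def by auto
qed

text \<open>Nonempty cells of the join correspond one to one to the itineraries that occur; an empty
  cell contributes 0 * ln 0 = 0.\<close>

lemma partition_entropy_join:
  "partition_entropy M (dynamical_join M T P n) = ent M (itinerary T (label P) n)"
proof -
  let ?X = "itinerary T (label P) n"
  let ?F = "\<lambda>w. ?X -` {w} \<inter> space M"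
  let ?\<eta> = "\<lambda>A. prob A * ln (prob A)"
  have cell: "{x \<in> space M. \<forall>i<n. (T ^^ i) x \<in> A i} = ?F (map A [0..<n])" if "\<forall>i<n. A i \<in> P" for A
  proof -
    have "(T ^^ i) x \<in> A i \<longleftrightarrow> label P ((T ^^ i) x) = A i" if "x \<in> space M" "i < n" for x i
      using label_eq label_mem funpow_space that \<open>\<forall>i<n. A i \<in> P\<close> by metis
    then show ?thesis by (auto simp: itinerary_def list_eq_iff_nth_eq)
  qed
  have sub: "?F ` ?X ` space M \<subseteq> dynamical_join M T P n"
  proof safe
    fix x assume x: "x \<in> space M"
    let ?A = "\<lambda>i. label P ((T ^^ i) x)"
    have "\<forall>i<n. ?A i \<in> P" using label_mem funpow_space x by blast
    moreover have "?X x = map ?A [0..<n]" unfolding itinerary_def ..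
    ultimately have "?F (?X x) = {y \<in> space M. \<forall>i<n. (T ^^ i) y \<in> ?A i}" "\<forall>i<n. ?A i \<in> P"
      using cell[of ?A] by (simp_all only:)
    then show "?F (?X x) \<in> dynamical_join M T P n"
      unfolding dynamical_join_def mem_Collect_eq by (intro exI[of _ ?A] conjI)
  qed
  have rest: "B = {}" if "B \<in> dynamical_join M T P n - ?F ` ?X ` space M" for B
  proof (rule ccontr)
    assume "B \<noteq> {}"
    have "\<exists>A. B = {x \<in> space M. \<forall>i<n. (T ^^ i) x \<in> A i} \<and> (\<forall>i<n. A i \<in> P)"
      using that unfolding dynamical_join_def by (simp only: Diff_iff mem_Collect_eq)
    then obtain A where "B = {x \<in> space M. \<forall>i<n. (T ^^ i) x \<in> A i}" "\<forall>i<n. A i \<in> P"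
      by (elim exE conjE)
    then have A: "B = ?F (map A [0..<n])" using cell[of A] by (simp only:)
    obtain x where "x \<in> B" using \<open>B \<noteq> {}\<close> by blast
    then have x: "x \<in> space M" "map A [0..<n] = ?X x" using A by simp_all
    have "B = ?F (?X x)" using A unfolding x(2) .
    then show False using that x(1) by blast
  qed
  have "finite (?X ` space M)"
    using simple_functionD(1)[OF simple_function_itinerary[OF simple_function_label]] .
  have "dynamical_join M T P n \<subseteq> ?F ` ?X ` space M \<union> {{}}" using rest by blast
  then have fin: "finite (dynamical_join M T P n)"
    using \<open>finite (?X ` space M)\<close> finite_subset by blast
  have "(\<Sum>A\<in>dynamical_join M T P n. ?\<eta> A) = (\<Sum>A\<in>?F ` ?X ` space M. ?\<eta> A)"
  proof (rule sum.mono_neutral_right[OF fin sub], rule ballI)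
    fix A assume "A \<in> dynamical_join M T P n - ?F ` ?X ` space M"
    then have "A = {}" by (rule rest)
    then show "?\<eta> A = 0" by simp
  qed
  also have "\<dots> = (\<Sum>w\<in>?X ` space M. ?\<eta> (?F w))"
  proof (rule sum.reindex_cong[OF _ refl refl])
    show "inj_on ?F (?X ` space M)"
    proof (rule inj_onI)
      fix v w assume vw: "v \<in> ?X ` space M" "?F v = ?F w"
      then obtain x where "x \<in> space M" "v = ?X x" by blast
      then have "x \<in> ?F w" using vw by auto
      then show "v = w" using \<open>v = ?X x\<close> by simp
    qed
  qed
  finally show ?thesis by (simp add: partition_entropy_def ent_def)
qed

lemma entropy_wrt_partition_LIMSEQ:
  "(\<lambda>n. ent M (itinerary T (label P) n) / real n) \<longlonglongrightarrow> entropy_wrt_partition M T P"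
proof -
  have "convergent (\<lambda>n. ent M (itinerary T (label P) n) / real n)"
    by (rule fekete) (auto intro: ent_nonneg ent_itinerary_subadd simple_function_label)
  then show ?thesis
    unfolding entropy_wrt_partition_def partition_entropy_join by (simp add: convergent_LIMSEQ_iff)
qed

text \<open>The upper half of the generator theorem. A \<open>P\<close>-itinerary of length n is a
  function of the \<open>Q\<close>-itinerary of length n + m, from which each label is guessed, and
  of the itinerary of \<open>e\<close>, which records the true label on the small set
  \<open>B\<close> where the guess may fail. The corrections cost at most \<open>d\<close> per
  step.\<close>

lemma entropy_wrt_partition_le:
  fixes Q :: "'a \<Rightarrow> 'b"
  assumes Q: "simple_function M Q"
    and approx: "\<And>A \<epsilon>. A \<in> sets M \<Longrightarrow> 0 < \<epsilon> \<Longrightarrow> \<exists>m0. \<forall>m\<ge>m0. \<exists>W.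
      prob {x \<in> space M. (x \<in> A) \<noteq> (itinerary T Q m x \<in> W)} \<le> \<epsilon>"
    and H: "\<And>n. ent M (itinerary T Q n) \<le> real n * h + C"
  shows "entropy_wrt_partition M T P \<le> h"
proof (rule field_le_epsilon)
  fix d :: real assume d: "0 < d"
  define K where "K = real (card P)"
  have finP: "finite P" "P \<subseteq> sets M" using P by (auto simp: finite_partition_def)
  \<comment> \<open>The set \<open>B\<close> will have probability at most K t, and this expression
    is the bound of \<open>ent_Some_None_le\<close> for it.\<close>
  have "((\<lambda>t. K * t + K * (2 * sqrt (K * t))) \<longlongrightarrow> K * 0 + K * (2 * sqrt (K * 0))) (at_right 0)"
    by (intro tendsto_intros)
  then have "\<forall>\<^sub>F t in at_right 0. K * t + K * (2 * sqrt (K * t)) < d"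
    using d by (intro order_tendstoD(2)) auto
  moreover have "\<forall>\<^sub>F t in at_right (0::real). 0 < t" by (rule eventually_at_right_less)
  ultimately have "\<forall>\<^sub>F t in at_right 0. K * t + K * (2 * sqrt (K * t)) < d \<and> 0 < t"
    by (rule eventually_conj)
  then obtain t where t: "K * t + K * (2 * sqrt (K * t)) < d" "0 < t"
    using eventually_happens trivial_limit_at_right_real by blast
  have "\<forall>A\<in>P. \<exists>m0. \<forall>m\<ge>m0. \<exists>W. prob {x \<in> space M. (x \<in> A) \<noteq> (itinerary T Q m x \<in> W)} \<le> t"
    using approx finP t by blast
  then obtain m0 where m0: "\<And>A m. A \<in> P \<Longrightarrow> m \<ge> m0 A \<Longrightarrow>
      \<exists>W. prob {x \<in> space M. (x \<in> A) \<noteq> (itinerary T Q m x \<in> W)} \<le> t"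
    by metis
  define m where "m = Max (m0 ` P)"
  have "\<forall>A\<in>P. \<exists>W. prob {x \<in> space M. (x \<in> A) \<noteq> (itinerary T Q m x \<in> W)} \<le> t"
    using m0 finP by (simp add: m_def)
  then obtain W where W: "\<And>A. A \<in> P \<Longrightarrow> prob {x \<in> space M. (x \<in> A) \<noteq> (itinerary T Q m x \<in> W A)} \<le> t"
    by metis
  define bad where "bad A = {x \<in> space M. (x \<in> A) \<noteq> (itinerary T Q m x \<in> W A)}" for A
  define B where "B = (\<Union>A\<in>P. bad A)"
  have bad_sets: "bad A \<in> sets M" if "A \<in> P" for A
  proof -
    let ?V = "itinerary T Q m -` W A \<inter> space M"
    have "?V \<in> sets M" by (rule simple_functionD(2)[OF simple_function_itinerary[OF Q]])
    moreover have "bad A = (A - ?V) \<union> (?V - A)"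
      using finP that sets.sets_into_space[of A M] by (auto simp: bad_def)
    ultimately show ?thesis using finP that by auto
  qed
  then have B: "B \<in> sets M" using finP by (auto simp: B_def)
  have "prob B \<le> (\<Sum>A\<in>P. prob (bad A))"
    unfolding B_def using finP bad_sets by (intro finite_measure_subadditive_finite) auto
  also have "\<dots> \<le> (\<Sum>A\<in>P. t)" by (intro sum_mono) (use W in \<open>auto simp: bad_def\<close>)
  finally have PB: "prob B \<le> K * t" by (simp add: K_def)
  have "P \<noteq> {}" using P not_empty by (auto simp: finite_partition_def partition_on_def)
  then have K: "0 < K" using finP by (auto simp: K_def card_gt_0_iff)
  define e where "e x = (if x \<in> B then Some (label P x) else None)" for x
  have e_sf: "simple_function M e"
  proof -
    have "simple_function M (\<lambda>x. indicator B x :: real)" by (rule simple_function_indicator[OF B])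
    then have "simple_function M (\<lambda>x. (\<lambda>(s::real) y. if s = 1 then Some y else None) (indicator B x) (label P x))"
      by (rule simple_function_compose2[OF _ simple_function_label])
    also have "(\<lambda>x. (\<lambda>(s::real) y. if s = 1 then Some y else None) (indicator B x) (label P x)) = e"
      by (auto simp: e_def indicator_def)
    finally show ?thesis .
  qed
  have "ent M e \<le> K * t + real (card (label P ` space M)) * (2 * sqrt (K * t))"
    unfolding e_def by (rule ent_Some_None_le[OF simple_function_label B PB]) (use K t in auto)
  also have "\<dots> \<le> K * t + K * (2 * sqrt (K * t))"
    unfolding K_def using finP label_image_subset t
    by (intro add_left_mono mult_right_mono) (auto simp: card_mono)
  finally have ent_e: "ent M e \<le> d" using t by simp
  \<comment> \<open>Off \<open>B\<close> exactly one cell of \<open>P\<close> passes the test, so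
    the choice is the true label.\<close>
  define guess where "guess w = (SOME A. A \<in> P \<and> w \<in> W A)" for w
  have guess: "guess (itinerary T Q m x) = label P x" if "x \<in> space M" "x \<notin> B" for x
  proof -
    have "x \<in> A \<longleftrightarrow> itinerary T Q m x \<in> W A" if "A \<in> P" for A
      using \<open>x \<in> space M\<close> \<open>x \<notin> B\<close> that by (auto simp: B_def bad_def)
    then have "A \<in> P \<and> itinerary T Q m x \<in> W A \<longleftrightarrow> A = label P x" for A
      using label_mem[OF that(1)] label_eq by blast
    then show ?thesis by (simp add: guess_def)
  qed
  have step: "ent M (itinerary T (label P) n) \<le> real n * (h + d) + (real m * h + C)" for n
  proof -
    define f where "f = (\<lambda>(w, v). map (\<lambda>i. case v ! i of Some A \<Rightarrow> A | None \<Rightarrow> guess (take m (drop i w))) [0..<n])"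
    have "itinerary T (label P) n x = f (itinerary T Q (n + m) x, itinerary T e n x)" if x: "x \<in> space M" for x
      unfolding f_def by (rule nth_equalityI)
        (auto simp: itinerary_def[of T "label P"] itinerary_def[of T e] take_drop_itinerary e_def
          guess funpow_space x)
    then have "ent M (itinerary T (label P) n) \<le> ent M (\<lambda>x. (itinerary T Q (n + m) x, itinerary T e n x))"
      by (intro ent_le_of_fun simple_function_Pair simple_function_itinerary Q e_sf)
    also have "\<dots> \<le> ent M (itinerary T Q (n + m)) + ent M (itinerary T e n)"
      by (intro ent_Pair_le simple_function_itinerary Q e_sf)
    also have "\<dots> \<le> (real (n + m) * h + C) + real n * d"
    proof (rule add_mono[OF H])
      have "ent M (itinerary T e n) \<le> real n * ent M e" by (rule ent_itinerary_le[OF e_sf])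
      also have "\<dots> \<le> real n * d" using ent_e by (intro mult_left_mono) auto
      finally show "ent M (itinerary T e n) \<le> real n * d" .
    qed
    finally show ?thesis by (simp add: algebra_simps)
  qed
  show "entropy_wrt_partition M T P \<le> h + d"
  proof (rule LIMSEQ_le[OF entropy_wrt_partition_LIMSEQ])
    have "(\<lambda>n. h + d + (real m * h + C) / real n) \<longlonglongrightarrow> h + d + 0"
      by (intro tendsto_intros lim_const_over_n)
    then show "(\<lambda>n. h + d + (real m * h + C) / real n) \<longlonglongrightarrow> h + d" by simp
    have le: "ent M (itinerary T (label P) n) / real n \<le> h + d + (real m * h + C) / real n" if "n \<ge> 1" for n
    proof -
      have "ent M (itinerary T (label P) n) / real n \<le> (real n * (h + d) + (real m * h + C)) / real n"
        by (intro divide_right_mono step) auto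
      also have "\<dots> = h + d + (real m * h + C) / real n" using that by (simp add: add_divide_distrib)
      finally show ?thesis .
    qed
    show "\<exists>N. \<forall>n\<ge>N. ent M (itinerary T (label P) n) / real n \<le> h + d + (real m * h + C) / real n"
      by (intro exI[of _ "1::nat"] allI impI le)
  qed
qed

end

text \<open>Orthogonality bounds the integral of (S n)^2 by n B^2. Along n = k^2 the integrals of (S
  n / n)^2 are therefore summable, which gives convergence almost everywhere there; between k^2 and
  the next square S changes by at most 2 k B.\<close>

lemma averages_tendsto_0:
  fixes \<psi> :: "'a \<Rightarrow> real"
  assumes [measurable]: "\<psi> \<in> borel_measurable M"
    and B: "\<And>x. x \<in> space M \<Longrightarrow> \<bar>\<psi> x\<bar> \<le> B"
    and orth: "\<And>k. 1 \<le> k \<Longrightarrow> (\<integral>x. \<psi> x * \<psi> ((T ^^ k) x) \<partial>M) = 0"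
  shows "AE x in M. (\<lambda>n. (\<Sum>i<n. \<psi> ((T ^^ i) x)) / real n) \<longlonglongrightarrow> 0"
proof -
  define S where "S n x = (\<Sum>i<n. \<psi> ((T ^^ i) x))" for n x
  have [measurable]: "S n \<in> borel_measurable M" for n unfolding S_def by measurable
  have B0: "0 \<le> B" using B not_empty by (metis abs_ge_zero all_not_in_conv order_trans)
  have bdd: "integrable M (\<lambda>x. \<psi> ((T ^^ i) x) * \<psi> ((T ^^ j) x))" for i j
  proof (rule integrable_const_bound[where B = "B * B"])
    show "AE x in M. norm (\<psi> ((T ^^ i) x) * \<psi> ((T ^^ j) x)) \<le> B * B"
      using B0 by (intro AE_I2) (auto simp: abs_mult intro!: mult_mono B funpow_space)
  qed measurable
  have corr: "(\<integral>x. \<psi> ((T ^^ i) x) * \<psi> ((T ^^ (i + k)) x) \<partial>M) = (\<integral>x. \<psi> x * \<psi> ((T ^^ k) x) \<partial>M)" for i k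
    using integral_funpow[of "\<lambda>x. \<psi> x * \<psi> ((T ^^ k) x)" i]
    by (simp add: funpow_add add.commute[of i])
  have off: "(\<integral>x. \<psi> ((T ^^ i) x) * \<psi> ((T ^^ j) x) \<partial>M) = 0" if "i \<noteq> j" for i j
  proof (cases "i < j")
    case True
    then show ?thesis using corr[of i "j - i"] orth[of "j - i"] by simp
  next
    case False
    then show ?thesis using corr[of j "i - j"] orth[of "i - j"] that by (simp add: mult.commute)
  qed
  have diag: "(\<integral>x. \<psi> ((T ^^ i) x) * \<psi> ((T ^^ i) x) \<partial>M) \<le> B * B" for i
  proof -
    have "(\<integral>x. \<psi> ((T ^^ i) x) * \<psi> ((T ^^ i) x) \<partial>M) \<le> (\<integral>x. B * B \<partial>M)"
    proof (rule integral_mono[OF bdd])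
      fix x assume "x \<in> space M"
      then have "\<bar>\<psi> ((T ^^ i) x)\<bar> * \<bar>\<psi> ((T ^^ i) x)\<bar> \<le> B * B"
        using B0 by (intro mult_mono B funpow_space) auto
      then show "\<psi> ((T ^^ i) x) * \<psi> ((T ^^ i) x) \<le> B * B" by simp
    qed simp
    then show ?thesis by (simp add: prob_space)
  qed
  have var: "(\<integral>x. (S n x)\<^sup>2 \<partial>M) \<le> real n * (B * B)" "integrable M (\<lambda>x. (S n x)\<^sup>2)" for n
  proof -
    have eq: "(S n x)\<^sup>2 = (\<Sum>i<n. \<Sum>j<n. \<psi> ((T ^^ i) x) * \<psi> ((T ^^ j) x))" for x
      by (simp add: S_def power2_eq_square sum_product)
    show "integrable M (\<lambda>x. (S n x)\<^sup>2)" unfolding eq by (intro Bochner_Integration.integrable_sum bdd)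
    have "(\<integral>x. (S n x)\<^sup>2 \<partial>M) = (\<Sum>i<n. \<Sum>j<n. (\<integral>x. \<psi> ((T ^^ i) x) * \<psi> ((T ^^ j) x) \<partial>M))"
      unfolding eq using bdd by (simp add: Bochner_Integration.integral_sum)
    also have "\<dots> = (\<Sum>i<n. (\<integral>x. \<psi> ((T ^^ i) x) * \<psi> ((T ^^ i) x) \<partial>M))"
    proof (rule sum.cong[OF refl])
      fix i assume "i \<in> {..<n}"
      then show "(\<Sum>j<n. (\<integral>x. \<psi> ((T ^^ i) x) * \<psi> ((T ^^ j) x) \<partial>M)) = (\<integral>x. \<psi> ((T ^^ i) x) * \<psi> ((T ^^ i) x) \<partial>M)"
        using off by (subst sum.remove[of _ i]) (auto intro!: sum.neutral)
    qed
    also have "\<dots> \<le> (\<Sum>i<n. B * B)" by (intro sum_mono diag)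
    finally show "(\<integral>x. (S n x)\<^sup>2 \<partial>M) \<le> real n * (B * B)" by simp
  qed
  define g where "g k x = (S ((Suc k)\<^sup>2) x / real ((Suc k)\<^sup>2))\<^sup>2" for k x
  have [measurable]: "g k \<in> borel_measurable M" for k unfolding g_def by measurable
  have g0: "0 \<le> g k x" for k x by (simp add: g_def)
  have "(\<integral>\<^sup>+x. ennreal (g k x) \<partial>M) \<le> ennreal (B * B * (1 / real ((Suc k)\<^sup>2)))" for k
  proof -
    have "integrable M (g k)" unfolding g_def power_divide using var(2) by simp
    then have "(\<integral>\<^sup>+x. ennreal (g k x) \<partial>M) = ennreal (\<integral>x. g k x \<partial>M)"
      using g0 by (intro nn_integral_eq_integral) auto
    also have "(\<integral>x. g k x \<partial>M) = (\<integral>x. (S ((Suc k)\<^sup>2) x)\<^sup>2 \<partial>M) / (real ((Suc k)\<^sup>2))\<^sup>2"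
      unfolding g_def power_divide by simp
    also have "\<dots> \<le> real ((Suc k)\<^sup>2) * (B * B) / (real ((Suc k)\<^sup>2))\<^sup>2"
      by (intro divide_right_mono var) auto
    also have "\<dots> = B * B * (1 / real ((Suc k)\<^sup>2))" by (simp add: power2_eq_square)
    finally show ?thesis by (simp add: ennreal_leI)
  qed
  then have "(\<Sum>k. \<integral>\<^sup>+x. ennreal (g k x) \<partial>M) \<le> (\<Sum>k. ennreal (B * B * (1 / real ((Suc k)\<^sup>2))))"
    by (intro suminf_le) auto
  also have "\<dots> < \<infinity>"
  proof -
    have "summable (\<lambda>k. 1 / real ((Suc k)\<^sup>2))"
      using inverse_power_summable[of 2, where ?'a = real] summable_Suc_iff[of "\<lambda>k. inverse (real k ^ 2)"]
      by (simp add: field_simps inverse_eq_divide)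
    then have "summable (\<lambda>k. B * B * (1 / real ((Suc k)\<^sup>2)))" by (rule summable_mult)
    then show ?thesis using ennreal_suminf_neq_top by (simp add: less_top)
  qed
  finally have "(\<integral>\<^sup>+x. (\<Sum>k. ennreal (g k x)) \<partial>M) \<noteq> \<infinity>"
    by (subst nn_integral_suminf) auto
  then have "AE x in M. (\<Sum>k. ennreal (g k x)) \<noteq> \<infinity>"
    by (intro nn_integral_PInf_AE) auto
  then show ?thesis
  proof (rule AE_mp, intro AE_I2 impI)
    fix x assume x: "x \<in> space M" and "(\<Sum>k. ennreal (g k x)) \<noteq> \<infinity>"
    then have "summable (\<lambda>k. g k x)" using g0 by (intro summable_suminf_not_top) auto
    then have "(\<lambda>k. g k x) \<longlonglongrightarrow> 0" by (rule summable_LIMSEQ_zero)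
    then have "(\<lambda>k. sqrt (g k x)) \<longlonglongrightarrow> sqrt 0" by (rule tendsto_real_sqrt)
    then have "(\<lambda>k. \<bar>S ((Suc k)\<^sup>2) x\<bar> / real ((Suc k)\<^sup>2)) \<longlonglongrightarrow> 0"
      by (simp add: g_def)
    then have sq: "(\<lambda>k. \<bar>S (k\<^sup>2) x\<bar> / real (k\<^sup>2)) \<longlonglongrightarrow> 0"
      by (rule LIMSEQ_imp_Suc[of "\<lambda>k. \<bar>S (k\<^sup>2) x\<bar> / real (k\<^sup>2)"])
    have "(\<lambda>k. B * (2 / real k)) \<longlonglongrightarrow> B * 0" by (intro tendsto_intros lim_const_over_n)
    with sq have lim: "(\<lambda>k. \<bar>S (k\<^sup>2) x\<bar> / real (k\<^sup>2) + B * (2 / real k)) \<longlonglongrightarrow> 0"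
      using tendsto_add[of _ 0 _ _ 0] by fastforce
    have fs: "filterlim floor_sqrt at_top sequentially"
      unfolding filterlim_at_top eventually_sequentially by (meson le_floor_sqrtI)
    have "(\<lambda>n. S n x / real n) \<longlonglongrightarrow> 0"
    proof (rule tendsto_rabs_zero_cancel, rule tendsto_sandwich[of "\<lambda>_. 0"])
      show "(\<lambda>n. \<bar>S ((floor_sqrt n)\<^sup>2) x\<bar> / real ((floor_sqrt n)\<^sup>2) + B * (2 / real (floor_sqrt n))) \<longlonglongrightarrow> 0"
        using filterlim_compose[OF lim fs] .
      show "\<forall>\<^sub>F n in sequentially. \<bar>S n x / real n\<bar> \<le>
          \<bar>S ((floor_sqrt n)\<^sup>2) x\<bar> / real ((floor_sqrt n)\<^sup>2) + B * (2 / real (floor_sqrt n))"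
      proof (rule eventually_sequentiallyI[of 1])
        fix n :: nat assume "1 \<le> n"
        define k where "k = floor_sqrt n"
        have k: "0 < k" "k\<^sup>2 \<le> n" "n < (Suc k)\<^sup>2"
          using \<open>1 \<le> n\<close> Suc_floor_sqrt_power2_gt by (auto simp: k_def)
        have "S n x = S (k\<^sup>2) x + (\<Sum>i\<in>{k\<^sup>2..<n}. \<psi> ((T ^^ i) x))"
          unfolding S_def lessThan_atLeast0 using k by (subst sum.atLeastLessThan_concat) auto
        also have "\<bar>\<dots>\<bar> \<le> \<bar>S (k\<^sup>2) x\<bar> + (\<Sum>i\<in>{k\<^sup>2..<n}. \<bar>\<psi> ((T ^^ i) x)\<bar>)"
          by (intro abs_triangle_ineq[THEN order_trans] add_left_mono sum_abs)
        also have "(\<Sum>i\<in>{k\<^sup>2..<n}. \<bar>\<psi> ((T ^^ i) x)\<bar>) \<le> real (n - k\<^sup>2) * B"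
          using sum_bounded_above[of "{k\<^sup>2..<n}" "\<lambda>i. \<bar>\<psi> ((T ^^ i) x)\<bar>" B] B funpow_space x by simp
        also have "real (n - k\<^sup>2) * B \<le> real (2 * k) * B"
        proof (rule mult_right_mono[OF _ B0])
          have "n - k\<^sup>2 \<le> 2 * k" using k by (simp add: power2_eq_square)
          then show "real (n - k\<^sup>2) \<le> real (2 * k)" by (simp only: of_nat_le_iff)
        qed
        finally have "\<bar>S n x\<bar> / real n \<le> (\<bar>S (k\<^sup>2) x\<bar> + real (2 * k) * B) / real n"
          by (intro divide_right_mono) auto
        also have "\<dots> \<le> (\<bar>S (k\<^sup>2) x\<bar> + real (2 * k) * B) / real (k\<^sup>2)"
          using k(1,2) B0 \<open>1 \<le> n\<close> by (intro divide_left_mono mult_pos_pos) auto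
        also have "\<dots> = \<bar>S (k\<^sup>2) x\<bar> / real (k\<^sup>2) + B * (2 / real k)"
          using k by (simp add: add_divide_distrib power2_eq_square)
        finally show "\<bar>S n x / real n\<bar> \<le>
          \<bar>S ((floor_sqrt n)\<^sup>2) x\<bar> / real ((floor_sqrt n)\<^sup>2) + B * (2 / real (floor_sqrt n))"
          by (simp add: k_def)
      qed
    qed auto
    then show "(\<lambda>n. (\<Sum>i<n. \<psi> ((T ^^ i) x)) / real n) \<longlonglongrightarrow> 0" by (simp add: S_def)
  qed
qed

end

section \<open>Distribution functions of fair measures\<close>

definition cumul :: "real \<Rightarrow> real measure \<Rightarrow> real \<Rightarrow> real" where
  "cumul a M x = measure M {1 - a..x}"

definition core_mass :: "real \<Rightarrow> real measure \<Rightarrow> real" where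
  "core_mass a M = measure M {1 - a..a - 1}"

locale fair_tent =
  fixes a :: real and M :: "real measure"
  assumes a_gt: "sqrt 2 < a" and a_lt: "a < 2" and fair: "fair_measure a M"
begin

lemma a_bounds: "1.41 < a" "1 < a" "a \<le> 2"
  using a_gt a_lt sqrt2_bounds by auto

lemma sets_M_eq: "sets M = sets (restrict_space borel {1 - a..1})"
  using fair by (simp add: fair_measure_def tent_interval_def)

lemma space_M: "space M = {1 - a..1}"
  using sets_eq_imp_space_eq[OF sets_M_eq] by (simp add: space_restrict_space)

lemma sets_M: "A \<in> sets M \<longleftrightarrow> A \<in> sets borel \<and> A \<subseteq> {1 - a..1}"
  unfolding sets_M_eq by (subst sets_restrict_space_iff) auto

lemma measurable_M: "f \<in> borel_measurable borel \<Longrightarrow> f \<in> borel_measurable M"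
  unfolding measurable_cong_sets[OF sets_M_eq refl] by (rule measurable_restrict_space1)

lemma Icc_sets: "1 - a \<le> x \<Longrightarrow> y \<le> 1 \<Longrightarrow> {x..y} \<in> sets M"
  by (auto simp: sets_M)

sublocale prob_space M
  using fair by (intro prob_spaceI) (simp add: fair_measure_def)

sublocale measure_preserving M "tent a"
  using fair by unfold_locales (auto simp: fair_measure_def)

lemma emeasure_singleton: "emeasure M {x} = 0"
proof (cases "x \<in> space M")
  case True
  then show ?thesis using fair by (simp add: fair_measure_def)
next
  case False
  then have "{x} \<notin> sets M" using sets.sets_into_space by blast
  then show ?thesis by (rule emeasure_notin_sets)
qed

lemma measure_singleton: "measure M {x} = 0"
  by (simp add: measure_def emeasure_singleton)

lemma finite_null_sets: "finite A \<Longrightarrow> A \<subseteq> {1 - a..1} \<Longrightarrow> A \<in> null_sets M"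
proof (induction A rule: finite_induct)
  case (insert x A)
  have "{x} \<in> null_sets M"
    using insert by (auto simp: null_sets_def emeasure_singleton sets_M)
  then have "{x} \<union> A \<in> null_sets M" using insert by (intro null_sets.Un) auto
  then show ?case by simp
qed simp

lemma AE_notin_finite: "finite A \<Longrightarrow> AE x in M. x \<notin> A"
proof -
  assume A: "finite A"
  have "A \<inter> {1 - a..1} \<in> null_sets M" using A by (intro finite_null_sets) auto
  then show ?thesis by (rule AE_I') (auto simp: space_M)
qed

lemma preimage_count_eq:
  assumes "x \<in> {1 - a..1}" "x \<noteq> 0"
  shows "preimage_count a x = (if x \<le> a - 1 then 2 else 1)"
proof -
  have *: "{y \<in> tent_interval a. tent a y = tent a x} = {x, - x} \<inter> {1 - a..1}"
    using a_bounds assms by (auto simp: tent_interval_def tent_def abs_eq_iff)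
  show ?thesis
  proof (cases "x \<le> a - 1")
    case True
    then have "{x, - x} \<inter> {1 - a..1} = {x, - x}" using assms a_bounds by auto
    then show ?thesis using True assms unfolding preimage_count_def * by (simp add: card_insert_if)
  next
    case False
    then have "{x, - x} \<inter> {1 - a..1} = {x}" using assms by auto
    then show ?thesis using False unfolding preimage_count_def * by simp
  qed
qed

lemma measure_tent_image:
  assumes E: "E \<in> sets M" and c: "E \<subseteq> {1 - a..0} \<or> E \<subseteq> {0..a - 1}"
  shows "measure M (tent a ` E) = 2 * measure M E"
proof -
  have inj: "inj_on (tent a) E"
    using c a_bounds by (auto simp: inj_on_def tent_def abs_if)
  have "emeasure M (tent a ` E) = (\<integral>\<^sup>+x\<in>E. of_nat (preimage_count a x) \<partial>M)"
    using fair E inj by (simp add: fair_measure_def)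
  also have "\<dots> = (\<integral>\<^sup>+x. 2 * indicator E x \<partial>M)"
  proof (rule nn_integral_cong_AE, rule AE_mp[OF AE_notin_finite[of "{0}"]], simp, intro AE_I2 impI)
    fix x assume "x \<in> space M" "x \<notin> {0}"
    then show "of_nat (preimage_count a x) * indicator E x = (2 * indicator E x :: ennreal)"
      using c a_bounds by (cases "x \<in> E") (auto simp: preimage_count_eq space_M)
  qed
  also have "\<dots> = 2 * emeasure M E" using E by (simp add: nn_integral_cmult)
  finally show ?thesis by (simp add: measure_def enn2real_mult)
qed

lemma measure_tent_image_outer:
  assumes E: "E \<in> sets M" and c: "E \<subseteq> {a - 1<..1}"
  shows "measure M (tent a ` E) = measure M E"
proof -
  have inj: "inj_on (tent a) E"
    using c a_bounds by (auto simp: inj_on_def tent_def abs_if)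
  have "emeasure M (tent a ` E) = (\<integral>\<^sup>+x\<in>E. of_nat (preimage_count a x) \<partial>M)"
    using fair E inj by (simp add: fair_measure_def)
  also have "\<dots> = (\<integral>\<^sup>+x. indicator E x \<partial>M)"
  proof (rule nn_integral_cong_AE, rule AE_mp[OF AE_notin_finite[of "{0}"]], simp, intro AE_I2 impI)
    fix x assume "x \<in> space M" "x \<notin> {0}"
    then show "of_nat (preimage_count a x) * indicator E x = (indicator E x :: ennreal)"
      using c a_bounds by (cases "x \<in> E") (auto simp: preimage_count_eq space_M)
  qed
  also have "\<dots> = emeasure M E" using E by simp
  finally show ?thesis by (simp add: measure_def)
qed

lemma tent_image_neg:
  assumes "x \<le> y" "y \<le> 0"
  shows "tent a ` {x..y} = {tent a x..tent a y}"
proof (intro equalityI subsetI)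
  fix z assume z: "z \<in> {tent a x..tent a y}"
  have "(z - 1) / a \<in> {x..y}"
    using z assms a_bounds by (auto simp: tent_def field_simps)
  moreover have "tent a ((z - 1) / a) = z"
  proof -
    have "tent a y \<le> 1" using a_bounds by (simp add: tent_def)
    then have "z \<le> 1" using z by simp
    then show ?thesis using a_bounds by (simp add: tent_def abs_mult abs_of_nonpos)
  qed
  ultimately show "z \<in> tent a ` {x..y}" by (metis imageI)
qed (use assms a_bounds in \<open>auto simp: tent_def\<close>)

lemma tent_image_pos:
  assumes "x \<le> y" "0 \<le> x"
  shows "tent a ` {x..y} = {tent a y..tent a x}"
proof (intro equalityI subsetI)
  fix z assume z: "z \<in> {tent a y..tent a x}"
  have "(1 - z) / a \<in> {x..y}"
    using z assms a_bounds by (auto simp: tent_def field_simps)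
  moreover have "tent a ((1 - z) / a) = z"
  proof -
    have "tent a x \<le> 1" using a_bounds by (simp add: tent_def)
    then have "z \<le> 1" using z by simp
    then show ?thesis using a_bounds by (simp add: tent_def abs_mult abs_of_nonneg)
  qed
  ultimately show "z \<in> tent a ` {x..y}" by (metis imageI)
qed (use assms a_bounds in \<open>auto simp: tent_def\<close>)

abbreviation "F \<equiv> cumul a M"
abbreviation "b \<equiv> core_mass a M"

lemma measure_Ioc:
  assumes "1 - a \<le> x" "y \<le> 1"
  shows "measure M {x<..y} = measure M {x..y}"
proof (cases "x \<le> y")
  case True
  have "{x..y} = {x} \<union> {x<..y}" using True by auto
  then have "measure M {x..y} = measure M {x} + measure M {x<..y}"
    using assms True by (simp only:) (intro finite_measure_Union, auto simp: sets_M)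
  then show ?thesis by (simp add: measure_singleton)
next
  case False
  then show ?thesis by simp
qed

lemma measure_Icc:
  assumes "1 - a \<le> x" "x \<le> y" "y \<le> 1"
  shows "measure M {x..y} = F y - F x"
proof -
  have "{1 - a..y} = {1 - a..x} \<union> {x<..y}" using assms by auto
  then have "measure M {1 - a..y} = measure M {1 - a..x} + measure M {x<..y}"
    using assms by (simp only:) (intro finite_measure_Union, auto simp: sets_M)
  then show ?thesis using assms by (simp add: cumul_def measure_Ioc)
qed

lemma cumul_mono: "1 - a \<le> x \<Longrightarrow> x \<le> y \<Longrightarrow> y \<le> 1 \<Longrightarrow> F x \<le> F y"
  using measure_Icc[of x y] measure_nonneg[of M "{x..y}"] by simp

lemma cumul_ends: "F (1 - a) = 0" "F 1 = 1" "F (a - 1) = b"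
  using prob_space by (simp_all add: cumul_def measure_singleton core_mass_def space_M)

lemma cumul_bounds: "0 \<le> F x" "F x \<le> 1"
  by (simp_all add: cumul_def)

lemma cumul_diff_double:
  assumes "1 - a \<le> x" "x \<le> y" "y \<le> 0"
  shows "F (tent a y) - F (tent a x) = 2 * (F y - F x)"
proof -
  have t: "tent a x \<in> {1 - a..1}" "tent a y \<in> {1 - a..1}"
    using assms a_bounds by (intro tent_mem; auto)+
  have "tent a x \<le> tent a y" using assms a_bounds by (simp add: tent_def)
  then have "F (tent a y) - F (tent a x) = measure M (tent a ` {x..y})"
    using assms t by (simp add: tent_image_neg measure_Icc)
  also have "\<dots> = 2 * measure M {x..y}"
    using assms a_bounds by (intro measure_tent_image Icc_sets) auto
  finally show ?thesis using assms by (simp add: measure_Icc)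
qed

lemma cumul_diff_double':
  assumes "0 \<le> x" "x \<le> y" "y \<le> a - 1"
  shows "F (tent a x) - F (tent a y) = 2 * (F y - F x)"
proof -
  have t: "tent a x \<in> {1 - a..1}" "tent a y \<in> {1 - a..1}"
    using assms a_bounds by (intro tent_mem; auto)+
  have "tent a y \<le> tent a x" using assms a_bounds by (simp add: tent_def)
  then have "F (tent a x) - F (tent a y) = measure M (tent a ` {x..y})"
    using assms t by (simp add: tent_image_pos measure_Icc)
  also have "\<dots> = 2 * measure M {x..y}"
    using assms a_bounds by (intro measure_tent_image Icc_sets) auto
  finally show ?thesis using assms a_bounds by (simp add: measure_Icc)
qed

text \<open>Both halves of the core have the same image, and each has half the mass of that
  image.\<close>

lemma cumul_0: "F 0 = b / 2"
proof -
  have "tent a (1 - a) = tent a (a - 1)" using a_bounds by (simp add: tent_def)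
  then show ?thesis
    using cumul_diff_double[of "1 - a" 0] cumul_diff_double'[of 0 "a - 1"] a_bounds
    by (simp add: cumul_ends)
qed

lemma cumul_tent_neg:
  assumes "1 - a \<le> x" "x \<le> 0"
  shows "F (tent a x) = 1 - b + 2 * F x"
proof -
  have "tent a 0 = 1" by (simp add: tent_def)
  then show ?thesis using cumul_diff_double[of x 0] assms by (simp add: cumul_ends cumul_0)
qed

lemma cumul_tent_pos:
  assumes "0 \<le> x" "x \<le> a - 1"
  shows "F (tent a x) = 1 + b - 2 * F x"
proof -
  have "tent a 0 = 1" by (simp add: tent_def)
  then show ?thesis using cumul_diff_double'[of 0 x] assms by (simp add: cumul_ends cumul_0)
qed

lemma cumul_tent_outer:
  assumes "a - 1 < x" "x \<le> 1"
  shows "F (tent a x) = 1 - F x"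
proof -
  have t: "tent a x \<in> {1 - a..1}" using assms a_bounds by (intro tent_mem) auto
  have t1: "tent a 1 = 1 - a" using a_bounds by (simp add: tent_def)
  have "F (tent a x) = measure M (tent a ` {x..1})"
    using assms a_bounds by (subst tent_image_pos) (auto simp: t1 cumul_def)
  also have "\<dots> = measure M {x..1}"
    using assms a_bounds by (intro measure_tent_image_outer Icc_sets) auto
  finally show ?thesis using assms a_bounds by (simp add: measure_Icc cumul_ends)
qed

lemma cumul_crit_3: "F (crit a 3) = 1 - b"
proof -
  have "crit a 3 = tent a (1 - a)"
    using crit_Suc_tent[of a 2] by (simp add: crit_2)
  then show ?thesis using cumul_tent_neg[of "1 - a"] a_bounds by (simp add: cumul_ends)
qed

text \<open>If b = 0, then \<open>F (crit a 3) = 1\<close>; but a^2 > 2 puts \<open>crit a 3\<close>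
  into the core, where F is at most b = 0.\<close>

lemma core_mass_pos: "0 < b"
proof (rule ccontr)
  assume "\<not> 0 < b"
  then have b: "b = 0" using measure_nonneg[of M "{1 - a..a - 1}"] by (simp add: core_mass_def)
  have t: "crit a 3 \<in> {1 - a..1}" using a_bounds by (intro crit_mem) auto
  have "sqrt 2 * sqrt 2 < a * a" using a_gt a_bounds by (intro mult_strict_mono) auto
  then have "crit a 3 \<le> a - 1" using a_bounds by (simp add: crit_3 power2_eq_square)
  then have "F (crit a 3) \<le> F (a - 1)" using t a_bounds by (intro cumul_mono) auto
  then show False using b by (simp add: cumul_ends cumul_crit_3)
qed

lemma cumul_diff_le_neg:
  assumes "1 - a \<le> x" "x \<le> y" "y \<le> 0"
  shows "F (tent a y) - F (tent a x) \<le> 2 * (F y - F x)"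
  using cumul_diff_double[OF assms] by simp

text \<open>Across a - 1 the slope of the conjugate map changes from -2 to -1, and b <= F y makes up
  for the difference.\<close>

lemma cumul_diff_le_pos:
  assumes "0 \<le> x" "x \<le> y" "y \<le> 1"
  shows "F (tent a x) - F (tent a y) \<le> 2 * (F y - F x)"
proof -
  consider "y \<le> a - 1" | "x \<le> a - 1" "a - 1 < y" | "a - 1 < x" by linarith
  then show ?thesis
  proof cases
    case 1
    then show ?thesis using cumul_diff_double'[of x y] assms by simp
  next
    case 2
    then have "F (a - 1) \<le> F y" "F x \<le> F (a - 1)" using assms a_bounds by (intro cumul_mono; simp)+
    then show ?thesis using 2 assms by (simp add: cumul_tent_outer cumul_tent_pos cumul_ends)
  next
    case 3
    then have "F x \<le> F y" using assms a_bounds by (intro cumul_mono; simp)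
    then show ?thesis using 3 assms by (simp add: cumul_tent_outer)
  qed
qed

section \<open>Uniform full support\<close>

abbreviation "p \<equiv> fixpt a"

lemma p_bounds: "0 < p" "p < 1" "tent a p = p" "tent a (- p) = p"
  using fixpt_bounds[of a] a_bounds tent_fixpt[of a] by (auto simp: tent_def)

text \<open>The interval is iterated, keeping the longer half when it is folded, until it contains
  the fixed point. A round takes at most two steps: it multiplies the length by at least l^2 / 2 and
  the mass by at most 4. Since no length exceeds 2, \<open>r\<close> rounds are enough.\<close>

lemma grow_to_fixpt:
  assumes l: "sqrt 2 < l" "l \<le> a" and xy: "1 - a \<le> x" "x < y" "y \<le> 1"
    and r: "2 < (l\<^sup>2 / 2) ^ r * (y - x)"
  shows "\<exists>x' y'. 1 - a \<le> x' \<and> x' \<le> p \<and> p \<le> y' \<and> y' \<le> 1 \<and>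
    (y - x) / 2 \<le> y' - x' \<and> F y' - F x' \<le> 4 ^ r * (F y - F x)"
  using xy r
proof (induction r arbitrary: x y)
  case 0
  then show ?case using a_bounds by simp
next
  case (Suc r)
  define \<theta> where "\<theta> = l\<^sup>2 / 2"
  have l1: "1 < l" "l \<le> 2" using l a_bounds sqrt2_bounds by auto
  have "sqrt 2 * sqrt 2 < l * l" using l l1 by (intro mult_strict_mono) auto
  then have \<theta>1: "1 < \<theta>" by (simp add: \<theta>_def power2_eq_square)
  have "l * l \<le> 2 * l" using l1 by (intro mult_right_mono) auto
  then have \<theta>l: "\<theta> \<le> l" by (simp add: \<theta>_def power2_eq_square)
  have \<theta>a: "\<theta> \<le> a" using \<theta>l l by simp
  have \<theta>aa: "2 * \<theta> \<le> a * a" using l l1 by (simp add: \<theta>_def power2_eq_square mult_mono)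
  have Fxy: "0 \<le> F y - F x" using cumul_mono[of x y] Suc.prems by simp
  have use_IH: ?case
    if V: "1 - a \<le> u" "v \<le> 1" "\<theta> * (y - x) \<le> v - u" "F v - F u \<le> 4 * (F y - F x)" for u v
  proof -
    have pos: "0 < \<theta> * (y - x)" using \<theta>1 Suc.prems by simp
    have "2 < \<theta> ^ r * (\<theta> * (y - x))" using Suc.prems(4) by (simp add: \<theta>_def mult.assoc mult.left_commute)
    also have "\<dots> \<le> \<theta> ^ r * (v - u)" using \<theta>1 V by (intro mult_left_mono) auto
    finally obtain x' y' where *: "1 - a \<le> x'" "x' \<le> p" "p \<le> y'" "y' \<le> 1"
      "(v - u) / 2 \<le> y' - x'" "F y' - F x' \<le> 4 ^ r * (F v - F u)"
      using Suc.IH[of u v] V pos unfolding \<theta>_def[symmetric] by auto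
    have "1 * (y - x) \<le> \<theta> * (y - x)" using \<theta>1 Suc.prems by (intro mult_right_mono) auto
    then have "(y - x) / 2 \<le> y' - x'" using * V by simp
    moreover have "4 ^ r * (F v - F u) \<le> 4 ^ r * (4 * (F y - F x))" using V by (intro mult_left_mono) auto
    ultimately have "F y' - F x' \<le> 4 ^ Suc r * (F y - F x)"
      using *(6) by (simp only: power_Suc mult_ac)
    then show ?case using * \<open>(y - x) / 2 \<le> y' - x'\<close> by blast
  qed
  have mem: "tent a z \<in> {1 - a..1}" if "z \<in> {1 - a..1}" for z
    using that a_bounds by (intro tent_mem) auto
  have exp: "\<theta> * (y - x) \<le> a * (y - x)" using \<theta>a Suc.prems by (intro mult_right_mono) auto
  consider (p) "x \<le> p" "p \<le> y" | (pos) "0 \<le> x" | (neg) "y \<le> 0"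
    | (mid) "x < 0" "0 < y" "y < p" "- p \<le> x" | (low) "x < - p" "0 < y" "y < p"
    using p_bounds by linarith
  then show ?case
  proof cases
    case p
    have "(1::real) \<le> 4 ^ Suc r" by (rule one_le_power) simp
    then have "1 * (F y - F x) \<le> 4 ^ Suc r * (F y - F x)" using Fxy by (intro mult_right_mono)
    then show ?thesis using p Suc.prems by (intro exI[of _ x] exI[of _ y]) auto
  next
    case pos
    show ?thesis
    proof (rule use_IH)
      show "1 - a \<le> tent a y" "tent a x \<le> 1" using mem[of x] mem[of y] Suc.prems by auto
      show "\<theta> * (y - x) \<le> tent a x - tent a y" using exp pos Suc.prems by (simp add: tent_def algebra_simps)
      show "F (tent a x) - F (tent a y) \<le> 4 * (F y - F x)"
        using cumul_diff_le_pos[of x y] pos Suc.prems Fxy by simp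
    qed
  next
    case neg
    show ?thesis
    proof (rule use_IH)
      show "1 - a \<le> tent a x" "tent a y \<le> 1" using mem[of x] mem[of y] Suc.prems by auto
      show "\<theta> * (y - x) \<le> tent a y - tent a x" using exp neg Suc.prems by (simp add: tent_def algebra_simps)
      show "F (tent a y) - F (tent a x) \<le> 4 * (F y - F x)"
        using cumul_diff_le_neg[of x y] neg Suc.prems Fxy by simp
    qed
  next
    case mid
    \<comment> \<open>The longer half is mapped to an interval \<open>[tent a t, 1]\<close> in the
      nonnegative reals, so the next step is injective too, and two steps stretch this half by
      a^2.\<close>
    have t01: "tent a 0 = 1" "tent a 1 = 1 - a" using a_bounds by (auto simp: tent_def)
    obtain t where t: "t = x \<or> t = y" "(y - x) / 2 \<le> \<bar>t\<bar>"
    proof (cases "\<bar>x\<bar> \<le> \<bar>y\<bar>")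
      case True
      then show thesis using mid by (intro that[of y]) auto
    next
      case False
      then show thesis using mid by (intro that[of x]) auto
    qed
    have t': "\<bar>t\<bar> \<le> p" "t \<in> {1 - a..1}" using t mid Suc.prems by auto
    have "F 1 - F (tent a t) \<le> 2 * (F y - F x)"
      using t(1)
    proof
      assume "t = x"
      then show ?thesis using cumul_diff_le_neg[of x 0] cumul_mono[of 0 y] mid Suc.prems a_bounds by (simp add: t01)
    next
      assume "t = y"
      then show ?thesis using cumul_diff_le_pos[of 0 y] cumul_mono[of x 0] mid Suc.prems a_bounds by (simp add: t01)
    qed
    moreover have tt: "0 \<le> tent a t" "tent a t \<le> 1"
    proof -
      have "a * \<bar>t\<bar> \<le> a * p" using t' a_bounds by (intro mult_left_mono) auto
      moreover have "1 - a * p = p" using p_bounds by (simp add: tent_def)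
      ultimately show "0 \<le> tent a t" using p_bounds by (simp add: tent_def)
      show "tent a t \<le> 1" using mem[OF t'(2)] by simp
    qed
    ultimately have "F (tent a (tent a t)) - F (1 - a) \<le> 4 * (F y - F x)"
      using cumul_diff_le_pos[of "tent a t" 1] by (simp add: t01)
    moreover have "\<theta> * (y - x) \<le> tent a (tent a t) - (1 - a)"
    proof -
      have "2 * \<theta> * ((y - x) / 2) \<le> a * a * \<bar>t\<bar>"
        by (rule mult_mono[OF \<theta>aa t(2)]) (use Suc.prems in auto)
      moreover have "tent a (tent a t) - (1 - a) = a * a * \<bar>t\<bar>"
        using tt by (simp add: tent_def algebra_simps)
      ultimately show ?thesis by simp
    qed
    ultimately show ?thesis
      using mem[OF mem[OF t'(2)]] by (intro use_IH) auto
  next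
    case low
    \<comment> \<open>The image of [x, 0] already contains the fixed point. Since y < p < -x, it has
      at least half of the original length; no other case loses length.\<close>
    have t01: "tent a 0 = 1" using a_bounds by (auto simp: tent_def)
    have "a * p \<le> a * \<bar>x\<bar>" using low a_bounds by (intro mult_left_mono) auto
    then have "tent a x \<le> p" using p_bounds by (simp add: tent_def)
    moreover have "F 1 - F (tent a x) \<le> 4 ^ Suc r * (F y - F x)"
    proof -
      have "F 1 - F (tent a x) \<le> 2 * (F y - F x)"
        using cumul_diff_le_neg[of x 0] cumul_mono[of 0 y] low Suc.prems a_bounds p_bounds by (simp add: t01)
      also have "\<dots> \<le> 4 ^ Suc r * (F y - F x)"
      proof (rule mult_right_mono[OF _ Fxy])
        have "(1::real) \<le> 4 ^ r" by (rule one_le_power) simp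
        then show "(2::real) \<le> 4 ^ Suc r" unfolding power_Suc by linarith
      qed
      finally show ?thesis .
    qed
    moreover have "(y - x) / 2 \<le> 1 - tent a x"
    proof -
      have "(y - x) / 2 \<le> 1 * \<bar>x\<bar>" using low p_bounds by simp
      also have "\<dots> \<le> a * \<bar>x\<bar>" using a_bounds by (intro mult_right_mono) auto
      finally show ?thesis by (simp add: tent_def)
    qed
    ultimately show ?thesis
      using mem[of x] p_bounds Suc.prems by (intro exI[of _ "tent a x"] exI[of _ 1]) auto
  qed
qed

text \<open>One-sided neighbourhoods of the fixed point are stretched by \<open>a\<close> and change
  sides, so both sides are treated at once. The process ends when a left neighbourhood reaches 0 and
  contains [0, p].\<close>

lemma grow_from_fixpt:
  assumes l: "1 < l" "l \<le> a" and d: "1 \<le> l ^ k * d"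
  shows "p + d \<le> 1 \<Longrightarrow> F p - F 0 \<le> 2 ^ k * (F (p + d) - F p)"
    and "1 - a \<le> p - d \<Longrightarrow> F p - F 0 \<le> 2 ^ k * (F p - F (p - d))"
proof -
  have "(p + d \<le> 1 \<longrightarrow> F p - F 0 \<le> 2 ^ k * (F (p + d) - F p)) \<and>
    (1 - a \<le> p - d \<longrightarrow> F p - F 0 \<le> 2 ^ k * (F p - F (p - d)))"
    using d
  proof (induction k arbitrary: d)
    case 0
    then show ?case using p_bounds cumul_mono[of "p - d" 0] a_bounds by auto
  next
    case (Suc k)
    have lk: "0 < l ^ Suc k" "1 \<le> l ^ k" using l by auto
    have d0: "0 < d"
    proof (rule ccontr)
      assume "\<not> 0 < d"
      then have "l ^ Suc k * d \<le> 0" using lk by (intro mult_nonneg_nonpos) auto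
      then show False using Suc.prems by simp
    qed
    have "1 \<le> l ^ k * (l * d)" using Suc.prems by (simp add: mult.assoc mult.left_commute)
    also have "\<dots> \<le> l ^ k * (a * d)" using l d0 by (intro mult_left_mono mult_right_mono) auto
    finally have IH: "p + a * d \<le> 1 \<Longrightarrow> F p - F 0 \<le> 2 ^ k * (F (p + a * d) - F p)"
      "1 - a \<le> p - a * d \<Longrightarrow> F p - F 0 \<le> 2 ^ k * (F p - F (p - a * d))"
      using Suc.IH by blast+
    have mem: "tent a z \<in> {1 - a..1}" if "z \<in> {1 - a..1}" for z
      using that a_bounds by (intro tent_mem) auto
    have ap: "1 - a * p = p" using p_bounds by (simp add: tent_def)
    show ?case
    proof (intro conjI impI)
      assume pd: "p + d \<le> 1"
      have t: "tent a (p + d) = p - a * d" using d0 p_bounds ap by (simp add: tent_def algebra_simps)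
      have "F p - F 0 \<le> 2 ^ k * (F p - F (p - a * d))"
        using mem[of "p + d"] pd d0 p_bounds a_bounds by (intro IH) (auto simp: t)
      also have "\<dots> \<le> 2 ^ k * (2 * (F (p + d) - F p))"
        using cumul_diff_le_pos[of p "p + d"] d0 p_bounds pd by (intro mult_left_mono) (auto simp: t)
      finally show "F p - F 0 \<le> 2 ^ Suc k * (F (p + d) - F p)" by (simp only: power_Suc mult_ac)
    next
      assume pd: "1 - a \<le> p - d"
      show "F p - F 0 \<le> 2 ^ Suc k * (F p - F (p - d))"
      proof (cases "p - d \<le> 0")
        case True
        have "0 \<le> F p - F (p - d)" using cumul_mono[of "p - d" p] pd d0 p_bounds by simp
        moreover have "(1::real) \<le> 2 ^ Suc k" by (rule one_le_power) simp
        ultimately have "1 * (F p - F (p - d)) \<le> 2 ^ Suc k * (F p - F (p - d))"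
          by (intro mult_right_mono)
        then show ?thesis using cumul_mono[of "p - d" 0] True pd by simp
      next
        case False
        have t: "tent a (p - d) = p + a * d" using False ap by (simp add: tent_def algebra_simps)
        have "F p - F 0 \<le> 2 ^ k * (F (p + a * d) - F p)"
          using mem[of "p - d"] pd d0 p_bounds a_bounds by (intro IH) (auto simp: t)
        also have "\<dots> \<le> 2 ^ k * (2 * (F p - F (p - d)))"
          using cumul_diff_le_pos[of "p - d" p] d0 p_bounds False by (intro mult_left_mono) (auto simp: t)
        finally show ?thesis by (simp only: power_Suc mult_ac)
      qed
    qed
  qed
  then show "p + d \<le> 1 \<Longrightarrow> F p - F 0 \<le> 2 ^ k * (F (p + d) - F p)"
    "1 - a \<le> p - d \<Longrightarrow> F p - F 0 \<le> 2 ^ k * (F p - F (p - d))" by blast+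
qed

text \<open>[p, 1] is mapped onto [1 - a, p] and [0, p] onto [p, 1], with masses at most doubled.
  Hence at least 1/3 of the mass is above p, and [0, p] has at least half of that.\<close>

lemma cumul_0_fixpt: "1 / 6 \<le> F p - F 0"
proof -
  have "tent a 0 = 1" "tent a 1 = 1 - a" using a_bounds by (auto simp: tent_def)
  then show ?thesis
    using cumul_diff_le_pos[of 0 p] cumul_diff_le_pos[of p 1] p_bounds by (simp add: cumul_ends)
qed

end

text \<open>The bound depends on \<delta> and on a lower bound \<open>l\<close> of the parameter
  only. This uniformity matters in \<open>steep\<close>, where it is applied to parameters close to
  \<open>a0\<close> that are chosen after \<kappa>.\<close>

lemma full_support:
  assumes l: "sqrt 2 < l" and \<delta>: "0 < \<delta>"
  shows "\<exists>\<kappa>>0. \<forall>a M x y. fair_tent a M \<longrightarrow> l \<le> a \<longrightarrow> 1 - a \<le> x \<longrightarrow> y \<le> 1 \<longrightarrow> \<delta> \<le> y - x \<longrightarrow>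
    \<kappa> \<le> cumul a M y - cumul a M x"
proof -
  have l1: "1 < l" using l sqrt2_bounds by auto
  have "sqrt 2 * sqrt 2 < l * l" using l l1 by (intro mult_strict_mono) auto
  then have \<theta>: "1 < l\<^sup>2 / 2" by (simp add: power2_eq_square)
  obtain r where "2 / \<delta> < (l\<^sup>2 / 2) ^ r" using real_arch_pow[OF \<theta>] by blast
  then have r: "2 < (l\<^sup>2 / 2) ^ r * \<delta>" using \<delta> by (simp add: field_simps)
  obtain k where "4 / \<delta> < l ^ k" using real_arch_pow[OF l1] by blast
  then have k: "1 \<le> l ^ k * (\<delta> / 4)" using \<delta> by (simp add: field_simps)
  show ?thesis
  proof (intro exI[of _ "1 / (6 * 2 ^ k * 4 ^ r)"] conjI allI impI)
    fix a M x y
    assume "fair_tent a M" and la: "l \<le> a" and x: "1 - a \<le> x" and y: "y \<le> 1" and xy: "\<delta> \<le> y - x"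
    then interpret fair_tent a M by simp
    have "(l\<^sup>2 / 2) ^ r * \<delta> \<le> (l\<^sup>2 / 2) ^ r * (y - x)" using xy by (intro mult_left_mono) auto
    then have "2 < (l\<^sup>2 / 2) ^ r * (y - x)" using r by linarith
    then obtain x' y' where *: "1 - a \<le> x'" "x' \<le> p" "p \<le> y'" "y' \<le> 1"
      "(y - x) / 2 \<le> y' - x'" "F y' - F x' \<le> 4 ^ r * (F y - F x)"
      using grow_to_fixpt[OF l la x _ y] xy \<delta> by fastforce
    \<comment> \<open>The interval around the fixed point has length at least \<delta> / 2, so one
      of its sides has length at least \<delta> / 4.\<close>
    have "1 / 6 \<le> 2 ^ k * (F y' - F x')"
    proof (cases "\<delta> / 4 \<le> y' - p")
      case True
      have "1 / 6 \<le> 2 ^ k * (F (p + \<delta> / 4) - F p)"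
        using grow_from_fixpt(1)[OF l1 la k] cumul_0_fixpt True * by linarith
      also have "\<dots> \<le> 2 ^ k * (F y' - F x')"
        using cumul_mono[of "p + \<delta> / 4" y'] cumul_mono[of x' p] True * \<delta> p_bounds a_bounds
        by (intro mult_left_mono) auto
      finally show ?thesis .
    next
      case False
      then have x': "x' \<le> p - \<delta> / 4" using * xy by (simp add: field_simps)
      have "1 / 6 \<le> 2 ^ k * (F p - F (p - \<delta> / 4))"
        using grow_from_fixpt(2)[OF l1 la k] cumul_0_fixpt x' * by linarith
      also have "\<dots> \<le> 2 ^ k * (F y' - F x')"
        using cumul_mono[of x' "p - \<delta> / 4"] cumul_mono[of p y'] x' * \<delta> p_bounds a_bounds
        by (intro mult_left_mono) auto
      finally show ?thesis .
    qed
    also have "\<dots> \<le> 2 ^ k * (4 ^ r * (F y - F x))" using * by (intro mult_left_mono) auto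
    finally show "1 / (6 * 2 ^ k * 4 ^ r) \<le> F y - F x" by (simp add: field_simps)
  qed simp
qed

section \<open>Itineraries and the affine dependence on the mass of the core\<close>

definition symb :: "real \<Rightarrow> real \<Rightarrow> nat" where
  "symb a x = (if x \<le> 0 then 0 else if x \<le> a - 1 then 1 else 2)"

lemma sg_eq_symb: "sg x = (if symb a x = 0 then 1 else - 1)"
  by (auto simp: sg_def symb_def)

definition visits :: "real \<Rightarrow> nat \<Rightarrow> nat" where
  "visits a n = card {i \<in> {3..<n}. crit a i \<le> a - 1}"

text \<open>Index \<open>k\<close> belongs to \<^term>\<open>crit a (k + 3)\<close>, since \<^term>\<open>crit a 3\<close> is the first point of the critical orbit
  at which the distribution function depends on the mass of the core: there it is \<open>1 - core_mass a M\<close>.\<close>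

primrec mass_coef :: "real \<Rightarrow> nat \<Rightarrow> real" where
  "mass_coef a 0 = - 1"
| "mass_coef a (Suc k) = (if symb a (crit a (k + 3)) = 0 then - 1 + 2 * mass_coef a k
     else if symb a (crit a (k + 3)) = 1 then 1 - 2 * mass_coef a k else - mass_coef a k)"

lemma visits_Suc: "3 \<le> n \<Longrightarrow> visits a (Suc n) = visits a n + (if crit a n \<le> a - 1 then 1 else 0)"
proof -
  assume n: "3 \<le> n"
  have "{i \<in> {3..<Suc n}. crit a i \<le> a - 1} =
    (if crit a n \<le> a - 1 then insert n {i \<in> {3..<n}. crit a i \<le> a - 1} else {i \<in> {3..<n}. crit a i \<le> a - 1})"
    using n by (auto simp: less_Suc_eq)
  then show ?thesis by (simp add: visits_def)
qed

lemma visits_3 [simp]: "visits a 3 = 0"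
  by (simp add: visits_def)

lemma crit_3_le:
  assumes "sqrt 2 < a"
  shows "crit a 3 \<le> a - 1"
proof -
  have "0 < a" using assms sqrt2_bounds by auto
  then have "sqrt 2 * sqrt 2 < a * a" using assms by (intro mult_strict_mono) auto
  moreover have "1 \<le> a" using assms sqrt2_bounds by auto
  ultimately show ?thesis by (simp add: crit_3 power2_eq_square)
qed

text \<open>The signed coefficient X is unchanged outside the core and becomes 2 X + 1 or 2 X - 1 at
  a visit. It starts at 1, and the first visit, at \<open>crit a 3\<close>, turns it into 3
  whichever branch is used. From then on the bounds 2^v + 1 and 2 * 2^v - 1 are invariant; their
  strictness separates the coefficients of two times in \<open>steep\<close>.\<close>

lemma mass_coef_bounds:
  assumes a: "sqrt 2 < a"
  shows "2 ^ visits a (k + 3) \<le> - orient a (k + 3) * mass_coef a k"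
    "- orient a (k + 3) * mass_coef a k \<le> 2 * 2 ^ visits a (k + 3) - 1"
    "1 \<le> k \<Longrightarrow> 2 ^ visits a (k + 3) + 1 \<le> - orient a (k + 3) * mass_coef a k"
proof -
  define X where "X k = - orient a (k + 3) * mass_coef a k" for k
  define v where "v k = visits a (k + 3)" for k
  have o: "orient a (Suc k + 3) = orient a (k + 3) * sg (crit a (k + 3))" for k
    using orient_Suc[of "k + 3" a] by simp
  have v: "v (Suc k) = v k + (if crit a (k + 3) \<le> a - 1 then 1 else 0)" for k
    using visits_Suc[of "k + 3" a] by (simp add: v_def)
  have a1: "1 < a" using a sqrt2_bounds by auto
  have step: "X (Suc k) = X k \<and> v (Suc k) = v k \<or>
    (X (Suc k) = 2 * X k + 1 \<or> X (Suc k) = 2 * X k - 1) \<and> v (Suc k) = Suc (v k)" for k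
    using orient_cases[of a "k + 3"] a1 unfolding X_def o v mass_coef.simps
    by (auto simp: symb_def sg_def)
  have 0: "X 0 = 1" "v 0 = 0" by (simp_all add: X_def v_def)
  have 1: "X (Suc 0) = 3" "v (Suc 0) = 1"
    using crit_3_le[OF a] a1 unfolding X_def o v mass_coef.simps by (auto simp: symb_def sg_def 0)
  have main: "2 ^ v (Suc k) + 1 \<le> X (Suc k) \<and> X (Suc k) \<le> 2 * 2 ^ v (Suc k) - 1" for k
  proof (induction k)
    case (Suc k)
    then show ?case using step[of "Suc k"] by auto
  qed (simp add: 1)
  have "2 ^ v k \<le> X k \<and> X k \<le> 2 * 2 ^ v k - 1 \<and> (1 \<le> k \<longrightarrow> 2 ^ v k + 1 \<le> X k)"
    using main[of "k - 1"] by (cases k) (auto simp: 0)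
  then show "2 ^ visits a (k + 3) \<le> - orient a (k + 3) * mass_coef a k"
    "- orient a (k + 3) * mass_coef a k \<le> 2 * 2 ^ visits a (k + 3) - 1"
    "1 \<le> k \<Longrightarrow> 2 ^ visits a (k + 3) + 1 \<le> - orient a (k + 3) * mass_coef a k"
    by (auto simp: X_def v_def)
qed

lemma mass_coef_abs:
  assumes "sqrt 2 < a"
  shows "2 ^ visits a (k + 3) \<le> \<bar>mass_coef a k\<bar>" "\<bar>mass_coef a k\<bar> \<le> 2 * 2 ^ visits a (k + 3)"
proof -
  have "\<bar>- orient a (k + 3) * mass_coef a k\<bar> = \<bar>mass_coef a k\<bar>" by (simp add: abs_mult)
  moreover have "(0::real) < 2 ^ visits a (k + 3)" by simp
  ultimately show "2 ^ visits a (k + 3) \<le> \<bar>mass_coef a k\<bar>" "\<bar>mass_coef a k\<bar> \<le> 2 * 2 ^ visits a (k + 3)"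
    using mass_coef_bounds(1,2)[OF assms, of k] by linarith+
qed

text \<open>The masses obey a recursion which is affine in the mass of the core and depends otherwise only on the
  itinerary of the critical point.\<close>

lemma cumul_crit_diff:
  assumes "fair_tent a M" "fair_tent a' M'"
    and "\<And>i. 3 \<le> i \<Longrightarrow> i < k + 3 \<Longrightarrow> symb a (crit a i) = symb a' (crit a' i)"
  shows "cumul a M (crit a (k + 3)) - cumul a' M' (crit a' (k + 3)) =
    mass_coef a k * (core_mass a M - core_mass a' M')"
proof -
  have rec: "cumul a M (crit a (Suc n)) = (if symb a (crit a n) = 0 then 1 - core_mass a M + 2 * cumul a M (crit a n)
      else if symb a (crit a n) = 1 then 1 + core_mass a M - 2 * cumul a M (crit a n)
      else 1 - cumul a M (crit a n))" if "fair_tent a M" for a M n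
  proof -
    interpret fair_tent a M by fact
    have "crit a n \<in> {1 - a..1}" using a_bounds by (intro crit_mem) auto
    then show ?thesis
      unfolding crit_Suc_tent using cumul_tent_neg[of "crit a n"] cumul_tent_pos[of "crit a n"] cumul_tent_outer[of "crit a n"]
      by (auto simp: symb_def)
  qed
  show ?thesis
    using assms(3)
  proof (induction k)
    case 0
    interpret A: fair_tent a M by fact
    interpret B: fair_tent a' M' by fact
    show ?case by (simp add: A.cumul_crit_3 B.cumul_crit_3)
  next
    case (Suc k)
    have "symb a (crit a (k + 3)) = symb a' (crit a' (k + 3))" by (rule Suc.prems) auto
    moreover have "cumul a M (crit a (k + 3)) - cumul a' M' (crit a' (k + 3)) =
      mass_coef a k * (core_mass a M - core_mass a' M')"
      by (rule Suc.IH) (rule Suc.prems, auto)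
    ultimately show ?case
      using rec[OF assms(1), of "k + 3"] rec[OF assms(2), of "k + 3"]
      by (auto simp: algebra_simps)
  qed
qed

section \<open>Cylinders and entropy\<close>

text \<open>The binary logarithm of the factor by which the iterate multiplies masses on the
  cylinder of the word.\<close>

definition weight :: "nat list \<Rightarrow> nat" where
  "weight w = length (filter (\<lambda>s. s \<noteq> 2) w)"

lemma weight_simps [simp]: "weight [] = 0" "weight (v @ w) = weight v + weight w"
  "weight (s # w) = (if s = 2 then 0 else 1) + weight w"
  by (simp_all add: weight_def)

lemma affine_image_borel:
  fixes E :: "real set"
  assumes "E \<in> sets borel" "\<sigma> \<noteq> 0"
  shows "(\<lambda>x. \<sigma> * x + c) ` E \<in> sets borel"
proof -
  have "(\<lambda>x. \<sigma> * x + c) ` E = (\<lambda>y. (y - c) / \<sigma>) -` E"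
  proof (intro equalityI subsetI)
    fix y assume "y \<in> (\<lambda>y. (y - c) / \<sigma>) -` E"
    then have "(y - c) / \<sigma> \<in> E" "y = \<sigma> * ((y - c) / \<sigma>) + c" using assms by auto
    then show "y \<in> (\<lambda>x. \<sigma> * x + c) ` E" by blast
  qed (use assms in auto)
  moreover have "(\<lambda>y::real. (y - c) / \<sigma>) -` E \<inter> space borel \<in> sets borel"
    by (rule measurable_sets[OF _ assms(1)]) measurable
  ultimately show ?thesis by simp
qed

context fair_tent
begin

abbreviation "code \<equiv> itinerary (tent a) (symb a)"

definition cyl :: "nat \<Rightarrow> nat list \<Rightarrow> real set" where
  "cyl n w = {x \<in> space M. code n x = w}"

lemma symb_measurable: "symb a -` A \<inter> {1 - a..1} \<in> sets M"
proof -
  have "symb a \<in> measurable borel (count_space UNIV)" unfolding symb_def by measurable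
  then have "symb a -` A \<inter> space borel \<in> sets borel" by (rule measurable_sets) simp
  then have "symb a -` A \<in> sets borel" by simp
  then show ?thesis by (auto simp: sets_M)
qed

lemma simple_function_symb: "simple_function M (symb a)"
  unfolding simple_function_def
proof
  have "symb a ` space M \<subseteq> {0, 1, 2}" by (auto simp: symb_def)
  then show "finite (symb a ` space M)" by (rule finite_subset) simp
qed (use symb_measurable space_M in simp)

lemmas simple_function_code = simple_function_itinerary[OF simple_function_symb]

lemma cyl_sets: "cyl n w \<in> sets M"
proof -
  have "cyl n w = code n -` {w} \<inter> space M" by (auto simp: cyl_def)
  then show ?thesis using simple_functionD(2)[OF simple_function_code] by simp
qed

lemma cyl_snoc: "cyl (Suc n) (w @ [s]) = {x \<in> cyl n w. symb a ((tent a ^^ n) x) = s}"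
  by (auto simp: cyl_def itinerary_Suc)

lemma code_in: "code n x \<in> {w. set w \<subseteq> {0, 1, 2} \<and> length w = n}"
  by (auto simp: itinerary_def symb_def)

lemma finite_words: "finite {w. set w \<subseteq> {0, 1, 2::nat} \<and> length w = n}"
  by (rule finite_lists_length_eq) simp

lemma cyl_affine: "\<exists>\<sigma> c. \<bar>\<sigma>\<bar> = a ^ n \<and> (\<forall>x\<in>cyl n w. (tent a ^^ n) x = \<sigma> * x + c)"
proof (induction n arbitrary: w)
  case 0
  show ?case by (intro exI[of _ 1] exI[of _ 0]) simp
next
  case (Suc n)
  show ?case
  proof (cases "cyl (Suc n) w = {}")
    case True
    then show ?thesis using a_bounds by (intro exI[of _ "a ^ Suc n"]) auto
  next
    case False
    then have "length w = Suc n" by (auto simp: cyl_def)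
    then obtain v s where w: "w = v @ [s]" by (metis length_Suc_conv_rev)
    obtain \<sigma> c where IH: "\<bar>\<sigma>\<bar> = a ^ n" "\<And>x. x \<in> cyl n v \<Longrightarrow> (tent a ^^ n) x = \<sigma> * x + c"
      using Suc by blast
    define e :: real where "e = (if s = 0 then 1 else - 1)"
    have "tent a y = 1 + e * a * y" if "symb a y = s" for y
      using that by (auto simp: tent_def e_def symb_def split: if_splits)
    then have "(tent a ^^ Suc n) x = (e * a * \<sigma>) * x + (1 + e * a * c)" if "x \<in> cyl (Suc n) w" for x
      using that IH(2)[of x] unfolding w cyl_snoc by (simp add: algebra_simps)
    moreover have "\<bar>e * a * \<sigma>\<bar> = a ^ Suc n" using IH(1) a_bounds by (simp add: e_def abs_mult)
    ultimately show ?thesis by blast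
  qed
qed

lemma cyl_expand:
  assumes "x \<in> cyl n w" "y \<in> cyl n w"
  shows "\<bar>(tent a ^^ n) x - (tent a ^^ n) y\<bar> = a ^ n * \<bar>x - y\<bar>"
proof -
  obtain \<sigma> c where \<sigma>: "\<bar>\<sigma>\<bar> = a ^ n" "\<And>x. x \<in> cyl n w \<Longrightarrow> (tent a ^^ n) x = \<sigma> * x + c"
    using cyl_affine by blast
  have "(tent a ^^ n) x - (tent a ^^ n) y = \<sigma> * (x - y)"
    using \<sigma>(2) assms by (simp add: algebra_simps)
  then show ?thesis using \<sigma>(1) by (simp add: abs_mult)
qed

lemma tent_iterate_mem: "x \<in> {1 - a..1} \<Longrightarrow> (tent a ^^ n) x \<in> {1 - a..1}"
  using a_bounds by (intro tent_funpow_mem) auto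

lemma cyl_diam: "x \<in> cyl n w \<Longrightarrow> y \<in> cyl n w \<Longrightarrow> \<bar>x - y\<bar> \<le> 2 / a ^ n"
proof -
  assume xy: "x \<in> cyl n w" "y \<in> cyl n w"
  then have "(tent a ^^ n) x \<in> {1 - a..1}" "(tent a ^^ n) y \<in> {1 - a..1}"
    using tent_iterate_mem by (auto simp: cyl_def space_M)
  then have "\<bar>(tent a ^^ n) x - (tent a ^^ n) y\<bar> \<le> 2" using a_bounds by auto
  then show ?thesis using cyl_expand[OF xy] a_bounds by (simp add: field_simps)
qed

lemma image_cyl_sets:
  assumes "E \<in> sets M" "E \<subseteq> cyl n w"
  shows "(tent a ^^ n) ` E \<in> sets M"
proof -
  obtain \<sigma> c where \<sigma>: "\<bar>\<sigma>\<bar> = a ^ n" "\<And>x. x \<in> cyl n w \<Longrightarrow> (tent a ^^ n) x = \<sigma> * x + c"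
    using cyl_affine by blast
  have "(tent a ^^ n) ` E = (\<lambda>x. \<sigma> * x + c) ` E" using \<sigma>(2) assms by (intro image_cong) auto
  moreover have "\<sigma> \<noteq> 0" using \<sigma>(1) a_bounds by auto
  ultimately have "(tent a ^^ n) ` E \<in> sets borel"
    using affine_image_borel assms(1) sets_M by metis
  moreover have "(tent a ^^ n) ` E \<subseteq> {1 - a..1}"
    using assms(1) tent_iterate_mem by (auto simp: sets_M)
  ultimately show ?thesis by (simp add: sets_M)
qed

lemma measure_image_cyl:
  assumes "E \<in> sets M" "E \<subseteq> cyl n w"
  shows "measure M ((tent a ^^ n) ` E) = 2 ^ weight w * measure M E"
  using assms
proof (induction n arbitrary: w)
  case 0
  show ?case
  proof (cases "E = {}")
    case False
    then have "w = []" using 0 by (auto simp: cyl_def)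
    then show ?thesis by simp
  qed simp
next
  case (Suc n)
  show ?case
  proof (cases "E = {}")
    case False
    then have "length w = Suc n" using Suc.prems by (auto simp: cyl_def)
    then obtain v s where w: "w = v @ [s]" by (metis length_Suc_conv_rev)
    have Ev: "E \<subseteq> cyl n v" and Es: "\<And>x. x \<in> E \<Longrightarrow> symb a ((tent a ^^ n) x) = s"
      using Suc.prems unfolding w cyl_snoc by auto
    let ?E = "(tent a ^^ n) ` E"
    have sets: "?E \<in> sets M" by (rule image_cyl_sets[OF Suc.prems(1) Ev])
    have sub: "\<And>y. y \<in> ?E \<Longrightarrow> 1 - a \<le> y \<and> y \<le> 1 \<and> symb a y = s" using sets Es by (auto simp: sets_M)
    have "measure M (tent a ` ?E) = (if s = 2 then 1 else 2) * measure M ?E"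
    proof (cases "s = 2")
      case True
      have "y \<in> {a - 1<..1}" if "y \<in> ?E" for y
        using sub[OF that] a_bounds True by (simp add: symb_def split: if_splits)
      then have "?E \<subseteq> {a - 1<..1}" by (rule subsetI)
      then show ?thesis using measure_tent_image_outer[OF sets] True by simp
    next
      case False
      have "?E \<subseteq> {1 - a..0} \<or> ?E \<subseteq> {0..a - 1}"
      proof (cases "s = 0")
        case True
        have "y \<in> {1 - a..0}" if "y \<in> ?E" for y
          using sub[OF that] True by (simp add: symb_def split: if_splits)
        then show ?thesis by blast
      next
        case False
        have "y \<in> {0..a - 1}" if "y \<in> ?E" for y
          using sub[OF that] False \<open>s \<noteq> 2\<close> by (simp add: symb_def split: if_splits)
        then show ?thesis by blast
      qed
      then show ?thesis using measure_tent_image[OF sets] False by simp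
    qed
    moreover have "(tent a ^^ Suc n) ` E = tent a ` ?E" by (simp add: image_image)
    ultimately show ?thesis using Suc.IH[OF Suc.prems(1) Ev] by (simp add: w)
  qed simp
qed

lemma measure_cyl: "measure M (cyl n w) = measure M ((tent a ^^ n) ` cyl n w) / 2 ^ weight w"
  using measure_image_cyl[OF cyl_sets order_refl, of n w] by (simp add: field_simps)

lemma measure_cyl_le: "measure M (cyl n w) \<le> 1 / 2 ^ weight w"
  unfolding measure_cyl by (intro divide_right_mono prob_le_1) auto

lemma cyl_eq_vimage: "code n -` {w} \<inter> space M = cyl n w"
  by (auto simp: cyl_def)

lemma weight_code: "real (weight (code n x)) = (\<Sum>i<n. indicator {..a - 1} ((tent a ^^ i) x))"
proof (induction n)
  case (Suc n)
  have "symb a y = 2 \<longleftrightarrow> y \<notin> {..a - 1}" for y using a_bounds by (auto simp: symb_def)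
  then show ?case using Suc by (simp add: itinerary_Suc indicator_def)
qed simp

lemma integrable_bounded:
  fixes f :: "real \<Rightarrow> real"
  assumes "f \<in> borel_measurable M" "\<And>x. x \<in> space M \<Longrightarrow> \<bar>f x\<bar> \<le> B"
  shows "integrable M f"
  by (rule integrable_const_bound[where B = B]) (use assms in auto)

lemma indicator_measurable: "A \<in> sets borel \<Longrightarrow> (indicator A :: real \<Rightarrow> real) \<in> borel_measurable M"
  by (intro measurable_M borel_measurable_indicator)

lemma integral_core: "(\<integral>x. indicator {..a - 1} x \<partial>M) = b"
proof -
  have "(\<integral>x. indicator {..a - 1} x \<partial>M) = measure M ({..a - 1} \<inter> space M)"
    by (rule Bochner_Integration.integral_indicator)
  also have "{..a - 1} \<inter> space M = {1 - a..a - 1}" using a_bounds by (auto simp: space_M)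
  finally show ?thesis by (simp add: core_mass_def)
qed

lemma integral_weight: "(\<integral>x. real (weight (code n x)) \<partial>M) = real n * b"
proof -
  have m: "(\<lambda>x. indicator {..a - 1} ((tent a ^^ i) x) :: real) \<in> borel_measurable M" for i
    using measurable_compose[OF funpow_meas indicator_measurable[of "{..a - 1}"]] by simp
  have "(\<integral>x. real (weight (code n x)) \<partial>M) = (\<Sum>i<n. \<integral>x. indicator {..a - 1} ((tent a ^^ i) x) \<partial>M)"
    unfolding weight_code
    by (intro Bochner_Integration.integral_sum integrable_bounded[where B = 1] m) (auto simp: indicator_def)
  also have "\<dots> = (\<Sum>i<n. b)"
    by (rule sum.cong[OF refl], subst integral_funpow[OF indicator_measurable], simp, rule integral_core)
  finally show ?thesis by simp
qed

lemma integral_simple: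
  fixes h :: "'c \<Rightarrow> real"
  assumes X: "simple_function M X"
  shows "(\<integral>x. h (X x) \<partial>M) = (\<Sum>w\<in>X ` space M. h w * measure M (X -` {w} \<inter> space M))"
proof -
  have fin: "finite (X ` space M)" by (rule simple_functionD[OF X])
  have "(\<integral>x. h (X x) \<partial>M) = (\<integral>x. (\<Sum>w\<in>X ` space M. h w * indicator (X -` {w} \<inter> space M) x) \<partial>M)"
  proof (rule Bochner_Integration.integral_cong[OF refl])
    fix x assume "x \<in> space M"
    then have "(\<Sum>w\<in>X ` space M. h w * indicator (X -` {w} \<inter> space M) x) = (\<Sum>w\<in>X ` space M. if w = X x then h w else 0)"
      by (intro sum.cong) (auto simp: indicator_def)
    then show "h (X x) = (\<Sum>w\<in>X ` space M. h w * indicator (X -` {w} \<inter> space M) x)"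
      using fin \<open>x \<in> space M\<close> by simp
  qed
  also have "\<dots> = (\<Sum>w\<in>X ` space M. \<integral>x. h w * indicator (X -` {w} \<inter> space M) x \<partial>M)"
    using simple_functionD(2)[OF X]
    by (intro Bochner_Integration.integral_sum integrable_mult_right) (auto simp: integrable_indicator_iff less_top[symmetric])
  also have "\<dots> = (\<Sum>w\<in>X ` space M. h w * measure M (X -` {w} \<inter> space M))"
    using sets.sets_into_space simple_functionD(2)[OF X] by (intro sum.cong) (auto simp: Int_absorb2)
  finally show ?thesis .
qed

section \<open>The partition into branches generates\<close>

definition approximable :: "real set \<Rightarrow> bool" where
  "approximable A \<longleftrightarrow> (\<forall>\<epsilon>>0. \<exists>m0. \<forall>m\<ge>m0. \<exists>W. prob {x \<in> space M. (x \<in> A) \<noteq> (code m x \<in> W)} \<le> \<epsilon>)"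

lemma code_vimage_sets: "{x \<in> space M. code m x \<in> W} \<in> sets M"
proof -
  have "{x \<in> space M. code m x \<in> W} = code m -` W \<inter> space M" by auto
  then show ?thesis using simple_functionD(2)[OF simple_function_code] by simp
qed

lemma bad_sets:
  assumes "A \<in> sets borel"
  shows "{x \<in> space M. (x \<in> A) \<noteq> (code m x \<in> W)} \<in> sets M"
proof -
  have A: "A \<inter> space M \<in> sets M" using assms by (auto simp: sets_M space_M)
  have "{x \<in> space M. (x \<in> A) \<noteq> (code m x \<in> W)} =
    (A \<inter> space M - {x \<in> space M. code m x \<in> W}) \<union> ({x \<in> space M. code m x \<in> W} - A \<inter> space M)"
    by auto
  then show ?thesis using A code_vimage_sets by auto
qed

text \<open>A cylinder of level m that meets both sides of \<open>t\<close> has diameter at most 2 /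
  a^m. Accepting all cylinders that meet the half-line thus errs only in (t, t + 2 / a^m], and these
  sets decrease to the empty set.\<close>

lemma approximable_atMost: "approximable {..t}"
  unfolding approximable_def
proof (intro allI impI)
  fix \<epsilon> :: real assume \<epsilon>: "0 < \<epsilon>"
  define G where "G m = {t<..t + 2 / a ^ m} \<inter> space M" for m
  have Gs: "G m \<in> sets M" for m by (auto simp: G_def sets_M space_M)
  have "decseq G"
  proof (rule decseq_SucI)
    fix m
    have "2 / a ^ Suc m \<le> 2 / a ^ m" using a_bounds by (intro divide_left_mono) auto
    then show "G (Suc m) \<subseteq> G m" unfolding G_def by fastforce
  qed
  then have "(\<lambda>m. measure M (G m)) \<longlonglongrightarrow> measure M (\<Inter>m. G m)"
    using Gs by (intro finite_Lim_measure_decseq) auto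
  moreover have "(\<Inter>m. G m) = {}"
  proof (rule ccontr)
    assume "(\<Inter>m. G m) \<noteq> {}"
    then obtain x where x: "\<And>m. t < x \<and> x \<le> t + 2 / a ^ m" unfolding G_def by fastforce
    obtain m where "2 / (x - t) < a ^ m" using real_arch_pow a_bounds by blast
    then have "2 / a ^ m < x - t" using x[of 0] a_bounds by (simp add: field_simps)
    then show False using x[of m] by simp
  qed
  ultimately have "(\<lambda>m. measure M (G m)) \<longlonglongrightarrow> 0" by simp
  then obtain m0 where m0: "\<And>m. m \<ge> m0 \<Longrightarrow> measure M (G m) < \<epsilon>"
    using \<epsilon> order_tendstoD(2)[of _ 0 sequentially \<epsilon>] unfolding eventually_sequentially by blast
  show "\<exists>m0. \<forall>m\<ge>m0. \<exists>W. prob {x \<in> space M. (x \<in> {..t}) \<noteq> (code m x \<in> W)} \<le> \<epsilon>"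
  proof (intro exI allI impI)
    fix m assume m: "m0 \<le> m"
    define W where "W = code m ` ({..t} \<inter> space M)"
    have "{x \<in> space M. (x \<in> {..t}) \<noteq> (code m x \<in> W)} \<subseteq> G m"
    proof
      fix x assume "x \<in> {x \<in> space M. (x \<in> {..t}) \<noteq> (code m x \<in> W)}"
      then have x: "x \<in> space M" "t < x" "code m x \<in> W" by (auto simp: W_def)
      then obtain y where y: "y \<in> space M" "y \<le> t" "code m x = code m y" by (auto simp: W_def)
      have "\<bar>x - y\<bar> \<le> 2 / a ^ m" using x y by (intro cyl_diam[of _ _ "code m x"]) (auto simp: cyl_def)
      then show "x \<in> G m" using x y by (auto simp: G_def)
    qed
    then have "prob {x \<in> space M. (x \<in> {..t}) \<noteq> (code m x \<in> W)} \<le> measure M (G m)"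
      using Gs by (intro finite_measure_mono)
    then show "prob {x \<in> space M. (x \<in> {..t}) \<noteq> (code m x \<in> W)} \<le> \<epsilon>" using m0[OF m] by simp
  qed
qed

lemma approximable_Un:
  assumes A: "A \<in> sets borel" "approximable A" and B: "B \<in> sets borel" "approximable B"
  shows "approximable (A \<union> B)"
  unfolding approximable_def
proof (intro allI impI)
  fix \<epsilon> :: real assume "0 < \<epsilon>"
  then have e: "0 < \<epsilon> / 2" by simp
  obtain mA where mA: "\<And>m. m \<ge> mA \<Longrightarrow> \<exists>W. prob {x \<in> space M. (x \<in> A) \<noteq> (code m x \<in> W)} \<le> \<epsilon> / 2"
    using A(2) e unfolding approximable_def by blast
  obtain mB where mB: "\<And>m. m \<ge> mB \<Longrightarrow> \<exists>W. prob {x \<in> space M. (x \<in> B) \<noteq> (code m x \<in> W)} \<le> \<epsilon> / 2"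
    using B(2) e unfolding approximable_def by blast
  show "\<exists>m0. \<forall>m\<ge>m0. \<exists>W. prob {x \<in> space M. (x \<in> A \<union> B) \<noteq> (code m x \<in> W)} \<le> \<epsilon>"
  proof (intro exI[of _ "max mA mB"] allI impI)
    fix m assume m: "max mA mB \<le> m"
    obtain V W where V: "prob {x \<in> space M. (x \<in> A) \<noteq> (code m x \<in> V)} \<le> \<epsilon> / 2"
      and W: "prob {x \<in> space M. (x \<in> B) \<noteq> (code m x \<in> W)} \<le> \<epsilon> / 2"
      using mA[of m] mB[of m] m by auto
    have "prob {x \<in> space M. (x \<in> A \<union> B) \<noteq> (code m x \<in> V \<union> W)}
      \<le> prob ({x \<in> space M. (x \<in> A) \<noteq> (code m x \<in> V)} \<union> {x \<in> space M. (x \<in> B) \<noteq> (code m x \<in> W)})"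
      using A B by (intro finite_measure_mono sets.Un bad_sets) auto
    also have "\<dots> \<le> \<epsilon> / 2 + \<epsilon> / 2"
      using A B V W by (intro order_trans[OF measure_Un_le] bad_sets add_mono)
    finally have "prob {x \<in> space M. (x \<in> A \<union> B) \<noteq> (code m x \<in> V \<union> W)} \<le> \<epsilon>"
      by (simp only: field_sum_of_halves)
    then show "\<exists>W. prob {x \<in> space M. (x \<in> A \<union> B) \<noteq> (code m x \<in> W)} \<le> \<epsilon>"
      by (rule exI[of _ "V \<union> W"])
  qed
qed

text \<open>Half-lines generate the Borel sets. In the step for countable unions, a finite partial
  union misses only a set of small measure.\<close>

lemma approximable_borel: "A \<in> sets borel \<Longrightarrow> approximable A"
proof -
  assume "A \<in> sets borel"
  then have "A \<in> sigma_sets UNIV (range (\<lambda>t::real. {..t}))" by (simp add: borel_eq_atMost)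
  then have "A \<in> sets borel \<and> approximable A"
  proof (induction rule: sigma_sets.induct)
    case (Basic A)
    then show ?case using approximable_atMost by auto
  next
    case Empty
    show ?case by (auto simp: approximable_def intro!: exI[of _ "{}"])
  next
    case (Compl A)
    have "approximable (UNIV - A)"
      unfolding approximable_def
    proof (intro allI impI)
      fix \<epsilon> :: real assume "0 < \<epsilon>"
      then obtain m0 where m0: "\<And>m. m \<ge> m0 \<Longrightarrow> \<exists>W. prob {x \<in> space M. (x \<in> A) \<noteq> (code m x \<in> W)} \<le> \<epsilon>"
        using Compl unfolding approximable_def by blast
      have eq: "{x \<in> space M. (x \<in> UNIV - A) \<noteq> (code m x \<in> - W)} = {x \<in> space M. (x \<in> A) \<noteq> (code m x \<in> W)}" for m W
        by auto
      show "\<exists>m0. \<forall>m\<ge>m0. \<exists>W. prob {x \<in> space M. (x \<in> UNIV - A) \<noteq> (code m x \<in> W)} \<le> \<epsilon>"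
      proof (intro exI[of _ m0] allI impI)
        fix m assume "m0 \<le> m"
        then obtain W where "prob {x \<in> space M. (x \<in> A) \<noteq> (code m x \<in> W)} \<le> \<epsilon>" using m0 by blast
        then have "prob {x \<in> space M. (x \<in> UNIV - A) \<noteq> (code m x \<in> - W)} \<le> \<epsilon>" by (simp only: eq)
        then show "\<exists>W. prob {x \<in> space M. (x \<in> UNIV - A) \<noteq> (code m x \<in> W)} \<le> \<epsilon>"
          by (rule exI[of _ "- W"])
      qed
    qed
    then show ?case using Compl by auto
  next
    case (Union A)
    have As: "A i \<in> sets borel" "approximable (A i)" for i using Union by auto
    define C where "C k = (\<Union>i<k. A i)" for k
    have Cs: "C k \<in> sets borel \<and> approximable (C k)" for k
    proof (induction k)
      case 0
      show ?case by (auto simp: C_def approximable_def intro!: exI[of _ "{}"])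
    next
      case (Suc k)
      have "C (Suc k) = C k \<union> A k" by (auto simp: C_def less_Suc_eq)
      then show ?case using Suc As by (auto intro: approximable_Un)
    qed
    have UA: "(\<Union>i. A i) \<in> sets borel" using As by auto
    have "approximable (\<Union>i. A i)"
      unfolding approximable_def
    proof (intro allI impI)
      fix \<epsilon> :: real assume "0 < \<epsilon>"
      then have e: "0 < \<epsilon> / 2" by simp
      define R where "R k = ((\<Union>i. A i) - C k) \<inter> space M" for k
      have Rs: "R k \<in> sets M" for k
      proof -
        have "(\<Union>i. A i) - C k \<in> sets borel" using UA Cs by (intro sets.Diff) auto
        then show ?thesis by (auto simp: R_def sets_M space_M)
      qed
      have "decseq R" by (rule decseq_SucI) (auto simp: R_def C_def)
      then have "(\<lambda>k. measure M (R k)) \<longlonglongrightarrow> measure M (\<Inter>k. R k)"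
        using Rs by (intro finite_Lim_measure_decseq) auto
      moreover have "(\<Inter>k. R k) = {}" by (auto simp: R_def C_def)
      ultimately have "(\<lambda>k. measure M (R k)) \<longlonglongrightarrow> 0" by simp
      then obtain k where k: "measure M (R k) < \<epsilon> / 2"
        using e order_tendstoD(2)[of _ 0 sequentially "\<epsilon> / 2"] unfolding eventually_sequentially by blast
      obtain m0 where m0: "\<And>m. m \<ge> m0 \<Longrightarrow> \<exists>W. prob {x \<in> space M. (x \<in> C k) \<noteq> (code m x \<in> W)} \<le> \<epsilon> / 2"
        using Cs[of k] e unfolding approximable_def by blast
      show "\<exists>m0. \<forall>m\<ge>m0. \<exists>W. prob {x \<in> space M. (x \<in> (\<Union>i. A i)) \<noteq> (code m x \<in> W)} \<le> \<epsilon>"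
      proof (intro exI[of _ m0] allI impI)
        fix m assume "m0 \<le> m"
        then obtain W where W: "prob {x \<in> space M. (x \<in> C k) \<noteq> (code m x \<in> W)} \<le> \<epsilon> / 2" using m0 by blast
        have "prob {x \<in> space M. (x \<in> (\<Union>i. A i)) \<noteq> (code m x \<in> W)}
          \<le> prob ({x \<in> space M. (x \<in> C k) \<noteq> (code m x \<in> W)} \<union> R k)"
          using Cs Rs by (intro finite_measure_mono sets.Un bad_sets) (auto simp: R_def C_def)
        also have "\<dots> \<le> \<epsilon> / 2 + \<epsilon> / 2"
          using Cs Rs W k by (intro order_trans[OF measure_Un_le] bad_sets add_mono) auto
        finally have "prob {x \<in> space M. (x \<in> (\<Union>i. A i)) \<noteq> (code m x \<in> W)} \<le> \<epsilon>"
          by (simp only: field_sum_of_halves)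
        then show "\<exists>W. prob {x \<in> space M. (x \<in> (\<Union>i. A i)) \<noteq> (code m x \<in> W)} \<le> \<epsilon>"
          by (rule exI[of _ W])
      qed
    qed
    then show ?case using UA by simp
  qed
  then show ?thesis ..
qed

end

section \<open>Markov parameters\<close>

locale markov_tent = fair_tent +
  assumes finite_crit: "finite (range (crit a))"
begin

text \<open>A forward invariant set that contains all endpoints of branches: 0, 1 and 1 - a begin
  the critical orbit, and a - 1 has the same image as 1 - a.\<close>

definition V :: "real set" where
  "V = insert (a - 1) (range (crit a))"

lemma V_facts: "finite V" "0 \<in> V" "1 \<in> V" "1 - a \<in> V" "a - 1 \<in> V" "V \<subseteq> {1 - a..1}"
    "v \<in> V \<Longrightarrow> tent a v \<in> V"
proof -
  show "finite V" using finite_crit by (simp add: V_def)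
  show "0 \<in> V" "1 \<in> V" "1 - a \<in> V" "a - 1 \<in> V"
    unfolding V_def by (auto intro: range_eqI[of _ _ 0] range_eqI[of _ _ 1] range_eqI[of _ _ 2] simp: crit_2)
  have "crit a n \<in> {1 - a..1}" for n using a_bounds by (intro crit_mem) auto
  then show "V \<subseteq> {1 - a..1}" using a_bounds by (auto simp: V_def)
  have "tent a (a - 1) = crit a 3"
    using crit_Suc_tent[of a 2] a_bounds by (simp add: crit_2 tent_def)
  then show "tent a v \<in> V" if "v \<in> V"
    using that by (auto simp: V_def crit_Suc_tent[symmetric])
qed

definition gap :: real where
  "gap = Min (insert 1 {y - x | x y. x \<in> V \<and> y \<in> V \<and> x < y})"

lemma gap: "0 < gap" "x \<in> V \<Longrightarrow> y \<in> V \<Longrightarrow> x < y \<Longrightarrow> gap \<le> y - x"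
proof -
  have "{y - x | x y. x \<in> V \<and> y \<in> V \<and> x < y} \<subseteq> (\<lambda>(x, y). y - x) ` (V \<times> V)" by auto
  then have fin: "finite {y - x | x y. x \<in> V \<and> y \<in> V \<and> x < y}"
    using V_facts(1) finite_subset by blast
  then show "0 < gap" by (auto simp: gap_def)
  show "gap \<le> y - x" if "x \<in> V" "y \<in> V" "x < y"
    unfolding gap_def using fin that by (intro Min_le) auto
qed

text \<open>A further letter intersects the image with a branch, whose endpoints lie in
  \<open>V\<close>, and then applies the map, which preserves \<open>V\<close>. Sandwiching between
  an open and a closed interval avoids deciding which endpoints belong to the image; the degenerate
  case \<alpha> = \<beta> is included.\<close>

lemma cyl_image_ends:
  assumes "cyl n w \<noteq> {}"
  shows "\<exists>\<alpha>\<in>V. \<exists>\<beta>\<in>V. \<alpha> \<le> \<beta> \<and> {\<alpha><..<\<beta>} \<subseteq> (tent a ^^ n) ` cyl n w \<and> (tent a ^^ n) ` cyl n w \<subseteq> {\<alpha>..\<beta>}"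
  using assms
proof (induction n arbitrary: w)
  case 0
  then have "cyl 0 w = {1 - a..1}" by (auto simp: cyl_def space_M)
  then show ?case using V_facts a_bounds by (intro bexI[of _ "1 - a"] bexI[of _ 1]) auto
next
  case (Suc n)
  then have "length w = Suc n" by (auto simp: cyl_def)
  then obtain v s where w: "w = v @ [s]" by (metis length_Suc_conv_rev)
  define S where "S = {y. 1 - a \<le> y \<and> y \<le> 1 \<and> symb a y = s}"
  let ?E = "(tent a ^^ n) ` cyl n v"
  have E: "?E \<subseteq> {1 - a..1}" using tent_iterate_mem by (auto simp: cyl_def space_M)
  have img: "(tent a ^^ Suc n) ` cyl (Suc n) w = tent a ` (?E \<inter> S)"
    unfolding w cyl_snoc S_def using E by (auto simp: image_iff) force+
  then have ne: "?E \<inter> S \<noteq> {}" using Suc.prems by auto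
  obtain \<alpha> \<beta> where ab: "\<alpha> \<in> V" "\<beta> \<in> V" "\<alpha> \<le> \<beta>" "{\<alpha><..<\<beta>} \<subseteq> ?E" "?E \<subseteq> {\<alpha>..\<beta>}"
    using Suc.IH[of v] ne by fastforce
  have "\<exists>lo\<in>V. \<exists>hi\<in>V. {lo<..<hi} \<subseteq> S \<and> S \<subseteq> {lo..hi} \<and> (hi \<le> 0 \<or> 0 \<le> lo)"
  proof -
    consider "s = 0" | "s = 1" | "s = 2" using ne by (auto simp: S_def symb_def split: if_splits)
    then show ?thesis
    proof cases
      case 1
      have "{1 - a<..<0} \<subseteq> S" "S \<subseteq> {1 - a..0}" using 1 by (auto simp: S_def symb_def split: if_splits)
      then show ?thesis using V_facts by (intro bexI[of _ "1 - a"] bexI[of _ 0]) auto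
    next
      case 2
      have "{0<..<a - 1} \<subseteq> S" "S \<subseteq> {0..a - 1}" using 2 a_bounds by (auto simp: S_def symb_def split: if_splits)
      then show ?thesis using V_facts by (intro bexI[of _ 0] bexI[of _ "a - 1"]) auto
    next
      case 3
      have "{a - 1<..<1} \<subseteq> S" "S \<subseteq> {a - 1..1}" using 3 a_bounds by (auto simp: S_def symb_def split: if_splits)
      then show ?thesis using V_facts a_bounds by (intro bexI[of _ "a - 1"] bexI[of _ 1]) auto
    qed
  qed
  then obtain lo hi where S: "lo \<in> V" "hi \<in> V" "{lo<..<hi} \<subseteq> S" "S \<subseteq> {lo..hi}" "hi \<le> 0 \<or> 0 \<le> lo" by blast
  define \<alpha>' where "\<alpha>' = max \<alpha> lo"
  define \<beta>' where "\<beta>' = min \<beta> hi"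
  have V': "\<alpha>' \<in> V" "\<beta>' \<in> V" using ab S by (auto simp: \<alpha>'_def \<beta>'_def max_def min_def)
  have sub: "?E \<inter> S \<subseteq> {\<alpha>'..\<beta>'}" using ab(5) S(4) by (fastforce simp: \<alpha>'_def \<beta>'_def)
  then have le: "\<alpha>' \<le> \<beta>'" using ne by fastforce
  have inn: "{\<alpha>'<..<\<beta>'} \<subseteq> ?E \<inter> S" using ab(4) S(3) by (auto simp: \<alpha>'_def \<beta>'_def)
  have t: "tent a \<alpha>' \<in> V" "tent a \<beta>' \<in> V" using V' V_facts(7) by auto
  consider "\<beta>' \<le> 0" | "0 \<le> \<alpha>'" using S(5) by (auto simp: \<alpha>'_def \<beta>'_def min_def max_def)
  then show ?case
    unfolding img
  proof cases
    case 1
    have I: "tent a ` {\<alpha>'..\<beta>'} = {tent a \<alpha>'..tent a \<beta>'}" using le 1 by (rule tent_image_neg)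
    have "{tent a \<alpha>'<..<tent a \<beta>'} \<subseteq> tent a ` {\<alpha>'<..<\<beta>'}"
    proof
      fix z assume z: "z \<in> {tent a \<alpha>'<..<tent a \<beta>'}"
      then have "z \<in> tent a ` {\<alpha>'..\<beta>'}" unfolding I by auto
      then obtain y where y: "y \<in> {\<alpha>'..\<beta>'}" "z = tent a y" by blast
      then have "y \<noteq> \<alpha>'" "y \<noteq> \<beta>'" using z by auto
      then show "z \<in> tent a ` {\<alpha>'<..<\<beta>'}" using y by auto
    qed
    moreover have "tent a \<alpha>' \<le> tent a \<beta>'" using I le by auto
    moreover have "tent a ` {\<alpha>'<..<\<beta>'} \<subseteq> tent a ` (?E \<inter> S)" by (rule image_mono[OF inn])
    moreover have "tent a ` (?E \<inter> S) \<subseteq> {tent a \<alpha>'..tent a \<beta>'}"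
      using image_mono[OF sub, of "tent a"] unfolding I .
    ultimately show "\<exists>\<alpha>\<in>V. \<exists>\<beta>\<in>V. \<alpha> \<le> \<beta> \<and> {\<alpha><..<\<beta>} \<subseteq> tent a ` (?E \<inter> S) \<and> tent a ` (?E \<inter> S) \<subseteq> {\<alpha>..\<beta>}"
      by (intro bexI[OF _ t(1)] bexI[OF _ t(2)] conjI) (assumption, rule order_trans)
  next
    case 2
    have I: "tent a ` {\<alpha>'..\<beta>'} = {tent a \<beta>'..tent a \<alpha>'}" using le 2 by (rule tent_image_pos)
    have "{tent a \<beta>'<..<tent a \<alpha>'} \<subseteq> tent a ` {\<alpha>'<..<\<beta>'}"
    proof
      fix z assume z: "z \<in> {tent a \<beta>'<..<tent a \<alpha>'}"
      then have "z \<in> tent a ` {\<alpha>'..\<beta>'}" unfolding I by auto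
      then obtain y where y: "y \<in> {\<alpha>'..\<beta>'}" "z = tent a y" by blast
      then have "y \<noteq> \<alpha>'" "y \<noteq> \<beta>'" using z by auto
      then show "z \<in> tent a ` {\<alpha>'<..<\<beta>'}" using y by auto
    qed
    moreover have "tent a \<beta>' \<le> tent a \<alpha>'" using I le by auto
    moreover have "tent a ` {\<alpha>'<..<\<beta>'} \<subseteq> tent a ` (?E \<inter> S)" by (rule image_mono[OF inn])
    moreover have "tent a ` (?E \<inter> S) \<subseteq> {tent a \<beta>'..tent a \<alpha>'}"
      using image_mono[OF sub, of "tent a"] unfolding I .
    ultimately show "\<exists>\<alpha>\<in>V. \<exists>\<beta>\<in>V. \<alpha> \<le> \<beta> \<and> {\<alpha><..<\<beta>} \<subseteq> tent a ` (?E \<inter> S) \<and> tent a ` (?E \<inter> S) \<subseteq> {\<alpha>..\<beta>}"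
      by (intro bexI[OF _ t(2)] bexI[OF _ t(1)] conjI) (assumption, rule order_trans)
  qed
qed

text \<open>A nondegenerate image has length at least \<open>gap\<close>, so full support bounds its
  mass below, and the scaling of masses by 2^weight and of lengths by a^n carries both bounds back
  to the cylinder. A degenerate image comes from a single point, since the iterate is injective on
  cylinders.\<close>

lemma cyl_dichotomy:
  "\<exists>\<kappa>>0. \<kappa> \<le> 1 \<and> (\<forall>n w. measure M (cyl n w) = 0 \<and> (\<exists>x. cyl n w \<subseteq> {x}) \<or>
      \<kappa> / 2 ^ weight w \<le> measure M (cyl n w) \<and>
      (\<exists>x y. {x<..<y} \<subseteq> cyl n w \<and> cyl n w \<subseteq> {x..y} \<and> gap / a ^ n \<le> y - x))"
proof -
  obtain \<kappa>0 where \<kappa>0: "\<kappa>0 > 0"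
    "\<And>x y. 1 - a \<le> x \<Longrightarrow> y \<le> 1 \<Longrightarrow> gap \<le> y - x \<Longrightarrow> \<kappa>0 \<le> F y - F x"
    using full_support[OF a_gt gap(1)] fair_tent_axioms by blast
  define \<kappa> where "\<kappa> = min 1 \<kappa>0"
  have "measure M (cyl n w) = 0 \<and> (\<exists>x. cyl n w \<subseteq> {x}) \<or>
      \<kappa> / 2 ^ weight w \<le> measure M (cyl n w) \<and>
      (\<exists>x y. {x<..<y} \<subseteq> cyl n w \<and> cyl n w \<subseteq> {x..y} \<and> gap / a ^ n \<le> y - x)" for n w
  proof (cases "cyl n w = {}")
    case False
    let ?E = "(tent a ^^ n) ` cyl n w"
    obtain \<alpha> \<beta> where ab: "\<alpha> \<in> V" "\<beta> \<in> V" "\<alpha> \<le> \<beta>" "{\<alpha><..<\<beta>} \<subseteq> ?E" "?E \<subseteq> {\<alpha>..\<beta>}"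
      using cyl_image_ends[OF False] by blast
    have Vab: "1 - a \<le> \<alpha>" "\<beta> \<le> 1" using ab V_facts(6) by auto
    obtain \<sigma> c where \<sigma>: "\<bar>\<sigma>\<bar> = a ^ n" "\<And>x. x \<in> cyl n w \<Longrightarrow> (tent a ^^ n) x = \<sigma> * x + c"
      using cyl_affine by blast
    have \<sigma>0: "\<sigma> \<noteq> 0" using \<sigma>(1) a_bounds by auto
    show ?thesis
    proof (cases "\<alpha> = \<beta>")
      case True
      obtain x where x: "x \<in> cyl n w" using False by blast
      have "y = x" if "y \<in> cyl n w" for y
      proof -
        have "(tent a ^^ n) y \<in> {\<alpha>..\<beta>}" "(tent a ^^ n) x \<in> {\<alpha>..\<beta>}" using ab(5) that x by blast+
        then have "a ^ n * \<bar>y - x\<bar> = 0" using cyl_expand[OF that x] True by simp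
        then show ?thesis using a_bounds by simp
      qed
      then have "cyl n w = {x}" using x by blast
      then show ?thesis by (auto simp: measure_singleton)
    next
      case False
      then have lt: "\<alpha> < \<beta>" using ab by simp
      have g: "gap \<le> \<beta> - \<alpha>" using gap(2)[OF ab(1,2) lt] .
      have Es: "?E \<in> sets M" by (rule image_cyl_sets[OF cyl_sets order_refl])
      have "\<kappa> \<le> F \<beta> - F \<alpha>" using \<kappa>0(2)[OF Vab g] by (simp add: \<kappa>_def)
      also have "\<dots> = measure M {\<alpha><..\<beta>}" using measure_Icc[of \<alpha> \<beta>] measure_Ioc[of \<alpha> \<beta>] Vab ab by simp
      also have "{\<alpha><..\<beta>} = {\<alpha><..<\<beta>} \<union> {\<beta>}" using lt by auto
      also have "measure M \<dots> = measure M {\<alpha><..<\<beta>} + measure M {\<beta>}"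
        using Vab lt by (intro finite_measure_Union) (auto simp: sets_M)
      also have "\<dots> \<le> measure M ?E"
        using ab(4) Es by (simp add: measure_singleton finite_measure_mono)
      finally have "\<kappa> / 2 ^ weight w \<le> measure M (cyl n w)"
        unfolding measure_cyl by (intro divide_right_mono) auto
      moreover have "\<exists>x y. {x<..<y} \<subseteq> cyl n w \<and> cyl n w \<subseteq> {x..y} \<and> gap / a ^ n \<le> y - x"
      proof -
        have inv: "x \<in> cyl n w" if x: "\<sigma> * x + c \<in> {\<alpha><..<\<beta>}" for x
        proof -
          obtain x' where "x' \<in> cyl n w" "\<sigma> * x + c = \<sigma> * x' + c" using x ab(4) \<sigma>(2) by auto
          then show ?thesis using \<sigma>0 by simp
        qed
        have out: "\<sigma> * x + c \<in> {\<alpha>..\<beta>}" if "x \<in> cyl n w" for x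
          using \<sigma>(2)[OF that] ab(5) that by auto
        have len: "gap / a ^ n \<le> (\<beta> - \<alpha>) / \<bar>\<sigma>\<bar>"
          unfolding \<sigma>(1) using g a_bounds by (intro divide_right_mono) auto
        show ?thesis
        proof (cases "\<sigma> > 0")
          case True
          have "{(\<alpha> - c) / \<sigma><..<(\<beta> - c) / \<sigma>} \<subseteq> cyl n w"
            using True by (auto intro!: inv simp: field_simps)
          moreover have "cyl n w \<subseteq> {(\<alpha> - c) / \<sigma>..(\<beta> - c) / \<sigma>}"
            using True by (auto dest!: out simp: field_simps)
          moreover have "(\<beta> - c) / \<sigma> - (\<alpha> - c) / \<sigma> = (\<beta> - \<alpha>) / \<bar>\<sigma>\<bar>" using True by (simp add: field_simps)
          ultimately show ?thesis using len by (intro exI conjI) (assumption | simp)+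
        next
          case False
          then have neg: "\<sigma> < 0" using \<sigma>0 by simp
          have "{(\<beta> - c) / \<sigma><..<(\<alpha> - c) / \<sigma>} \<subseteq> cyl n w"
            using neg by (auto intro!: inv simp: field_simps)
          moreover have "cyl n w \<subseteq> {(\<beta> - c) / \<sigma>..(\<alpha> - c) / \<sigma>}"
            using neg by (auto dest!: out simp: field_simps)
          moreover have "(\<alpha> - c) / \<sigma> - (\<beta> - c) / \<sigma> = (\<beta> - \<alpha>) / \<bar>\<sigma>\<bar>" using neg by (simp add: field_simps)
          ultimately show ?thesis using len by (intro exI conjI) (assumption | simp)+
        qed
      qed
      ultimately show ?thesis by blast
    qed
  qed auto
  then show ?thesis using \<kappa>0 by (intro exI[of _ \<kappa>]) (auto simp: \<kappa>_def)
qed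

text \<open>Masses between \<kappa> / 2^weight and 1 / 2^weight mean that the information of a
  cylinder is its weight times ln 2, up to the additive constant -ln \<kappa>. By invariance the
  mean weight is n b.\<close>

lemma ent_code_bounds:
  "\<exists>C. \<forall>n. real n * (b * ln 2) \<le> ent M (code n) \<and> ent M (code n) \<le> real n * (b * ln 2) + C"
proof -
  obtain \<kappa> where \<kappa>: "\<kappa> > 0" "\<kappa> \<le> 1"
    "\<And>n w. measure M (cyl n w) = 0 \<or> \<kappa> / 2 ^ weight w \<le> measure M (cyl n w)"
    using cyl_dichotomy by blast
  have "real n * (b * ln 2) \<le> ent M (code n) \<and> ent M (code n) \<le> real n * (b * ln 2) + (- ln \<kappa>)" for n
  proof -
    let ?m = "\<lambda>w. measure M (cyl n w)"
    have each: "?m w * (real (weight w) * ln 2) \<le> - (?m w * ln (?m w))"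
      "- (?m w * ln (?m w)) \<le> ?m w * (real (weight w) * ln 2) + ?m w * (- ln \<kappa>)" for w
    proof -
      have "?m w * (real (weight w) * ln 2) \<le> - (?m w * ln (?m w)) \<and>
        - (?m w * ln (?m w)) \<le> ?m w * (real (weight w) * ln 2) + ?m w * (- ln \<kappa>)"
      proof (cases "?m w = 0")
        case False
        then have m: "0 < ?m w" by (simp add: zero_less_measure_iff)
        have "ln (?m w) \<le> ln (1 / 2 ^ weight w)" using m measure_cyl_le by (subst ln_le_cancel_iff) auto
        then have 1: "real (weight w) * ln 2 \<le> - ln (?m w)" by (simp add: ln_div ln_realpow)
        have "ln (\<kappa> / 2 ^ weight w) \<le> ln (?m w)" using m \<kappa>(1) \<kappa>(3)[of n w] False by (subst ln_le_cancel_iff) auto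
        then have 2: "- ln (?m w) \<le> real (weight w) * ln 2 - ln \<kappa>" using \<kappa>(1) by (simp add: ln_div ln_realpow)
        show ?thesis
          using mult_left_mono[OF 1 less_imp_le[OF m]] mult_left_mono[OF 2 less_imp_le[OF m]]
          by (simp add: algebra_simps)
      qed simp
      then show "?m w * (real (weight w) * ln 2) \<le> - (?m w * ln (?m w))"
        "- (?m w * ln (?m w)) \<le> ?m w * (real (weight w) * ln 2) + ?m w * (- ln \<kappa>)" by blast+
    qed
    let ?W = "code n ` space M"
    have I: "(\<Sum>w\<in>?W. ?m w * (real (weight w) * ln 2)) = real n * (b * ln 2)"
    proof -
      have "real n * b = (\<Sum>w\<in>?W. real (weight w) * ?m w)"
        using integral_simple[OF simple_function_code[of n], of "\<lambda>w. real (weight w)"]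
        unfolding integral_weight cyl_eq_vimage by simp
      moreover have "(\<Sum>w\<in>?W. ?m w * (real (weight w) * ln 2)) = (\<Sum>w\<in>?W. real (weight w) * ?m w) * ln 2"
        unfolding sum_distrib_right by (rule sum.cong) (simp_all add: mult_ac)
      ultimately have "(\<Sum>w\<in>?W. ?m w * (real (weight w) * ln 2)) = real n * b * ln 2" by (simp only:)
      then show ?thesis by (simp only: mult.assoc)
    qed
    have J: "(\<Sum>w\<in>?W. ?m w * (- ln \<kappa>)) = - ln \<kappa>"
    proof -
      have "1 = (\<Sum>w\<in>?W. ?m w)"
        using integral_simple[OF simple_function_code[of n], of "\<lambda>w. 1"]
        unfolding cyl_eq_vimage by (simp add: prob_space)
      then show ?thesis unfolding sum_distrib_right[symmetric] by simp
    qed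
    have E: "ent M (code n) = (\<Sum>w\<in>?W. - (?m w * ln (?m w)))"
      by (simp add: ent_def cyl_eq_vimage sum_negf)
    have "(\<Sum>w\<in>?W. ?m w * (real (weight w) * ln 2)) \<le> ent M (code n)"
      unfolding E by (rule sum_mono) (rule each)
    moreover have "ent M (code n) \<le> (\<Sum>w\<in>?W. ?m w * (real (weight w) * ln 2) + ?m w * (- ln \<kappa>))"
      unfolding E by (rule sum_mono) (rule each)
    ultimately show ?thesis unfolding sum.distrib I J by simp
  qed
  then show ?thesis by blast
qed

lemma measure_entropy_eq: "measure_entropy M (tent a) = ereal (b * ln 2)"
proof -
  obtain C where C: "\<And>n. real n * (b * ln 2) \<le> ent M (code n)"
    "\<And>n. ent M (code n) \<le> real n * (b * ln 2) + C" using ent_code_bounds by blast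
  have upper: "entropy_wrt_partition M (tent a) P \<le> b * ln 2" if P: "finite_partition M P" for P
  proof (rule entropy_wrt_partition_le[OF P simple_function_symb _ C(2)])
    fix A and \<epsilon> :: real assume "A \<in> sets M" "0 < \<epsilon>"
    then have "approximable A" by (intro approximable_borel) (auto simp: sets_M)
    then show "\<exists>m0. \<forall>m\<ge>m0. \<exists>W. prob {x \<in> space M. (x \<in> A) \<noteq> (code m x \<in> W)} \<le> \<epsilon>"
      using \<open>0 < \<epsilon>\<close> by (auto simp: approximable_def)
  qed
  \<comment> \<open>The partition into branches attains the bound; \<open>g\<close> below recovers
    the branch from its cell.\<close>
  define Q where "Q = (\<lambda>w. symb a -` {w} \<inter> space M) ` symb a ` space M"
  have Q: "finite_partition M Q"
    unfolding finite_partition_def partition_on_def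
  proof (intro conjI)
    show "finite Q" using simple_functionD(1)[OF simple_function_symb] by (simp add: Q_def)
    show "Q \<subseteq> sets M" using simple_functionD(2)[OF simple_function_symb] by (auto simp: Q_def)
  qed (auto simp: Q_def disjoint_def)
  have lower: "b * ln 2 \<le> entropy_wrt_partition M (tent a) Q"
  proof (rule LIMSEQ_le_const[OF entropy_wrt_partition_LIMSEQ[OF Q]])
    have "b * ln 2 \<le> ent M (itinerary (tent a) (label Q) n) / real n" if n: "1 \<le> n" for n
    proof -
      define g where "g A = symb a (SOME x. x \<in> A)" for A
      have g: "g (label Q x) = symb a x" if "x \<in> space M" for x
      proof -
        have "label Q x = symb a -` {symb a x} \<inter> space M"
          by (rule label_eq[OF Q]) (use that in \<open>auto simp: Q_def\<close>)
        then have "(SOME y. y \<in> label Q x) \<in> symb a -` {symb a x}"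
          using that someI[of "\<lambda>y. y \<in> symb a -` {symb a x} \<inter> space M" x] by auto
        then show ?thesis by (simp add: g_def)
      qed
      have "ent M (code n) \<le> ent M (itinerary (tent a) (label Q) n)"
      proof (rule ent_le_of_fun[where f = "map g"])
        show "simple_function M (itinerary (tent a) (label Q) n)"
          by (intro simple_function_itinerary simple_function_label Q)
        fix x assume "x \<in> space M"
        then show "code n x = map g (itinerary (tent a) (label Q) n x)"
          by (simp add: itinerary_def g funpow_space)
      qed
      then have "real n * (b * ln 2) \<le> ent M (itinerary (tent a) (label Q) n)" using C(1)[of n] by simp
      then show ?thesis using n by (simp add: field_simps)
    qed
    then show "\<exists>N. \<forall>n\<ge>N. b * ln 2 \<le> ent M (itinerary (tent a) (label Q) n) / real n"
      by (intro exI[of _ 1]) blast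
  qed
  show ?thesis
    unfolding measure_entropy_def
  proof (rule antisym)
    show "(SUP P\<in>{P. finite_partition M P}. ereal (entropy_wrt_partition M (tent a) P)) \<le> ereal (b * ln 2)"
      using upper by (intro SUP_least) simp
    show "ereal (b * ln 2) \<le> (SUP P\<in>{P. finite_partition M P}. ereal (entropy_wrt_partition M (tent a) P))"
      using lower Q by (intro SUP_upper2[of Q]) auto
  qed
qed

end

section \<open>The frequency of visits to the core\<close>

context fair_tent
begin

text \<open>The involution that exchanges the two preimages of a point where there are two, and
  fixes the points outside the core.\<close>

definition sym :: "real \<Rightarrow> real" where
  "sym x = (if x \<le> a - 1 then - x else x)"

lemma sym_space: "x \<in> space M \<Longrightarrow> sym x \<in> space M"
  using a_bounds by (auto simp: sym_def space_M)

lemma tent_sym: "tent a (sym x) = tent a x"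
  by (simp add: sym_def tent_def)

lemma sym_measurable [measurable]: "sym \<in> measurable M M"
proof -
  have "sym \<in> borel_measurable borel" unfolding sym_def by measurable
  then have b: "sym \<in> borel_measurable M" by (rule measurable_M)
  have "sym \<in> measurable M (restrict_space borel {1 - a..1})"
    using b sym_space space_M by (intro measurable_restrict_space2) auto
  then show ?thesis using measurable_cong_sets[OF refl sets_M_eq] by blast
qed

text \<open>On either half of the core, a set and its reflection have the same image, whose mass is
  twice that of each.\<close>

lemma measure_uminus:
  assumes "E \<in> sets M" "E \<subseteq> {1 - a..a - 1}"
  shows "uminus ` E \<in> sets M" "measure M (uminus ` E) = measure M E"
proof -
  have neg: "uminus ` B \<in> sets M" if "B \<in> sets M" "B \<subseteq> {1 - a..a - 1}" for B
  proof -
    have "(\<lambda>x. (- 1) * x + 0) ` B \<in> sets borel"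
      using that by (intro affine_image_borel) (auto simp: sets_M)
    moreover have "(\<lambda>x. (- 1) * x + 0) ` B = uminus ` B" by (rule image_cong) auto
    moreover have "uminus ` B \<subseteq> {1 - a..1}" using that a_bounds by force
    ultimately show ?thesis by (simp add: sets_M)
  qed
  show "uminus ` E \<in> sets M" by (rule neg[OF assms])
  have half: "measure M (uminus ` B) = measure M B"
    if "B \<in> sets M" "B \<subseteq> {1 - a..0} \<or> B \<subseteq> {0..a - 1}" for B
  proof -
    have s: "uminus ` B \<in> sets M" using that a_bounds by (intro neg) auto
    have "2 * measure M (uminus ` B) = measure M (tent a ` uminus ` B)"
      using that(2) by (intro measure_tent_image[symmetric] s) force
    also have "tent a ` uminus ` B = tent a ` B" by (simp add: image_image tent_def)
    also have "measure M \<dots> = 2 * measure M B" using that by (intro measure_tent_image)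
    finally show ?thesis by simp
  qed
  define E1 where "E1 = E \<inter> {1 - a..0}"
  define E2 where "E2 = E \<inter> {0<..a - 1}"
  have s: "E1 \<in> sets M" "E2 \<in> sets M" using assms(1) by (auto simp: E1_def E2_def sets_M)
  have E: "E = E1 \<union> E2" "E1 \<inter> E2 = {}" using assms(2) by (auto simp: E1_def E2_def)
  have n: "uminus ` E1 \<in> sets M" "uminus ` E2 \<in> sets M"
    using s assms(2) by (intro neg; auto simp: E1_def E2_def)+
  have "measure M (uminus ` E) = measure M (uminus ` E1) + measure M (uminus ` E2)"
    unfolding E(1) image_Un using n E(2) by (intro finite_measure_Union) auto
  also have "\<dots> = measure M E1 + measure M E2"
  proof -
    have "E1 \<subseteq> {1 - a..0}" "E2 \<subseteq> {0..a - 1}" by (auto simp: E1_def E2_def)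
    then show ?thesis using half[OF s(1)] half[OF s(2)] by simp
  qed
  also have "\<dots> = measure M E" using finite_measure_Union[OF s E(2)] E(1) by simp
  finally show "measure M (uminus ` E) = measure M E" .
qed

lemma distr_sym: "distr M M sym = M"
proof (rule measure_eqI)
  fix E assume "E \<in> sets (distr M M sym)"
  then have E: "E \<in> sets M" by simp
  let ?D = "E \<inter> {1 - a..a - 1}" and ?R = "E \<inter> {a - 1<..1}"
  have s: "?D \<in> sets M" "?R \<in> sets M" using E by (auto simp: sets_M)
  have eq: "sym -` E \<inter> space M = uminus ` ?D \<union> ?R"
  proof (intro equalityI subsetI)
    fix x assume x: "x \<in> sym -` E \<inter> space M"
    show "x \<in> uminus ` ?D \<union> ?R"
    proof (cases "x \<le> a - 1")
      case True
      then have "- x \<in> ?D" using x by (auto simp: sym_def space_M)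
      then show ?thesis by (metis UnI1 image_eqI minus_minus)
    qed (use x in \<open>auto simp: sym_def space_M\<close>)
  qed (use a_bounds in \<open>auto simp: sym_def space_M\<close>)
  have "measure M (sym -` E \<inter> space M) = measure M (uminus ` ?D) + measure M ?R"
    unfolding eq using measure_uminus[OF s(1)] s a_bounds by (intro finite_measure_Union) auto
  also have "\<dots> = measure M ?D + measure M ?R" using measure_uminus[OF s(1)] by simp
  also have "\<dots> = measure M (?D \<union> ?R)" using s by (intro finite_measure_Union[symmetric]) auto
  also have "?D \<union> ?R = E" using E by (auto simp: sets_M)
  finally show "emeasure (distr M M sym) E = emeasure M E"
    using E by (simp add: emeasure_distr emeasure_eq_measure)
qed simp

text \<open>The fair measure gives the two preimages of a point equal weight, so a function that is
  odd under \<open>sym\<close> has conditional expectation 0 given the image point.\<close>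

lemma integral_tent_orthogonal:
  fixes \<psi> v :: "real \<Rightarrow> real"
  assumes [measurable]: "\<psi> \<in> borel_measurable M" "v \<in> borel_measurable M"
    and \<psi>: "\<And>x. x \<in> space M \<Longrightarrow> \<bar>\<psi> x\<bar> \<le> B" and v: "\<And>x. x \<in> space M \<Longrightarrow> \<bar>v x\<bar> \<le> B'"
    and sym: "AE x in M. \<psi> x + \<psi> (sym x) = 0"
  shows "(\<integral>x. \<psi> x * v (tent a x) \<partial>M) = 0"
proof -
  let ?g = "\<lambda>x. \<psi> x * v (tent a x)"
  have [measurable]: "?g \<in> borel_measurable M" by measurable
  have tent_space: "tent a x \<in> space M" if "x \<in> space M" for x using funpow_space[OF that, of 1] by simp
  have bd: "\<bar>?g x\<bar> \<le> B * B'" if "x \<in> space M" for x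
  proof -
    have "0 \<le> B" using \<psi>[OF that] by linarith
    then show ?thesis using that by (auto simp: abs_mult intro!: mult_mono \<psi> v tent_space)
  qed
  have i: "integrable M ?g" by (rule integrable_bounded[OF _ bd]) simp_all
  have i2: "integrable M (\<lambda>x. ?g (sym x))"
    by (rule integrable_bounded[where B = "B * B'"]) (measurable, rule bd, rule sym_space)
  have "(\<integral>x. ?g x \<partial>M) = (\<integral>x. ?g x \<partial>(distr M M sym))" by (simp add: distr_sym)
  also have "\<dots> = (\<integral>x. ?g (sym x) \<partial>M)" by (rule integral_distr) simp_all
  finally have "2 * (\<integral>x. ?g x \<partial>M) = (\<integral>x. ?g x + ?g (sym x) \<partial>M)"
    using i i2 by (simp add: Bochner_Integration.integral_add)
  also have "\<dots> = (\<integral>x. 0 \<partial>M)"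
  proof (rule integral_cong_AE)
    show "AE x in M. ?g x + ?g (sym x) = 0"
      using sym by eventually_elim (simp add: tent_sym distrib_right[symmetric])
  qed simp_all
  finally show ?thesis by simp
qed

section \<open>Kneading series and the Poisson equation\<close>

definition slope :: "nat \<Rightarrow> real" where
  "slope j = (if crit a (j + 3) \<le> 0 then 1 / 2 else if crit a (j + 3) \<le> a - 1 then - 1 / 2 else - 1)"

text \<open>Signed reciprocals of the slopes of the conjugate map, multiplied along the orbit of
  \<open>crit a 3\<close>; the absolute value is 2^(-visits).\<close>

definition kneading_coef :: "nat \<Rightarrow> real" where
  "kneading_coef j = (\<Prod>i<j. slope i)"

definition core :: "nat \<Rightarrow> bool" where
  "core j \<longleftrightarrow> crit a (j + 3) \<le> a - 1"

lemma kneading_coef_Suc: "kneading_coef (Suc j) = kneading_coef j * slope j"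
  by (simp add: kneading_coef_def)

lemma abs_kneading_coef_Suc:
  "\<bar>kneading_coef (Suc j)\<bar> = (if core j then \<bar>kneading_coef j\<bar> / 2 else \<bar>kneading_coef j\<bar>)"
  using a_bounds by (auto simp: kneading_coef_Suc abs_mult slope_def core_def)

lemma tent_outer_less:
  assumes "a - 1 < x"
  shows "tent a x < crit a 3"
proof -
  have "a * (a - 1) < a * x" using assms a_bounds by (intro mult_strict_left_mono) auto
  then show ?thesis using assms a_bounds by (simp add: tent_def crit_3 algebra_simps power2_eq_square)
qed

lemma core_cases: "core 0" "core j \<or> core (Suc j)"
proof -
  show "core 0" using crit_3_le[OF a_gt] by (simp add: core_def)
  show "core j \<or> core (Suc j)"
  proof (cases "core j")
    case False
    then have "crit a (Suc (j + 3)) < crit a 3"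
      unfolding crit_Suc_tent by (intro tent_outer_less) (simp add: core_def)
    then show ?thesis using crit_3_le[OF a_gt] by (simp add: core_def)
  qed simp
qed

text \<open>The complement of the core is mapped below \<open>crit a 3\<close>, hence into the core.
  So the absolute value is halved at least once in two steps, and 1/2 < (3/4)^2.\<close>

lemma kneading_coef_le: "\<bar>kneading_coef j\<bar> \<le> 2 * (3 / 4) ^ j"
proof (induction j rule: less_induct)
  case (less j)
  consider "j = 0" | "j = 1" | k where "j = Suc (Suc k)" by (metis One_nat_def old.nat.exhaust)
  then show ?case
  proof cases
    case 1
    then show ?thesis by (simp add: kneading_coef_def)
  next
    case 2
    then show ?thesis using abs_kneading_coef_Suc[of 0] core_cases(1) by (simp add: kneading_coef_def)
  next
    case 3
    have "\<bar>kneading_coef j\<bar> \<le> \<bar>kneading_coef k\<bar> / 2"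
      using core_cases(2)[of k] unfolding 3 by (auto simp: abs_kneading_coef_Suc)
    also have "\<dots> \<le> (3 / 4) ^ k" using less[of k] 3 by simp
    also have "\<dots> \<le> 2 * (3 / 4) ^ j" unfolding 3 by simp
    finally show ?thesis .
  qed
qed

lemma summable_kneading: "summable (\<lambda>j. \<bar>kneading_coef j\<bar>)"
proof (rule summable_comparison_test'[where N = 0])
  show "summable (\<lambda>j. 2 * (3 / 4 :: real) ^ j)" by (intro summable_mult summable_geometric) simp
qed (use kneading_coef_le in simp)

lemma summable_kneading_mult:
  assumes "\<And>j. \<bar>f j\<bar> \<le> 2"
  shows "summable (\<lambda>j. kneading_coef j * f j)"
proof (rule summable_comparison_test'[where N = 0])
  show "summable (\<lambda>j. \<bar>kneading_coef j\<bar> * 2)" by (intro summable_mult2 summable_kneading)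
  show "norm (kneading_coef j * f j) \<le> \<bar>kneading_coef j\<bar> * 2" for j
    using assms[of j] by (simp add: abs_mult mult_left_mono)
qed

definition core_sum :: real where
  "core_sum = (\<Sum>j. kneading_coef j * (if core j then 1 else 0))"

text \<open>The first term is 1 and, because the coefficients are halved at each visit to the core, the
  absolute values of the remaining ones add up to at most 1.\<close>

lemma core_sum_nonneg: "0 \<le> core_sum"
proof -
  have part: "2 * \<bar>kneading_coef (Suc J)\<bar> \<le> (\<Sum>j<Suc J. kneading_coef j * (if core j then 1 else 0))" for J
  proof (induction J)
    case 0
    show ?case using core_cases(1) abs_kneading_coef_Suc[of 0] by (simp add: kneading_coef_def)
  next
    case (Suc J)
    have "(\<Sum>j<Suc (Suc J). kneading_coef j * (if core j then 1 else 0)) =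
      (\<Sum>j<Suc J. kneading_coef j * (if core j then 1 else 0)) + kneading_coef (Suc J) * (if core (Suc J) then 1 else 0)"
      by simp
    then show ?case using Suc abs_kneading_coef_Suc[of "Suc J"] abs_ge_minus_self[of "kneading_coef (Suc J)"]
      by (simp split: if_splits)
  qed
  have "summable (\<lambda>j. kneading_coef j * (if core j then 1 else 0))" by (rule summable_kneading_mult) simp
  then have "(\<lambda>J. \<Sum>j<J. kneading_coef j * (if core j then 1 else 0)) \<longlonglongrightarrow> core_sum"
    unfolding core_sum_def by (rule summable_LIMSEQ)
  then have "(\<lambda>J. \<Sum>j<Suc J. kneading_coef j * (if core j then 1 else 0)) \<longlonglongrightarrow> core_sum"
    by (rule LIMSEQ_Suc)
  then show ?thesis
  proof (rule LIMSEQ_le_const)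
    have "0 \<le> (\<Sum>j<Suc J. kneading_coef j * (if core j then 1 else 0))" for J
      using part[of J] abs_ge_zero[of "kneading_coef (Suc J)"] by linarith
    then show "\<exists>N. \<forall>J\<ge>N. 0 \<le> (\<Sum>j<Suc J. kneading_coef j * (if core j then 1 else 0))" by blast
  qed
qed

definition step :: "nat \<Rightarrow> real \<Rightarrow> real" where
  "step j x = (if crit a (j + 3) \<le> x then 1 else 0)"

definition W :: "real \<Rightarrow> real" where
  "W x = (\<Sum>j. kneading_coef j * step j x)"

lemma W_bounded: "\<bar>W x\<bar> \<le> (\<Sum>j. \<bar>kneading_coef j\<bar>)"
proof -
  have "summable (\<lambda>j. \<bar>kneading_coef j * step j x\<bar>)"
    by (rule summable_comparison_test'[OF summable_kneading, of 0]) (simp add: step_def)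
  then have "\<bar>W x\<bar> \<le> (\<Sum>j. \<bar>kneading_coef j * step j x\<bar>)"
    unfolding W_def by (rule summable_rabs)
  also have "\<dots> \<le> (\<Sum>j. \<bar>kneading_coef j\<bar>)"
    by (intro suminf_le summable_kneading \<open>summable (\<lambda>j. \<bar>kneading_coef j * step j x\<bar>)\<close>) (simp add: step_def)
  finally show ?thesis .
qed

lemma W_measurable [measurable]: "W \<in> borel_measurable M"
proof (rule measurable_M)
  show "W \<in> borel_measurable borel" unfolding W_def step_def by measurable
qed

text \<open>The preimages of \<open>{crit a n..}\<close> are, up to complements, intervals of the form \<open>{\<plusminus>crit a (n - 1)..}\<close>.
  Hence the transfer operator maps the span of the indicator functions of the former and of the constants to
  itself, and a multiple of \<open>W\<close> solves the Poisson equation for the indicator function of the core.\<close>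

lemma W_tent:
  "W (tent a x) = step 0 (tent a x) + (\<Sum>j. kneading_coef j * (slope j * step (Suc j) (tent a x)))"
proof -
  have "summable (\<lambda>j. kneading_coef j * step j (tent a x))"
    by (rule summable_kneading_mult) (simp add: step_def)
  then have "W (tent a x) = (\<Sum>j. kneading_coef (Suc j) * step (Suc j) (tent a x)) + kneading_coef 0 * step 0 (tent a x)"
    unfolding W_def using suminf_split_head by fastforce
  then show ?thesis by (simp add: kneading_coef_Suc mult.assoc) (simp add: kneading_coef_def)
qed

lemma slope_bound: "\<bar>slope j\<bar> \<le> 1"
  by (simp add: slope_def)

lemma slope_step_bound: "\<bar>slope j * step (Suc j) y\<bar> \<le> 1"
  using slope_bound[of j] by (simp add: step_def)

lemma step_bound: "\<bar>step j y\<bar> \<le> 1"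
  by (simp add: step_def)

text \<open>Term j at \<open>x\<close> is paired with term j + 1 at the image. Every pair
  contributes its full coefficient: a threshold in the core lies below \<open>x\<close> and its
  image above that of \<open>x\<close>, while a threshold outside is on the same branch as
  \<open>x\<close>, where order is reversed. The unpaired term of index 0 vanishes.\<close>

lemma W_outer:
  assumes x: "a - 1 < x" "x \<le> 1" and ne: "\<And>n. \<bar>x\<bar> \<noteq> \<bar>crit a n\<bar>"
  shows "W x - W (tent a x) = (\<Sum>j. kneading_coef j)"
proof -
  have S: "summable (\<lambda>j. kneading_coef j * step j x)" 
    "summable (\<lambda>j. kneading_coef j * (slope j * step (Suc j) (tent a x)))"
    using step_bound slope_step_bound by (intro summable_kneading_mult; force intro: order_trans)+
  have "step 0 (tent a x) = 0" using tent_outer_less[OF x(1)] by (simp add: step_def)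
  then have "W x - W (tent a x) = (\<Sum>j. kneading_coef j * step j x - kneading_coef j * (slope j * step (Suc j) (tent a x)))"
    unfolding W_tent unfolding W_def using suminf_diff[OF S] by simp
  also have "\<dots> = (\<Sum>j. kneading_coef j)"
  proof (rule suminf_cong)
    fix j
    have t: "crit a (Suc j + 3) = tent a (crit a (j + 3))" using crit_Suc_tent[of a "j + 3"] by simp
    have "step j x - slope j * step (Suc j) (tent a x) = 1"
    proof (cases "core j")
      case True
      then have c: "crit a (j + 3) \<le> a - 1" by (simp add: core_def)
      have "crit a (j + 3) \<in> {1 - a..1}" using a_bounds by (intro crit_mem) auto
      then have "\<bar>crit a (j + 3)\<bar> \<le> a - 1" using c by auto
      then have "a * \<bar>crit a (j + 3)\<bar> < a * x" using x a_bounds by (intro mult_strict_left_mono) auto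
      then have "tent a x < crit a (Suc j + 3)" using x a_bounds unfolding t by (simp add: tent_def)
      then show ?thesis using c x by (simp add: step_def)
    next
      case False
      then have c: "a - 1 < crit a (j + 3)" by (simp add: core_def)
      then have sl: "slope j = - 1" using a_bounds by (simp add: slope_def)
      have "x \<noteq> crit a (j + 3)" using ne[of "j + 3"] by auto
      then have "crit a (j + 3) \<le> x \<longleftrightarrow> \<not> crit a (Suc j + 3) \<le> tent a x"
        using x c a_bounds unfolding t by (auto simp: tent_def not_le)
      then show ?thesis by (simp add: step_def sl)
    qed
    then show "kneading_coef j * step j x - kneading_coef j * (slope j * step (Suc j) (tent a x)) = kneading_coef j"
      by (simp add: right_diff_distrib[symmetric])
  qed
  finally show ?thesis .
qed

text \<open>The same pairing, summed over a fibre: a threshold in the core contributes its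
  coefficient once, any other twice. The constant -2 stems from the unpaired term of index 0, which
  is 1 on the image of the core.\<close>

lemma W_core:
  assumes x: "0 < x" "x \<le> a - 1" and ne: "\<And>n. \<bar>x\<bar> \<noteq> \<bar>crit a n\<bar>"
  shows "W x + W (- x) - 2 * W (tent a x) = 2 * (\<Sum>j. kneading_coef j) - core_sum - 2"
proof -
  have S: "summable (\<lambda>j. kneading_coef j * step j x)" "summable (\<lambda>j. kneading_coef j * step j (- x))"
    "summable (\<lambda>j. kneading_coef j * (slope j * step (Suc j) (tent a x)))"
    using step_bound slope_step_bound by (intro summable_kneading_mult; force intro: order_trans)+
  have S': "summable kneading_coef" "summable (\<lambda>j. kneading_coef j * (if core j then 1 else 0))"
    using summable_kneading_mult[of "\<lambda>_. 1"] summable_kneading_mult[of "\<lambda>j. if core j then 1 else 0"] by simp_all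
  let ?g = "\<lambda>j. kneading_coef j * step j x + kneading_coef j * step j (- x)
    - 2 * (kneading_coef j * (slope j * step (Suc j) (tent a x)))"
  have "a * x \<le> a * (a - 1)" using x a_bounds by (intro mult_left_mono) auto
  then have "step 0 (tent a x) = 1" using x a_bounds by (simp add: step_def tent_def crit_3 algebra_simps power2_eq_square)
  then have "W x + W (- x) - 2 * W (tent a x) = (\<Sum>j. ?g j) - 2"
    unfolding W_tent unfolding W_def
    using suminf_diff[OF summable_add[OF S(1,2)] summable_mult[OF S(3), of 2]] suminf_add[OF S(1,2)] suminf_mult[OF S(3), of 2]
    by simp
  also have "(\<Sum>j. ?g j) = (\<Sum>j. 2 * kneading_coef j - kneading_coef j * (if core j then 1 else 0))"
  proof (rule suminf_cong)
    fix j
    have t: "crit a (Suc j + 3) = tent a (crit a (j + 3))" using crit_Suc_tent[of a "j + 3"] by simp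
    have ne': "x \<noteq> crit a (j + 3)" "- x \<noteq> crit a (j + 3)" using ne[of "j + 3"] by auto
    have "step j x + step j (- x) - 2 * (slope j * step (Suc j) (tent a x)) = 2 - (if core j then 1 else 0)"
    proof (cases "core j")
      case True
      then have c: "crit a (j + 3) \<le> a - 1" by (simp add: core_def)
      show ?thesis
      proof (cases "crit a (j + 3) \<le> 0")
        case True
        have "a * crit a (j + 3) \<le> a * (- x) \<longleftrightarrow> crit a (j + 3) \<le> - x"
          using a_bounds by (intro mult_le_cancel_left_pos) simp
        then have "crit a (j + 3) \<le> - x \<longleftrightarrow> crit a (Suc j + 3) \<le> tent a x"
          using x True a_bounds unfolding t by (auto simp: tent_def)
        then show ?thesis using True x \<open>core j\<close> by (simp add: step_def slope_def)
      next
        case False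
        have "crit a (j + 3) \<le> x \<longleftrightarrow> \<not> crit a (Suc j + 3) \<le> tent a x"
          using x False ne' a_bounds unfolding t by (auto simp: tent_def not_le)
        then show ?thesis using False x c \<open>core j\<close> by (simp add: step_def slope_def)
      qed
    next
      case False
      then have c: "a - 1 < crit a (j + 3)" by (simp add: core_def)
      have "a * x \<le> a * crit a (j + 3)" using c x a_bounds by (intro mult_left_mono) auto
      then have "crit a (Suc j + 3) \<le> tent a x"
        using x c a_bounds unfolding t by (simp add: tent_def)
      then show ?thesis using False x c a_bounds by (simp add: step_def slope_def)
    qed
    then have "kneading_coef j * (step j x + step j (- x) - 2 * (slope j * step (Suc j) (tent a x))) =
      kneading_coef j * (2 - (if core j then 1 else 0))" by (rule arg_cong)
    then show "?g j = 2 * kneading_coef j - kneading_coef j * (if core j then 1 else 0)"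
      by (simp only: right_diff_distrib distrib_left mult.left_commute[of _ 2] mult.commute[of _ 2])
  qed
  also have "\<dots> = 2 * (\<Sum>j. kneading_coef j) - core_sum"
    using suminf_diff[OF summable_mult[OF S'(1), of 2] S'(2)] suminf_mult[OF S'(1), of 2] by (simp add: core_sum_def)
  finally show ?thesis by simp
qed

theorem AE_weight:
  "AE x in M. (\<lambda>n. real (weight (code n x)) / real n) \<longlonglongrightarrow> b"
proof -
  \<comment> \<open>Chosen so that 2 K cancels the constant -core_sum - 2 of \<open>W_core\<close>;
    nonnegativity of \<open>core_sum\<close> allows division by K.\<close>
  define K where "K = 1 + core_sum / 2"
  define A where "A = (\<Sum>j. kneading_coef j)"
  have K: "1 \<le> K" using core_sum_nonneg by (simp add: K_def)
  let ?\<phi> = "indicator {..a - 1} :: real \<Rightarrow> real"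
  define \<Theta> where "\<Theta> x = K * ?\<phi> x + W x - W (tent a x)" for x
  have [measurable]: "?\<phi> \<in> borel_measurable M" by (rule indicator_measurable) simp
  have \<Theta>m [measurable]: "\<Theta> \<in> borel_measurable M" unfolding \<Theta>_def by measurable
  define BW where "BW = (\<Sum>j. \<bar>kneading_coef j\<bar>)"
  have \<Theta>b: "\<bar>\<Theta> x\<bar> \<le> K + 2 * BW" for x
    using W_bounded[of x] W_bounded[of "tent a x"] K unfolding \<Theta>_def BW_def
    by (auto simp: indicator_def)
  have AE_ne: "AE x in M. x \<noteq> 0 \<and> (\<forall>n. \<bar>x\<bar> \<noteq> \<bar>crit a n\<bar>)"
  proof -
    have "AE x in M. x \<notin> {0}" by (rule AE_notin_finite) simp
    moreover have "AE x in M. \<forall>n. x \<notin> {crit a n, - crit a n}"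
      unfolding AE_all_countable by (intro allI AE_notin_finite) simp
    ultimately show ?thesis by eventually_elim (auto simp: abs_eq_iff)
  qed
  have pos: "\<Theta> x + \<Theta> (- x) = 2 * A" if "0 < x" "x \<le> a - 1" "\<And>n. \<bar>x\<bar> \<noteq> \<bar>crit a n\<bar>" for x
  proof -
    have "\<Theta> x + \<Theta> (- x) = 2 * K + (W x + W (- x) - 2 * W (tent a x))"
      using that a_bounds by (simp add: \<Theta>_def indicator_def tent_def)
    then show ?thesis unfolding W_core[OF that] by (simp add: K_def A_def)
  qed
  have sym: "AE x in M. \<Theta> x + \<Theta> (sym x) = 2 * A"
    using AE_ne AE_space
  proof eventually_elim
    case (elim x)
    then have x: "1 - a \<le> x" "x \<le> 1" "x \<noteq> 0" "\<And>n. \<bar>x\<bar> \<noteq> \<bar>crit a n\<bar>" by (auto simp: space_M)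
    consider "0 < x" "x \<le> a - 1" | "x < 0" | "a - 1 < x" using x by linarith
    then show ?case
    proof cases
      case 1
      then show ?thesis using pos[of x] x by (simp add: sym_def)
    next
      case 2
      then show ?thesis using pos[of "- x"] x a_bounds by (simp add: sym_def add.commute)
    next
      case 3
      then show ?thesis using W_outer[of x] x by (simp add: \<Theta>_def sym_def A_def)
    qed
  qed
  have \<Theta>i: "integrable M \<Theta>" by (rule integrable_bounded[OF \<Theta>m \<Theta>b])
  have Wi: "integrable M W" by (rule integrable_bounded[OF W_measurable W_bounded])
  have Wti: "integrable M (\<lambda>x. W (tent a x))"
    by (rule integrable_bounded[OF _ W_bounded]) measurable
  have \<phi>i: "integrable M ?\<phi>" by (rule integrable_bounded[where B = 1]) (auto simp: indicator_def)
  have I\<Theta>: "(\<integral>x. \<Theta> x \<partial>M) = A"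
  proof -
    have "(\<integral>x. \<Theta> x \<partial>M) = (\<integral>x. \<Theta> x \<partial>(distr M M sym))" by (simp add: distr_sym)
    also have "\<dots> = (\<integral>x. \<Theta> (sym x) \<partial>M)" by (rule integral_distr) simp_all
    finally have "2 * (\<integral>x. \<Theta> x \<partial>M) = (\<integral>x. \<Theta> x \<partial>M) + (\<integral>x. \<Theta> (sym x) \<partial>M)" by simp
    also have "\<dots> = (\<integral>x. \<Theta> x + \<Theta> (sym x) \<partial>M)"
      using \<Theta>i by (intro Bochner_Integration.integral_add[symmetric] integrable_bounded[OF _ \<Theta>b]) measurable
    also have "\<dots> = (\<integral>x. 2 * A \<partial>M)" by (rule integral_cong_AE) (use sym in measurable)
    finally show ?thesis by (simp add: prob_space)
  qed
  have "(\<integral>x. \<Theta> x \<partial>M) = K * b"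
  proof -
    have "(\<integral>x. W (tent a x) \<partial>M) = (\<integral>x. W x \<partial>M)"
      using integral_funpow[OF W_measurable, of 1] by simp
    then show ?thesis unfolding \<Theta>_def using \<phi>i Wi Wti integral_core by simp
  qed
  then have AK: "A = K * b" using I\<Theta> by simp
  define \<psi> where "\<psi> x = \<Theta> x - A" for x
  have [measurable]: "\<psi> \<in> borel_measurable M" unfolding \<psi>_def by measurable
  define B where "B = K + 2 * BW + \<bar>A\<bar>"
  have \<psi>b: "\<bar>\<psi> x\<bar> \<le> B" for x using \<Theta>b[of x] by (simp add: \<psi>_def B_def)
  have "AE x in M. (\<lambda>n. (\<Sum>i<n. \<psi> ((tent a ^^ i) x)) / real n) \<longlonglongrightarrow> 0"
  proof (rule averages_tendsto_0[OF _ \<psi>b])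
    fix k :: nat assume "1 \<le> k"
    then obtain l where k: "k = Suc l" by (cases k) auto
    have "(\<integral>x. \<psi> x * (\<lambda>x. \<psi> ((tent a ^^ l) x)) (tent a x) \<partial>M) = 0"
    proof (rule integral_tent_orthogonal[OF _ _ \<psi>b \<psi>b])
      show "AE x in M. \<psi> x + \<psi> (sym x) = 0" using sym by eventually_elim (simp add: \<psi>_def)
    qed measurable
    then show "(\<integral>x. \<psi> x * \<psi> ((tent a ^^ k) x) \<partial>M) = 0" by (simp add: k funpow_swap1)
  qed simp
  then show ?thesis
  proof eventually_elim
    case (elim x)
    have tele: "(\<Sum>i<n. \<psi> ((tent a ^^ i) x)) = K * (real (weight (code n x)) - real n * b) + W x - W ((tent a ^^ n) x)" for n
    proof (induction n)
      case 0
      show ?case by simp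
    next
      case (Suc n)
      have "real (weight (code (Suc n) x)) = real (weight (code n x)) + ?\<phi> ((tent a ^^ n) x)"
        by (simp add: weight_code)
      then show ?case using Suc by (simp add: \<psi>_def \<Theta>_def AK algebra_simps)
    qed
    have "(\<lambda>n. (W x - W ((tent a ^^ n) x)) / real n) \<longlonglongrightarrow> 0"
    proof (rule Lim_null_comparison)
      show "\<forall>\<^sub>F n in sequentially. norm ((W x - W ((tent a ^^ n) x)) / real n) \<le> 2 * BW / real n"
      proof (rule always_eventually, rule allI)
        fix n
        have "\<bar>W x - W ((tent a ^^ n) x)\<bar> \<le> 2 * BW"
          using W_bounded[of x] W_bounded[of "(tent a ^^ n) x"] unfolding BW_def by linarith
        then show "norm ((W x - W ((tent a ^^ n) x)) / real n) \<le> 2 * BW / real n"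
          by (simp add: divide_right_mono)
      qed
    qed (rule lim_const_over_n)
    then have "(\<lambda>n. ((\<Sum>i<n. \<psi> ((tent a ^^ i) x)) / real n - (W x - W ((tent a ^^ n) x)) / real n) / K + b) \<longlonglongrightarrow> (0 - 0) / K + b"
      by (intro tendsto_intros elim) (use K in auto)
    then have lim: "(\<lambda>n. ((\<Sum>i<n. \<psi> ((tent a ^^ i) x)) / real n - (W x - W ((tent a ^^ n) x)) / real n) / K + b) \<longlonglongrightarrow> b"
      by simp
    show ?case
    proof (rule Lim_transform_eventually[OF lim], rule eventually_sequentiallyI[of 1])
      fix n :: nat assume "1 \<le> n"
      then show "((\<Sum>i<n. \<psi> ((tent a ^^ i) x)) / real n - (W x - W ((tent a ^^ n) x)) / real n) / K + b =
        real (weight (code n x)) / real n"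
        unfolding tele using K by (simp add: field_simps)
    qed
  qed
qed

end

section \<open>Hausdorff dimension\<close>

context markov_tent
begin

abbreviation "fdim \<equiv> b * ln 2 / ln a"

lemma ln_a_pos: "0 < ln a"
  using a_bounds by simp

text \<open>For \<open>\<beta>\<close> slightly larger than \<open>b\<close>, cover by the cylinders of all large levels \<open>n\<close> which make at most \<open>\<beta> * n\<close>
  visits to the core: as each has measure of order at least \<open>2 powr (- \<beta> * n)\<close>, they are few.\<close>

lemma hausdorff_measure_typical:
  assumes A: "\<And>x. x \<in> A \<Longrightarrow> x \<in> space M \<and> (\<lambda>n. real (weight (code n x)) / real n) \<longlonglongrightarrow> b"
    and t: "fdim < t"
  shows "hausdorff_measure t A = 0"
proof -
  obtain \<kappa> where \<kappa>: "\<kappa> > 0" "\<And>n w. measure M (cyl n w) = 0 \<and> (\<exists>x. cyl n w \<subseteq> {x}) \<or> \<kappa> / 2 ^ weight w \<le> measure M (cyl n w)"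
    using cyl_dichotomy by blast
  have dim_pos: "0 < fdim" using core_mass_pos ln_a_pos by simp
  then have t0: "0 < t" using t by simp
  \<comment> \<open>Halfway between b and t ln a / ln 2: above the frequency of typical points, and
    small enough for \<rho> < 1.\<close>
  define \<beta> where "\<beta> = (b + t * ln a / ln 2) / 2"
  have bt: "b < t * ln a / ln 2" using t ln_a_pos by (simp add: field_simps)
  have \<beta>: "b < \<beta>" "\<beta> < t * ln a / ln 2"
    using less_half_sum[OF bt] gt_half_sum[OF bt] by (simp_all add: \<beta>_def)
  define \<rho> where "\<rho> = 2 powr \<beta> / a powr t"
  have \<rho>: "0 < \<rho>" "\<rho> < 1"
  proof -
    show "0 < \<rho>" using a_bounds by (simp add: \<rho>_def)
    have "\<beta> * ln 2 < t * ln a" using \<beta>(2) by (simp add: field_simps)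
    then have "2 powr \<beta> < a powr t" using a_bounds by (simp add: powr_def)
    then show "\<rho> < 1" using a_bounds by (simp add: \<rho>_def)
  qed
  define C where "C = 2 powr t / \<kappa>"
  have C: "0 < C" using \<kappa> by (simp add: C_def)
  define Wd where "Wd n = {w. (set w \<subseteq> {0, 1, 2} \<and> length w = n) \<and> real (weight w) \<le> \<beta> * real n \<and> cyl n w \<noteq> {}}" for n
  have fin: "finite (Wd n)" for n unfolding Wd_def by (rule finite_subset[OF _ finite_words[of n]]) auto
  have diam: "diameter (cyl n w) \<le> 2 / a ^ n" for n w
  proof (cases "cyl n w = {}")
    case False
    then show ?thesis using cyl_diam by (intro diameter_le) (auto simp: dist_real_def)
  qed (use a_bounds in simp)
  have bnd: "bounded (cyl n w)" for n w
    by (rule bounded_subset[of "{1 - a..1}"]) (auto simp: cyl_def space_M)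
  have level: "(\<Sum>w\<in>Wd n. diameter (cyl n w) powr t) \<le> C * \<rho> ^ n" for n
  proof -
    define G where "G = {w \<in> Wd n. measure M (cyl n w) \<noteq> 0}"
    have finG: "finite G" using fin[of n] by (simp add: G_def)
    \<comment> \<open>Null cylinders cannot be counted through their masses, but they are single
      points and contribute \<open>0 powr t = 0\<close>.\<close>
    have "(\<Sum>w\<in>Wd n. diameter (cyl n w) powr t) = (\<Sum>w\<in>G. diameter (cyl n w) powr t)"
    proof (rule sum.mono_neutral_right[OF fin], force simp: G_def, rule ballI)
      fix w assume "w \<in> Wd n - G"
      then have "cyl n w \<noteq> {}" "measure M (cyl n w) = 0" by (auto simp: G_def Wd_def)
      moreover have "\<not> \<kappa> / 2 ^ weight w \<le> 0" using \<kappa>(1) by (simp add: not_le)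
      ultimately obtain x where "cyl n w \<subseteq> {x}" using \<kappa>(2)[of n w] by auto
      then have "cyl n w = {x}" using \<open>cyl n w \<noteq> {}\<close> by blast
      then show "diameter (cyl n w) powr t = 0" by simp
    qed
    also have "\<dots> \<le> (\<Sum>w\<in>G. (2 / a ^ n) powr t)"
      by (intro sum_mono powr_mono2 diam diameter_ge_0 bnd) (use t0 in auto)
    also have "\<dots> = real (card G) * (2 / a ^ n) powr t" by simp
    also have "real (card G) \<le> 2 powr (\<beta> * real n) / \<kappa>"
    proof -
      have "real (card G) * (\<kappa> / 2 powr (\<beta> * real n)) = (\<Sum>w\<in>G. \<kappa> / 2 powr (\<beta> * real n))" by simp
      also have "\<dots> \<le> (\<Sum>w\<in>G. measure M (cyl n w))"
      proof (rule sum_mono)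
        fix w assume w: "w \<in> G"
        have "(2::real) ^ weight w = 2 powr real (weight w)" by (simp add: powr_realpow)
        also have "\<dots> \<le> 2 powr (\<beta> * real n)" using w by (intro powr_mono) (auto simp: G_def Wd_def)
        finally have "\<kappa> / 2 powr (\<beta> * real n) \<le> \<kappa> / 2 ^ weight w"
          using \<kappa>(1) by (intro divide_left_mono) auto
        then show "\<kappa> / 2 powr (\<beta> * real n) \<le> measure M (cyl n w)"
          using \<kappa>(2)[of n w] w by (auto simp: G_def)
      qed
      also have "\<dots> = measure M (\<Union>w\<in>G. cyl n w)"
      proof (rule finite_measure_finite_Union[symmetric, OF finG])
        show "cyl n ` G \<subseteq> sets M" using cyl_sets by blast
        show "disjoint_family_on (cyl n) G" by (auto simp: disjoint_family_on_def cyl_def)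
      qed
      also have "\<dots> \<le> 1" by (rule prob_le_1)
      finally show ?thesis using \<kappa>(1) by (simp add: field_simps)
    qed
    then have "real (card G) * (2 / a ^ n) powr t \<le> 2 powr (\<beta> * real n) / \<kappa> * (2 / a ^ n) powr t"
      by (intro mult_right_mono) auto
    also have "\<dots> = C * \<rho> ^ n"
    proof -
      have "(a ^ n) powr t = (a powr t) ^ n" using a_bounds by (simp add: powr_power flip: powr_realpow)  (simp add: powr_powr mult.commute)
      moreover have "2 powr (\<beta> * real n) = (2 powr \<beta>) ^ n" by (simp add: powr_powr flip: powr_realpow)
      ultimately show ?thesis using a_bounds by (simp add: C_def \<rho>_def powr_divide power_divide)
    qed
    finally show ?thesis .
  qed
  have "hausdorff_premeasure t \<delta> A \<le> ennreal \<eta>" if \<delta>: "0 < \<delta>" and \<eta>: "0 < \<eta>" for \<delta> \<eta>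
  proof -
    have "(\<lambda>n. C * \<rho> ^ n / (1 - \<rho>)) \<longlonglongrightarrow> C * 0 / (1 - \<rho>)"
      using \<rho> by (intro tendsto_intros LIMSEQ_realpow_zero) auto
    then have "\<forall>\<^sub>F n in sequentially. C * \<rho> ^ n / (1 - \<rho>) < \<eta>" using \<eta> by (intro order_tendstoD) auto
    moreover have "(\<lambda>n. 2 * (1 / a) ^ n) \<longlonglongrightarrow> 2 * 0"
      using a_bounds by (intro tendsto_intros LIMSEQ_realpow_zero) auto
    then have "\<forall>\<^sub>F n in sequentially. 2 * (1 / a) ^ n < \<delta>" using \<delta> by (intro order_tendstoD) auto
    ultimately have "\<forall>\<^sub>F n in sequentially. C * \<rho> ^ n / (1 - \<rho>) < \<eta> \<and> 2 * (1 / a) ^ n < \<delta>"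
      by (rule eventually_conj)
    then obtain n0 where n0: "C * \<rho> ^ n0 / (1 - \<rho>) < \<eta>" "2 * (1 / a) ^ n0 < \<delta>"
      using eventually_happens trivial_limit_sequentially by blast
    have "\<forall>n. \<exists>xs. set xs = Wd n \<and> distinct xs" using finite_distinct_list[OF fin] by blast
    then obtain L where L: "\<And>n. set (L n) = Wd n" "\<And>n. distinct (L n)" by metis
    \<comment> \<open>Row k lists the cylinders of level n0 + k, padded by empty sets of diameter
      0.\<close>
    define f where "f = (\<lambda>(k, j). if j < length (L (n0 + k)) then cyl (n0 + k) (L (n0 + k) ! j) else {})"
    define U where "U i = f (prod_decode i)" for i
    have "A \<subseteq> (\<Union>i. U i)"
    proof
      fix x assume "x \<in> A"
      then have x: "x \<in> space M" "(\<lambda>n. real (weight (code n x)) / real n) \<longlonglongrightarrow> b" using A by auto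
      have "\<forall>\<^sub>F n in sequentially. real (weight (code n x)) / real n < \<beta>"
        by (rule order_tendstoD(2)[OF x(2) \<beta>(1)])
      then obtain N where N: "\<And>n. N \<le> n \<Longrightarrow> real (weight (code n x)) / real n < \<beta>"
        unfolding eventually_sequentially by blast
      \<comment> \<open>The successor makes the level positive, so the quotient by it is not the
        default value 0.\<close>
      define k where "k = Suc N"
      have "real (weight (code (n0 + k) x)) / real (n0 + k) < \<beta>" by (rule N) (simp add: k_def)
      then have "real (weight (code (n0 + k) x)) \<le> \<beta> * real (n0 + k)" by (simp add: k_def field_simps)
      moreover have mem: "x \<in> cyl (n0 + k) (code (n0 + k) x)" using x by (simp add: cyl_def)
      ultimately have "code (n0 + k) x \<in> Wd (n0 + k)" using code_in[of "n0 + k" x] by (auto simp: Wd_def)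
      then obtain j where j: "j < length (L (n0 + k))" "L (n0 + k) ! j = code (n0 + k) x"
        unfolding L(1)[symmetric] in_set_conv_nth by blast
      then have "x \<in> U (prod_encode (k, j))" using mem by (simp add: U_def f_def)
      then show "x \<in> (\<Union>i. U i)" by blast
    qed
    moreover have "bounded (U i) \<and> diameter (U i) \<le> \<delta>" for i
    proof -
      obtain k j where kj: "prod_decode i = (k, j)" by fastforce
      have "2 / a ^ (n0 + k) \<le> 2 / a ^ n0" using a_bounds by (intro divide_left_mono power_increasing) auto
      also have "\<dots> < \<delta>" using n0(2) by (simp add: power_divide)
      finally have "diameter (cyl (n0 + k) w) \<le> \<delta>" for w using diam[of "n0 + k" w] by linarith
      then show ?thesis using bnd \<delta> by (auto simp: U_def f_def kj)
    qed
    ultimately have "hausdorff_premeasure t \<delta> A \<le> (\<Sum>i. ennreal (diameter (U i) powr t))"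
      unfolding hausdorff_premeasure_def by (intro INF_lower) auto
    also have "\<dots> = (\<Sum>i. (\<lambda>p. ennreal (diameter (f p) powr t)) (prod_decode i))" by (simp add: U_def)
    also have "\<dots> = (\<Sum>k. \<Sum>j. ennreal (diameter (f (k, j)) powr t))"
      by (rule suminf_ennreal_2dimen) simp
    also have "\<dots> \<le> (\<Sum>k. ennreal (C * \<rho> ^ n0 * \<rho> ^ k))"
    proof (rule suminf_le)
      fix k
      have "(\<Sum>j. ennreal (diameter (f (k, j)) powr t)) = (\<Sum>j<length (L (n0 + k)). ennreal (diameter (f (k, j)) powr t))"
        by (rule suminf_finite) (auto simp: f_def)
      also have "\<dots> = ennreal (\<Sum>j<length (L (n0 + k)). diameter (cyl (n0 + k) (L (n0 + k) ! j)) powr t)"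
        by (simp add: f_def sum_ennreal)
      also have "(\<Sum>j<length (L (n0 + k)). diameter (cyl (n0 + k) (L (n0 + k) ! j)) powr t) =
          (\<Sum>w\<in>Wd (n0 + k). diameter (cyl (n0 + k) w) powr t)"
        using L by (intro sum.reindex_bij_betw bij_betw_nth) auto
      also have "ennreal \<dots> \<le> ennreal (C * \<rho> ^ (n0 + k))" by (intro ennreal_leI level)
      finally show "(\<Sum>j. ennreal (diameter (f (k, j)) powr t)) \<le> ennreal (C * \<rho> ^ n0 * \<rho> ^ k)"
        by (simp only: power_add mult.assoc)
    qed auto
    also have "\<dots> = ennreal (\<Sum>k. C * \<rho> ^ n0 * \<rho> ^ k)"
      using C \<rho> by (intro suminf_ennreal_eq) (auto intro!: sums_mult summable_sums summable_mult summable_geometric)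
    also have "(\<Sum>k. C * \<rho> ^ n0 * \<rho> ^ k) = C * \<rho> ^ n0 / (1 - \<rho>)"
      using \<rho> by (subst suminf_mult) (auto simp: suminf_geometric summable_geometric)
    also have "ennreal \<dots> \<le> ennreal \<eta>" using n0(1) by (intro ennreal_leI) simp
    finally show ?thesis .
  qed
  note small = this
  have "hausdorff_premeasure t \<delta> A \<le> 0" if "0 < \<delta>" for \<delta>
  proof (rule ennreal_le_epsilon)
    fix \<eta> :: real assume "0 < \<eta>"
    then show "hausdorff_premeasure t \<delta> A \<le> 0 + ennreal \<eta>" using small[OF that] by simp
  qed
  then have "hausdorff_measure t A \<le> 0" unfolding hausdorff_measure_def by (intro SUP_least) simp
  then show ?thesis by simp
qed

lemma exists_level:
  assumes d: "0 < d" "d \<le> gap / a ^ k"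
  shows "\<exists>n\<ge>k. d \<le> gap / a ^ n \<and> gap / a ^ Suc n < d"
proof -
  obtain m where "gap / d < a ^ m" using real_arch_pow a_bounds by blast
  then have m: "gap / a ^ m < d" using d a_bounds by (simp add: field_simps)
  define N where "N = (LEAST m. gap / a ^ m < d)"
  have N: "gap / a ^ N < d" unfolding N_def by (rule LeastI[of _ m]) (rule m)
  have "k < N"
  proof (rule ccontr)
    assume "\<not> k < N"
    then have "gap / a ^ k \<le> gap / a ^ N"
      using a_bounds gap(1) by (intro divide_left_mono power_increasing) auto
    then show False using N d by simp
  qed
  then have "\<not> gap / a ^ (N - 1) < d" "N = Suc (N - 1)"
    using not_less_Least[of "N - 1" "\<lambda>m. gap / a ^ m < d"] by (auto simp: N_def)
  then show ?thesis using N \<open>k < N\<close> by (intro exI[of _ "N - 1"]) auto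
qed

text \<open>Each of these cylinders contains a point of the lattice of mesh \<open>gap / (2 * a ^ n)\<close>.\<close>

lemma card_cylinders_meeting:
  assumes d: "0 \<le> d" "d \<le> gap / a ^ n" and G: "finite G"
    "\<And>w. w \<in> G \<Longrightarrow> measure M (cyl n w) \<noteq> 0 \<and> cyl n w \<inter> {c..c + d} \<noteq> {}"
  shows "card G \<le> 7"
proof -
  have nd: "measure M (cyl n w) = 0 \<or>
      (\<exists>x y. {x<..<y} \<subseteq> cyl n w \<and> cyl n w \<subseteq> {x..y} \<and> gap / a ^ n \<le> y - x)" for w
    using cyl_dichotomy by (elim exE conjE allE[of _ n] allE[of _ w]) argo
  define g where "g = gap / a ^ n"
  have g: "0 < g" using gap(1) a_bounds by (simp add: g_def)
  define l where "l = 2 * (c - g) / g"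
  have "\<exists>h::int. g / 2 * of_int h \<in> cyl n w \<and> h \<in> {\<lfloor>l\<rfloor>..\<lfloor>l\<rfloor> + 6}" if w: "w \<in> G" for w
  proof -
    obtain x y where xy: "{x<..<y} \<subseteq> cyl n w" "cyl n w \<subseteq> {x..y}" "g \<le> y - x"
      using nd[of w] G(2)[OF w] by (auto simp: g_def)
    then have meet: "x \<le> c + d" "c \<le> y" using G(2)[OF w] by fastforce+
    \<comment> \<open>Truncating to a neighbourhood of [c, c + d] keeps length at least
      \<open>g\<close> and leaves seven possible lattice indices.\<close>
    define x' where "x' = max x (c - g)"
    define y' where "y' = min y (c + d + g)"
    have xy': "g \<le> y' - x'" using meet xy(3) g d by (auto simp: x'_def y'_def min_def max_def g_def[symmetric])
    define h where "h = \<lfloor>2 * x' / g\<rfloor> + 1"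
    have "2 * x' / g < of_int h" "of_int h \<le> 2 * x' / g + 1" unfolding h_def by linarith+
    then have h: "x' < g / 2 * of_int h" "g / 2 * of_int h \<le> x' + g / 2" using g by (simp_all add: field_simps)
    then have mid: "g / 2 * of_int h \<in> {x'<..<y'}" using xy' g by auto
    have "x \<le> x'" "y' \<le> y" by (auto simp: x'_def y'_def)
    then have "g / 2 * of_int h \<in> {x<..<y}" using mid by auto
    then have "g / 2 * of_int h \<in> cyl n w" by (rule subsetD[OF xy(1)])
    moreover have "c - g < g / 2 * of_int h" "g / 2 * of_int h < c + 2 * g"
      using mid d by (auto simp: x'_def y'_def g_def)
    then have "l < of_int h" "of_int h < l + 6" using g by (simp_all add: l_def field_simps)
    then have "h \<in> {\<lfloor>l\<rfloor>..\<lfloor>l\<rfloor> + 6}" by (auto simp: floor_le_iff) linarith+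
    ultimately show ?thesis by blast
  qed
  then obtain h :: "nat list \<Rightarrow> int" where h: "\<And>w. w \<in> G \<Longrightarrow> g / 2 * of_int (h w) \<in> cyl n w"
    "\<And>w. w \<in> G \<Longrightarrow> h w \<in> {\<lfloor>l\<rfloor>..\<lfloor>l\<rfloor> + 6}" by metis
  have "inj_on h G"
  proof (rule inj_onI)
    fix v w assume "v \<in> G" "w \<in> G" "h v = h w"
    then show "v = w" using h(1)[of v] h(1)[of w] by (auto simp: cyl_def)
  qed
  then have "card G \<le> card {\<lfloor>l\<rfloor>..\<lfloor>l\<rfloor> + 6}" by (rule card_inj_on_le) (use h(2) in auto)
  then show ?thesis by simp
qed

text \<open>A mass distribution argument on \<open>G k\<close>, the points with at least \<beta> n
  visits for all n >= k, which has positive measure for some k. At the level n where gap / a^n is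
  comparable to its diameter, a small set meets at most seven nonnull cylinders with that many
  visits, each of mass at most a^(-t n).\<close>

lemma hausdorff_measure_full:
  assumes A: "A \<in> sets M" "emeasure M (space M - A) = 0" and t: "0 < t" "t < fdim"
  shows "hausdorff_measure t A \<noteq> 0"
proof -
  define \<beta> where "\<beta> = t * ln a / ln 2"
  have \<beta>: "\<beta> < b" "0 < \<beta>" using t ln_a_pos by (auto simp: \<beta>_def field_simps)
  have \<beta>t: "2 powr \<beta> = a powr t" using a_bounds by (simp add: powr_def \<beta>_def)
  define G where "G k = {x \<in> A. \<forall>n\<ge>k. \<beta> * real n \<le> real (weight (code n x))}" for k
  have Gs: "G k \<in> sets M" for k
  proof -
    have "{x \<in> space M. code n x \<in> {w. \<beta> * real n \<le> real (weight w)}} \<in> sets M" for n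
      by (rule code_vimage_sets)
    then have "(\<Inter>n\<in>{k..}. {x \<in> space M. code n x \<in> {w. \<beta> * real n \<le> real (weight w)}}) \<in> sets M"
      by (intro sets.countable_INT) auto
    moreover have "G k = A \<inter> (\<Inter>n\<in>{k..}. {x \<in> space M. code n x \<in> {w. \<beta> * real n \<le> real (weight w)}})"
      using sets.sets_into_space[OF A(1)] by (auto simp: G_def)
    ultimately show ?thesis using A(1) by auto
  qed
  have "\<exists>k. 0 < measure M (G k)"
  proof (rule ccontr)
    assume "\<not> ?thesis"
    then have "measure M (G k) = 0" for k using measure_nonneg[of M "G k"] by (metis less_eq_real_def)
    then have "G k \<in> null_sets M" for k using Gs by (auto simp: null_sets_def emeasure_eq_measure)
    then have "(\<Union>k. G k) \<in> null_sets M" by blast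
    moreover have "space M - A \<in> null_sets M" using A by (auto simp: null_sets_def)
    ultimately have "AE x in M. x \<notin> (\<Union>k. G k) \<and> x \<notin> space M - A"
      by (intro AE_conjI AE_not_in)
    then have "AE x in M. False"
      using AE_weight AE_space
    proof eventually_elim
      case (elim x)
      have "\<forall>\<^sub>F n in sequentially. \<beta> < real (weight (code n x)) / real n"
        by (rule order_tendstoD(1)[OF elim(2) \<beta>(1)])
      then obtain N where N: "\<And>n. N \<le> n \<Longrightarrow> \<beta> < real (weight (code n x)) / real n"
        unfolding eventually_sequentially by blast
      have "\<beta> * real n \<le> real (weight (code n x))" if "Suc N \<le> n" for n
        using N[of n] that by (simp add: field_simps)
      then have "x \<in> G (Suc N)" using elim by (auto simp: G_def)
      then show False using elim by blast
    qed
    then show False by simp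
  qed
  then obtain k where k: "0 < measure M (G k)" by blast
  \<comment> \<open>Seven cylinders, and the factor a / gap from
    \<open>gap / a ^ Suc n < d\<close>.\<close>
  define C where "C = 7 * (a / gap) powr t"
  have C: "0 < C" using gap(1) a_bounds by (simp add: C_def)
  define \<delta> where "\<delta> = gap / a ^ k"
  have \<delta>: "0 < \<delta>" using gap(1) a_bounds by (simp add: \<delta>_def)
  have local: "\<exists>E\<in>sets M. G k \<inter> U \<subseteq> E \<and> measure M E \<le> C * diameter U powr t"
    if U: "bounded U" "diameter U \<le> \<delta>" for U
  proof (cases "G k \<inter> U = {}")
    case True
    then show ?thesis using C by (intro bexI[of _ "{}"]) auto
  next
    case False
    then obtain u where u: "u \<in> U" "u \<in> G k" by blast
    define d where "d = diameter U"
    have d0: "0 \<le> d" using U by (simp add: d_def diameter_ge_0)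
    have dU: "\<bar>x - y\<bar> \<le> d" if "x \<in> U" "y \<in> U" for x y
      using diameter_bounded_bound[OF U(1) that] by (simp add: d_def dist_real_def)
    show ?thesis
    proof (cases "d = 0")
      case True
      \<comment> \<open>For diameter 0 the claimed bound is \<open>0 powr t = 0\<close>, and points
        have measure 0.\<close>
      then have "U \<subseteq> {u}" using dU[OF _ u(1)] by auto
      moreover have "{u} \<in> sets M" using u sets.sets_into_space[OF Gs[of k]] by (auto simp: sets_M space_M)
      ultimately show ?thesis using C by (intro bexI[of _ "{u}"]) (auto simp: measure_singleton)
    next
      case False
      then have "0 < d" using d0 by simp
      then obtain n where n: "k \<le> n" "d \<le> gap / a ^ n" "gap / a ^ Suc n < d"
        using exists_level[of d k] U(2) by (auto simp: d_def \<delta>_def)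
      have "bdd_below U" using bounded_imp_bdd_below[OF U(1)] .
      define c where "c = Inf U"
      have Uc: "U \<subseteq> {c..c + d}"
      proof
        fix x assume x: "x \<in> U"
        have "c \<le> x" unfolding c_def by (rule cInf_lower[OF x \<open>bdd_below U\<close>])
        moreover have "x - d \<le> c" unfolding c_def
          using u(1) dU[OF x] by (intro cInf_greatest) force+
        ultimately show "x \<in> {c..c + d}" by auto
      qed
      define H where "H = {w. (set w \<subseteq> {0, 1, 2} \<and> length w = n) \<and> \<beta> * real n \<le> real (weight w) \<and> cyl n w \<inter> U \<noteq> {}}"
      have finH: "finite H" unfolding H_def by (rule finite_subset[OF _ finite_words[of n]]) auto
      define H' where "H' = {w \<in> H. measure M (cyl n w) \<noteq> 0}"
      have "card H' \<le> 7"
      proof (rule card_cylinders_meeting[OF d0 n(2)])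
        show "finite H'" using finH by (simp add: H'_def)
        fix w assume "w \<in> H'"
        then have "measure M (cyl n w) \<noteq> 0" "cyl n w \<inter> U \<noteq> {}" by (simp_all add: H'_def H_def)
        then show "measure M (cyl n w) \<noteq> 0 \<and> cyl n w \<inter> {c..c + d} \<noteq> {}" using Uc by blast
      qed
      have sub: "G k \<inter> U \<subseteq> (\<Union>w\<in>H. cyl n w)"
      proof
        fix x assume x: "x \<in> G k \<inter> U"
        then have "x \<in> cyl n (code n x)" using sets.sets_into_space[OF Gs[of k]] by (auto simp: cyl_def)
        moreover have "code n x \<in> H"
          using x n(1) code_in[of n x] calculation unfolding H_def by (auto simp: G_def)
        ultimately show "x \<in> (\<Union>w\<in>H. cyl n w)" by blast
      qed
      have "measure M (\<Union>w\<in>H. cyl n w) \<le> (\<Sum>w\<in>H. measure M (cyl n w))"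
        using finH cyl_sets by (intro finite_measure_subadditive_finite) auto
      also have "\<dots> = (\<Sum>w\<in>H'. measure M (cyl n w))"
        using finH by (intro sum.mono_neutral_right) (auto simp: H'_def)
      also have "\<dots> \<le> (\<Sum>w\<in>H'. 1 / (a powr t) ^ n)"
      proof (rule sum_mono)
        fix w assume w: "w \<in> H'"
        have "(a powr t) ^ n = 2 powr (\<beta> * real n)"
          unfolding \<beta>t[symmetric] by (simp add: powr_powr flip: powr_realpow)
        also have "\<dots> \<le> 2 powr real (weight w)" using w by (intro powr_mono) (auto simp: H'_def H_def)
        also have "\<dots> = 2 ^ weight w" by (simp add: powr_realpow)
        finally have "1 / 2 ^ weight w \<le> 1 / (a powr t) ^ n"
          using a_bounds by (intro divide_left_mono) auto
        then show "measure M (cyl n w) \<le> 1 / (a powr t) ^ n" using measure_cyl_le[of n w] by simp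
      qed
      also have "\<dots> \<le> 7 * (1 / (a powr t) ^ n)"
        using \<open>card H' \<le> 7\<close> by (simp add: divide_right_mono)
      also have "1 / (a powr t) ^ n = (1 / a ^ n) powr t"
        using a_bounds by (simp add: powr_divide powr_power flip: powr_realpow) (simp add: powr_powr mult.commute)
      also have "\<dots> \<le> (a / gap * d) powr t"
        using n(3) gap(1) a_bounds t by (intro powr_mono2) (auto simp: field_simps)
      also have "\<dots> = (a / gap) powr t * d powr t"
        by (rule powr_mult)
      finally have "measure M (\<Union>w\<in>H. cyl n w) \<le> C * diameter U powr t" by (simp add: C_def d_def)
      moreover have "(\<Union>w\<in>H. cyl n w) \<in> sets M" using finH cyl_sets by auto
      ultimately show ?thesis using sub by blast
    qed
  qed
  have "ennreal (measure M (G k) / C) \<le> hausdorff_premeasure t \<delta> A"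
    unfolding hausdorff_premeasure_def
  proof (rule INF_greatest)
    fix U :: "nat \<Rightarrow> real set"
    assume "U \<in> {U. A \<subseteq> (\<Union>i. U i) \<and> (\<forall>i. bounded (U i) \<and> diameter (U i) \<le> \<delta>)}"
    then have U: "A \<subseteq> (\<Union>i. U i)" "\<And>i. bounded (U i)" "\<And>i. diameter (U i) \<le> \<delta>" by auto
    have "\<forall>i. \<exists>E\<in>sets M. G k \<inter> U i \<subseteq> E \<and> measure M E \<le> C * diameter (U i) powr t"
      using local U by blast
    then obtain E where E: "\<And>i. E i \<in> sets M" "\<And>i. G k \<inter> U i \<subseteq> E i"
      "\<And>i. measure M (E i) \<le> C * diameter (U i) powr t" by metis
    have "G k \<subseteq> (\<Union>i. E i)"
    proof
      fix x assume x: "x \<in> G k"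
      then have "x \<in> A" by (simp add: G_def)
      then obtain i where "x \<in> U i" using U(1) by blast
      then show "x \<in> (\<Union>i. E i)" using x E(2)[of i] by blast
    qed
    moreover have UE: "range E \<subseteq> sets M" using E(1) by blast
    ultimately have "emeasure M (G k) \<le> emeasure M (\<Union>i. E i)"
      by (intro emeasure_mono sets.countable_UN)
    also have "\<dots> \<le> (\<Sum>i. emeasure M (E i))" by (rule emeasure_subadditive_countably[OF UE])
    also have "\<dots> \<le> (\<Sum>i. ennreal C * ennreal (diameter (U i) powr t))"
    proof (rule suminf_le)
      fix i
      have "emeasure M (E i) \<le> ennreal (C * diameter (U i) powr t)"
        unfolding emeasure_eq_measure by (rule ennreal_leI[OF E(3)])
      then show "emeasure M (E i) \<le> ennreal C * ennreal (diameter (U i) powr t)"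
        using C by (simp add: ennreal_mult)
    qed auto
    also have "\<dots> = ennreal C * (\<Sum>i. ennreal (diameter (U i) powr t))" by simp
    finally have "ennreal (measure M (G k)) \<le> ennreal C * (\<Sum>i. ennreal (diameter (U i) powr t))"
      by (simp add: emeasure_eq_measure)
    then have "ennreal (1 / C) * ennreal (measure M (G k)) \<le> ennreal (1 / C) * (ennreal C * (\<Sum>i. ennreal (diameter (U i) powr t)))"
      by (intro mult_left_mono) auto
    also have "\<dots> = (\<Sum>i. ennreal (diameter (U i) powr t))"
      using C by (simp add: mult.assoc[symmetric] flip: ennreal_mult)
    also have "ennreal (1 / C) * ennreal (measure M (G k)) = ennreal (measure M (G k) / C)"
      using C by (simp flip: ennreal_mult)
    finally show "ennreal (measure M (G k) / C) \<le> (\<Sum>i. ennreal (diameter (U i) powr t))" .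
  qed
  also have "\<dots> \<le> hausdorff_measure t A"
    unfolding hausdorff_measure_def using \<delta> by (intro SUP_upper) auto
  finally have "ennreal (measure M (G k) / C) \<le> hausdorff_measure t A" .
  moreover have "0 < measure M (G k) / C" using k C by (rule divide_pos_pos)
  ultimately show ?thesis by (metis ennreal_eq_0_iff le_zero_eq not_le)
qed

theorem hausdorff_dim_measure_eq: "hausdorff_dim_measure M = ereal fdim"
  unfolding hausdorff_dim_measure_def
proof (rule antisym)
  obtain N where N: "{x \<in> space M. \<not> (\<lambda>n. real (weight (code n x)) / real n) \<longlonglongrightarrow> b} \<subseteq> N"
    "emeasure M N = 0" "N \<in> sets M"
    by (rule AE_E[OF AE_weight])
  define A where "A = space M - N"
  have A: "A \<in> sets M" "space M - A = N" using N sets.sets_into_space[OF N(3)] by (auto simp: A_def)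
  have "hausdorff_dim A \<le> ereal fdim"
    unfolding hausdorff_dim_def
  proof (rule ereal_le_epsilon2)
    fix e :: real assume e: "0 < e"
    have "hausdorff_measure (fdim + e) A = 0"
      by (rule hausdorff_measure_typical) (use N e in \<open>auto simp: A_def\<close>)
    moreover have "0 < fdim" using core_mass_pos ln_a_pos by simp
    ultimately have "(INF s\<in>{s. 0 < s \<and> hausdorff_measure s A = 0}. ereal s) \<le> ereal (fdim + e)"
      using e by (intro INF_lower) auto
    then show "(INF s\<in>{s. 0 < s \<and> hausdorff_measure s A = 0}. ereal s) \<le> ereal fdim + ereal e" by simp
  qed
  then show "(INF A\<in>{A \<in> sets M. emeasure M (space M - A) = 0}. hausdorff_dim A) \<le> ereal fdim"
    using A N by (intro INF_lower2[of A]) auto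
  show "ereal fdim \<le> (INF A\<in>{A \<in> sets M. emeasure M (space M - A) = 0}. hausdorff_dim A)"
    unfolding hausdorff_dim_def
  proof (intro INF_greatest)
    fix A s assume "A \<in> {A \<in> sets M. emeasure M (space M - A) = 0}" "s \<in> {s. 0 < s \<and> hausdorff_measure s A = 0}"
    then have "\<not> s < fdim" using hausdorff_measure_full[of A s] by auto
    then show "ereal fdim \<le> ereal s" by simp
  qed
qed

end

section \<open>Comparison of nearby parameters\<close>

lemma periodic_ratio_tendsto_0:
  fixes r :: "nat \<Rightarrow> real"
  assumes q: "1 \<le> q" and r: "\<And>n. 0 \<le> r n" "\<And>n. m \<le> n \<Longrightarrow> r (n + q) = c * r n"
    and c: "0 \<le> c" "c < 1"
  shows "r \<longlonglongrightarrow> 0"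
proof -
  define C where "C = (\<Sum>i<q. r (m + i))"
  have iter: "r (m + i + k * q) = c ^ k * r (m + i)" for i k
  proof (induction k)
    case (Suc k)
    have "r (m + i + k * q + q) = c * r (m + i + k * q)" by (rule r(2)) simp
    then show ?case using Suc by (simp add: algebra_simps)
  qed simp
  have le: "r (m + j) \<le> c ^ (j div q) * C" for j
  proof -
    have "r (m + j) = c ^ (j div q) * r (m + j mod q)"
      using iter[of "j mod q" "j div q"] by (simp add: add.assoc)
    also have "r (m + j mod q) \<le> C" unfolding C_def
      using q by (intro member_le_sum[of "j mod q" "{..<q}" "\<lambda>i. r (m + i)"]) (auto simp: r)
    finally show ?thesis using c by (simp add: mult_left_mono)
  qed
  have "filterlim (\<lambda>j. j div q) at_top sequentially"
    unfolding filterlim_at_top eventually_sequentially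
  proof
    fix Z
    show "\<exists>N. \<forall>n\<ge>N. Z \<le> n div q" using q by (intro exI[of _ "Z * q"]) (auto simp: less_eq_div_iff_mult_less_eq)
  qed
  then have "(\<lambda>j. c ^ (j div q) * C) \<longlonglongrightarrow> 0 * C"
    using c by (intro tendsto_intros filterlim_compose[OF LIMSEQ_realpow_zero]) auto
  then have "(\<lambda>j. r (m + j)) \<longlonglongrightarrow> 0"
    by (intro tendsto_sandwich[of "\<lambda>_. 0" "\<lambda>j. r (m + j)" _ "\<lambda>j. c ^ (j div q) * C"])
      (auto simp: r le intro!: always_eventually)
  then have "(\<lambda>j. r (j + m)) \<longlonglongrightarrow> 0" by (simp add: add.commute)
  then show ?thesis by (rule LIMSEQ_offset)
qed

lemma finite_range_crit:
  assumes "1 \<le> q" "\<And>n. m \<le> n \<Longrightarrow> crit a (n + q) = crit a n"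
  shows "finite (range (crit a))"
proof -
  have "crit a n \<in> crit a ` {..<m + q}" for n
  proof (induction n rule: less_induct)
    case (less n)
    show ?case
    proof (cases "n < m + q")
      case False
      then have "crit a n = crit a (n - q)" using assms(2)[of "n - q"] by simp
      then show ?thesis using less[of "n - q"] False assms(1) by simp
    qed simp
  qed
  then have "range (crit a) \<subseteq> crit a ` {..<m + q}" by blast
  then show ?thesis by (rule finite_subset) simp
qed

lemma crit_periodic:
  assumes "(tent a ^^ q) (crit a m) = crit a m" "m \<le> n"
  shows "crit a (n + q) = crit a n"
proof -
  obtain k where k: "n = k + m" using assms(2) le_Suc_ex by (metis add.commute)
  have "crit a (n + q) = (tent a ^^ k) (crit a (q + m))"
    unfolding k using crit_add[of a k "q + m"] by (simp add: ac_simps)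
  also have "\<dots> = crit a n" using assms(1) by (simp add: crit_add[symmetric] k)
  finally show ?thesis .
qed

definition dim_param :: "(real \<Rightarrow> real measure) \<Rightarrow> real \<Rightarrow> real" where
  "dim_param \<mu> a = core_mass a (\<mu> a) * ln 2 / ln a"

text \<open>One setting for both kinds of parameters: a positive point followed by q - 1 negative
  ones, where q = 1 is the fixed point. The strict inequality \<open>a0 < r\<close> leaves room on
  the right, where all comparisons take place.\<close>

locale preperiodic_param =
  fixes \<mu> :: "real \<Rightarrow> real measure" and l r \<eta> a0 :: real and m0 m q :: nat
  assumes T: "transversal l r m0 \<eta>" and l: "sqrt 2 < l" and r: "r < 2"
    and a0: "l \<le> a0" "a0 < r"
    and fair: "\<And>a. a \<in> {l..r} \<Longrightarrow> fair_tent a (\<mu> a)"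
    and q: "1 \<le> q"
    and cyc: "(tent a0 ^^ q) (crit a0 m) = crit a0 m"
      "0 < crit a0 m" "crit a0 m \<noteq> a0 - 1"
      "\<And>i. 1 \<le> i \<Longrightarrow> i < q \<Longrightarrow> (tent a0 ^^ i) (crit a0 m) < 0"
begin

lemma a0_bounds: "1.41 < a0" "1 < a0" "a0 < 2" "a0 \<in> {l..r}" "sqrt 2 < a0"
  using a0 l r sqrt2_bounds by auto

lemma fair0: "fair_tent a0 (\<mu> a0)"
  using fair a0_bounds by blast

lemmas per = crit_periodic[OF cyc(1)]

lemma finite0: "finite (range (crit a0))"
  by (rule finite_range_crit[OF q per])

lemma cycle_value:
  assumes "m \<le> n"
  shows "crit a0 n = crit a0 m \<or> crit a0 n < 0"
  using assms
proof (induction n rule: less_induct)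
  case (less n)
  show ?case
  proof (cases "n < m + q")
    case True
    then obtain i where i: "n = i + m" "i < q" using less.prems by (metis add.commute add_less_cancel_left le_Suc_ex)
    show ?thesis
    proof (cases "i = 0")
      case False
      then have "crit a0 n < 0" using cyc(4)[of i] i by (simp add: crit_add[symmetric])
      then show ?thesis ..
    qed (simp add: i)
  next
    case False
    then have "crit a0 n = crit a0 (n - q)" using per[of "n - q"] by simp
    then show ?thesis using less.IH[of "n - q"] False q by simp
  qed
qed

lemma crit_eq_multiple:
  assumes "\<And>i. s \<le> i \<Longrightarrow> crit a0 (i + t) = crit a0 i" "s \<le> j"
  shows "crit a0 (j + k * t) = crit a0 j"
proof (induction k)
  case (Suc k)
  have "crit a0 (j + k * t + t) = crit a0 (j + k * t)" using assms by simp
  then show ?case using Suc by (simp add: algebra_simps)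
qed simp

text \<open>An orbit that returns to 0 is periodic, so 0 would lie on the final cycle. The point a0
  - 1 has the same image as \<open>crit a0 2\<close>, so after hitting it the orbit repeats from
  \<open>crit a0 3\<close> on and a0 - 1 would be a positive point of the cycle, hence
  \<open>crit a0 m\<close>. Both are excluded.\<close>

lemma crit_avoids:
  assumes j: "3 \<le> j"
  shows "crit a0 j \<noteq> 0" "crit a0 j \<noteq> a0 - 1"
proof -
  show "crit a0 j \<noteq> 0"
  proof
    assume z: "crit a0 j = 0"
    have "crit a0 (i + j) = crit a0 i" for i using z by (simp add: crit_add) (simp add: crit_def)
    then have "crit a0 (0 + m * j) = crit a0 0" by (intro crit_eq_multiple[of 0]) auto
    moreover have "m \<le> m * j" using j by simp
    ultimately show False using cycle_value[of "m * j"] cyc(2) by simp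
  qed
  show "crit a0 j \<noteq> a0 - 1"
  proof
    assume z: "crit a0 j = a0 - 1"
    have "crit a0 (Suc j) = crit a0 3"
      using z a0_bounds crit_Suc_tent[of a0 2] by (simp add: crit_Suc_tent crit_2 tent_def)
    then have p: "crit a0 (i + (j - 2)) = crit a0 i" if "3 \<le> i" for i
    proof -
      have "crit a0 (i + (j - 2)) = crit a0 (i - 3 + Suc j)" by (rule arg_cong) (use that j in arith)
      also have "\<dots> = crit a0 (i - 3 + 3)" by (simp only: crit_add \<open>crit a0 (Suc j) = crit a0 3\<close>)
      also have "\<dots> = crit a0 i" using that by simp
      finally show ?thesis .
    qed
    have "crit a0 (j + m * (j - 2)) = crit a0 j" by (rule crit_eq_multiple[of 3]) (use p j in auto)
    moreover have "m \<le> j + m * (j - 2)"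
    proof -
      have "m * 1 \<le> m * (j - 2)" using j by (intro mult_le_mono2) simp
      then show ?thesis by linarith
    qed
    ultimately show False using cycle_value[of "j + m * (j - 2)"] cyc(3) z a0_bounds by auto
  qed
qed

definition visits_per_cycle :: nat where
  "visits_per_cycle = (if crit a0 m < a0 - 1 then q else q - 1)"

lemma visits_period:
  assumes "max m 3 \<le> n"
  shows "visits a0 (n + q) = visits a0 n + visits_per_cycle"
proof -
  \<comment> \<open>\<open>visits\<close> counts from time 3, so a return \<open>n1\<close> to
    \<open>crit a0 m\<close> not earlier than 3 is used.\<close>
  obtain k where k: "m + k * q \<ge> 3" "k \<ge> 1" using q by (metis le_add2 mult.right_neutral mult_le_mono nat_mult_1_right le_trans numeral_3_eq_3 one_le_numeral)
  define n1 where "n1 = m + k * q"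
  have n1: "m \<le> n1" "3 \<le> n1" using k by (auto simp: n1_def)
  have cn1: "crit a0 n1 = crit a0 m" unfolding n1_def by (rule crit_eq_multiple[OF per]) auto
  have start: "visits a0 (n1 + j) = visits a0 n1 + (if crit a0 m < a0 - 1 then j else j - 1)" if "j \<le> q" for j
    using that
  proof (induction j)
    case (Suc j)
    have v: "visits a0 (n1 + Suc j) = visits a0 (n1 + j) + (if crit a0 (n1 + j) \<le> a0 - 1 then 1 else 0)"
      using visits_Suc[of "n1 + j" a0] n1 by simp
    show ?case
    proof (cases "j = 0")
      case True
      then show ?thesis using v cn1 cyc(3) by auto
    next
      case False
      have "crit a0 (n1 + j) = (tent a0 ^^ j) (crit a0 m)" using crit_add[of a0 j n1] cn1 by (simp add: add.commute)
      then have "crit a0 (n1 + j) < 0" using cyc(4)[of j] False Suc.prems by simp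
      then show ?thesis using v Suc False a0_bounds by auto
    qed
  qed simp
  \<comment> \<open>The increment over one period does not depend on where the period
    starts.\<close>
  have inv: "visits a0 (n + q) + visits a0 n' = visits a0 n + visits a0 (n' + q)" if "max m 3 \<le> n" "n \<le> n'" for n n'
    using that(2)
  proof (induction n' rule: dec_induct)
    case (step n')
    have "crit a0 (n' + q) = crit a0 n'" using per step that by simp
    then show ?case using step visits_Suc[of n' a0] visits_Suc[of "n' + q" a0] that by simp
  qed simp
  have "visits a0 (n1 + q) = visits a0 n1 + visits_per_cycle"
    using start[of q] by (simp add: visits_per_cycle_def)
  then show ?thesis
    using inv[of n n1] inv[of n1 n] assms n1 by (cases "n \<le> n1") auto
qed

text \<open>Parameters \<open>a\<close> close to \<open>a0\<close> have the same critical itinerary until the first time the critical orbits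
  separate at the scale \<open>\<rho>\<close>.\<close>

lemma separation_scale:
  "\<exists>\<rho>>0. \<forall>a x i. \<bar>a - a0\<bar> < \<rho> \<longrightarrow> 3 \<le> i \<longrightarrow> \<bar>x - crit a0 i\<bar> < \<rho> \<longrightarrow> symb a x = symb a0 (crit a0 i)"
proof -
  define S where "S = crit a0 ` {3..}"
  have S: "finite S" "S \<noteq> {}" using finite_subset[OF _ finite0, of S] by (auto simp: S_def)
  define d where "d = Min ((\<lambda>c. min \<bar>c\<bar> \<bar>c - (a0 - 1)\<bar>) ` S)"
  have d: "0 < d" unfolding d_def using S crit_avoids by (subst Min_gr_iff) (auto simp: S_def)
  have dle: "d \<le> \<bar>crit a0 i\<bar>" "d \<le> \<bar>crit a0 i - (a0 - 1)\<bar>" if "3 \<le> i" for i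
  proof -
    have "d \<le> min \<bar>crit a0 i\<bar> \<bar>crit a0 i - (a0 - 1)\<bar>"
      unfolding d_def using S that by (intro Min_le) (auto simp: S_def)
    then show "d \<le> \<bar>crit a0 i\<bar>" "d \<le> \<bar>crit a0 i - (a0 - 1)\<bar>" by auto
  qed
  show ?thesis
  proof (intro exI[of _ "d / 2"] conjI allI impI)
    fix a x i assume *: "\<bar>a - a0\<bar> < d / 2" "3 \<le> i" "\<bar>x - crit a0 i\<bar> < d / 2"
    show "symb a x = symb a0 (crit a0 i)"
      using dle[OF *(2)] * unfolding symb_def by (simp add: abs_if split: if_splits)
  qed (use d in simp)
qed

definition separates :: "real \<Rightarrow> real \<Rightarrow> nat \<Rightarrow> bool" where
  "separates \<rho> a n \<longleftrightarrow> 3 \<le> n \<and> \<rho> \<le> \<bar>crit a n - crit a0 n\<bar> \<and>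
     (\<forall>i. 3 \<le> i \<longrightarrow> i < n \<longrightarrow> symb a (crit a i) = symb a0 (crit a0 i))"

lemma sg_eqI: "symb a x = symb a' x' \<Longrightarrow> sg x = sg x'"
  using sg_eq_symb[of x a] sg_eq_symb[of x' a'] by simp

lemma growth:
  assumes a: "a0 < a" "a \<le> r" and n: "m0 \<le> n"
    and s: "\<And>i. 3 \<le> i \<Longrightarrow> i < n \<Longrightarrow> symb a (crit a i) = symb a0 (crit a0 i)"
  shows "\<eta> * a0 ^ (n - m0) * (a - a0) \<le> - orient a0 n * (crit a n - crit a0 n)"
proof -
  have "(1 / (a0 - 1) + \<eta> * a0 ^ (n - m0)) * (a - a0) \<le> - orient a0 n * (crit a n - crit a0 n)"
    by (rule transversal_growth[OF T l r _ _ _ n]) (use a a0 sg_eqI[OF s] in auto)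
  moreover have "\<eta> * a0 ^ (n - m0) * (a - a0) \<le> (1 / (a0 - 1) + \<eta> * a0 ^ (n - m0)) * (a - a0)"
    using a a0_bounds by (intro mult_right_mono) auto
  ultimately show ?thesis by linarith
qed

text \<open>While the orbits are closer than \<rho> their itineraries agree, and while itineraries
  agree the distance grows exponentially.\<close>

lemma exists_separation:
  assumes \<rho>: "0 < \<rho>" "\<And>a x i. \<bar>a - a0\<bar> < \<rho> \<Longrightarrow> 3 \<le> i \<Longrightarrow> \<bar>x - crit a0 i\<bar> < \<rho> \<Longrightarrow> symb a x = symb a0 (crit a0 i)"
    and a: "a0 < a" "a \<le> r" "a < a0 + \<rho>"
  shows "\<exists>n. separates \<rho> a n"
proof -
  have sy: "symb a (crit a i) = symb a0 (crit a0 i)" if "3 \<le> i" "\<bar>crit a i - crit a0 i\<bar> < \<rho>" for i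
    by (rule \<rho>(2)) (use a that in auto)
  have "\<exists>n\<ge>3. \<rho> \<le> \<bar>crit a n - crit a0 n\<bar>"
  proof (rule ccontr)
    assume "\<not> ?thesis"
    then have s: "symb a (crit a i) = symb a0 (crit a0 i)" if "3 \<le> i" for i
      using sy that by (metis not_le)
    have pos: "0 < \<eta> * (a - a0)" using transversalD(2)[OF T] a by simp
    obtain k where k: "2 / (\<eta> * (a - a0)) < a0 ^ k" using real_arch_pow a0_bounds by blast
    have "2 < \<eta> * a0 ^ k * (a - a0)" using k pos by (simp add: field_simps)
    also have "\<dots> \<le> - orient a0 (m0 + k) * (crit a (m0 + k) - crit a0 (m0 + k))"
      using growth[OF a(1,2), of "m0 + k"] s by simp
    also have "\<dots> \<le> \<bar>crit a (m0 + k) - crit a0 (m0 + k)\<bar>"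
      using orient_cases[of a0 "m0 + k"] by auto
    also have "\<dots> \<le> 2"
      using abs_crit_le_1[of a "m0 + k"] abs_crit_le_1[of a0 "m0 + k"] a r a0_bounds by linarith
    finally show False by simp
  qed
  then have ex: "\<exists>n. 3 \<le> n \<and> \<rho> \<le> \<bar>crit a n - crit a0 n\<bar>" by blast
  define n where "n = (LEAST n. 3 \<le> n \<and> \<rho> \<le> \<bar>crit a n - crit a0 n\<bar>)"
  have n: "3 \<le> n" "\<rho> \<le> \<bar>crit a n - crit a0 n\<bar>" using LeastI_ex[OF ex] by (auto simp: n_def)
  have "symb a (crit a i) = symb a0 (crit a0 i)" if "3 \<le> i" "i < n" for i
    using not_less_Least[of i "\<lambda>n. 3 \<le> n \<and> \<rho> \<le> \<bar>crit a n - crit a0 n\<bar>"] that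
    by (intro sy) (auto simp: n_def)
  then show ?thesis using n by (auto simp: separates_def)
qed

lemma separation_late:
  assumes "0 < \<rho>"
  shows "\<exists>\<epsilon>>0. \<forall>a n. \<bar>a - a0\<bar> < \<epsilon> \<longrightarrow> separates \<rho> a n \<longrightarrow> N < n"
proof -
  have "\<forall>\<^sub>F a in nhds a0. \<forall>i\<in>{..N}. \<bar>crit a i - crit a0 i\<bar> < \<rho>"
  proof (rule eventually_ball_finite, simp, rule ballI)
    fix i
    have "isCont (\<lambda>a. crit a i) a0" using continuous_on_crit[of UNIV i] by (simp add: continuous_on_eq_continuous_at)
    then have lim: "((\<lambda>a. crit a i) \<longlongrightarrow> crit a0 i) (nhds a0)"
      using tendsto_at_iff_tendsto_nhds[of "\<lambda>a. crit a i" a0] by (simp add: isCont_def)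
    show "\<forall>\<^sub>F a in nhds a0. \<bar>crit a i - crit a0 i\<bar> < \<rho>"
      using tendstoD[OF lim assms] by (simp add: dist_real_def)
  qed
  then obtain \<epsilon> where \<epsilon>: "\<epsilon> > 0" "\<And>a. dist a a0 < \<epsilon> \<Longrightarrow> \<forall>i\<in>{..N}. \<bar>crit a i - crit a0 i\<bar> < \<rho>"
    unfolding eventually_nhds_metric by blast
  show ?thesis
  proof (intro exI[of _ \<epsilon>] conjI allI impI)
    fix a n assume "\<bar>a - a0\<bar> < \<epsilon>" "separates \<rho> a n"
    then show "N < n" using \<epsilon>(2)[of a] by (auto simp: separates_def dist_real_def not_less[symmetric])
  qed (use \<epsilon> in simp)
qed

text \<open>Entropy and dimension were computed for Markov parameters only, so the nearby parameters
  of the comparison are chosen among those whose critical orbit ends at the fixed point.\<close>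

lemma markov_dense:
  assumes "0 < \<epsilon>"
  shows "\<exists>a. a0 < a \<and> a < a0 + \<epsilon> \<and> a \<le> r \<and> finite (range (crit a))"
proof -
  define h where "h = min \<epsilon> (r - a0) / 3"
  have h: "0 < h" "2 * h < \<epsilon>" "2 * h < r - a0" using assms a0 by (auto simp: h_def min_def)
  have "\<exists>n. \<exists>a\<in>{a0 + h..a0 + 2 * h}. crit a n = fixpt a"
    using h a0_bounds r fixpt_bounds
    by (intro hit_continuous continuous_on_fixpt) (auto intro: less_imp_le)
  then obtain n a where a: "a \<in> {a0 + h..a0 + 2 * h}" "crit a n = fixpt a" by blast
  have "(tent a ^^ 1) (crit a n) = crit a n" using a h a0_bounds by (simp add: tent_fixpt)
  then have "crit a (k + 1) = crit a k" if "n \<le> k" for k using that by (rule crit_periodic)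
  then have "finite (range (crit a))" by (rule finite_range_crit[OF order_refl])
  then show ?thesis using a h by (intro exI[of _ a]) auto
qed

section \<open>Comparison of the dimension with nearby larger parameters\<close>

definition ratio :: "nat \<Rightarrow> real" where
  "ratio n = 2 ^ visits a0 n / a0 ^ n"

lemma ratio_pos: "0 < ratio n"
  using a0_bounds by (simp add: ratio_def)

lemma ratio_period: "max m 3 \<le> n \<Longrightarrow> ratio (n + q) = 2 ^ visits_per_cycle / a0 ^ q * ratio n"
  by (simp add: ratio_def visits_period power_add mult_ac)

text \<open>At time n the masses at the two orbits differ by \<open>mass_coef\<close> times the
  difference of the core masses, and by at most 1.\<close>

lemma core_mass_diff_le:
  assumes "separates \<rho> a n" "a \<in> {l..r}"
  shows "\<bar>core_mass a (\<mu> a) - core_mass a0 (\<mu> a0)\<bar> \<le> 1 / 2 ^ visits a0 n"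
proof -
  have n: "n = (n - 3) + 3" using assms by (simp add: separates_def)
  have "cumul a0 (\<mu> a0) (crit a0 n) - cumul a (\<mu> a) (crit a n) =
    mass_coef a0 (n - 3) * (core_mass a0 (\<mu> a0) - core_mass a (\<mu> a))"
    using cumul_crit_diff[OF fair0 fair[OF assms(2)], where k = "n - 3"] assms(1) n by (auto simp: separates_def)
  moreover have "\<bar>cumul a0 (\<mu> a0) (crit a0 n) - cumul a (\<mu> a) (crit a n)\<bar> \<le> 1"
    using fair_tent.cumul_bounds[OF fair0, of "crit a0 n"] fair_tent.cumul_bounds[OF fair[OF assms(2)], of "crit a n"]
    by linarith
  ultimately have "\<bar>mass_coef a0 (n - 3)\<bar> * \<bar>core_mass a0 (\<mu> a0) - core_mass a (\<mu> a)\<bar> \<le> 1"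
    by (simp add: abs_mult)
  moreover have "2 ^ visits a0 n * \<bar>core_mass a0 (\<mu> a0) - core_mass a (\<mu> a)\<bar> \<le>
    \<bar>mass_coef a0 (n - 3)\<bar> * \<bar>core_mass a0 (\<mu> a0) - core_mass a (\<mu> a)\<bar>"
    using mass_coef_abs(1)[OF a0_bounds(5), of "n - 3"] n by (intro mult_right_mono) auto
  ultimately show ?thesis by (simp add: field_simps abs_minus_commute)
qed

text \<open>If the dimension did not drop, \<open>b\<close> would have to grow at least linearly in
  a - a0 to keep up with ln a. At the separation time n, however, the growth of \<open>b\<close> is
  at most 2^(-visits) while a - a0 is at least of order a0^(-n), and the quotient 1 /
  \<open>ratio n\<close> of these tends to 0.\<close>

lemma flat:
  assumes flat: "a0 ^ q < 2 ^ visits_per_cycle"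
  shows "\<exists>a. a0 < a \<and> a \<le> r \<and> finite (range (crit a)) \<and> dim_param \<mu> a < dim_param \<mu> a0"
proof (rule ccontr)
  assume "\<not> ?thesis"
  then have mono: "dim_param \<mu> a0 \<le> dim_param \<mu> a" if "a0 < a" "a \<le> r" "finite (range (crit a))" for a
    using that by (meson not_le)
  obtain \<rho> where \<rho>: "0 < \<rho>" "\<And>a x i. \<bar>a - a0\<bar> < \<rho> \<Longrightarrow> 3 \<le> i \<Longrightarrow> \<bar>x - crit a0 i\<bar> < \<rho> \<Longrightarrow> symb a x = symb a0 (crit a0 i)"
    using separation_scale by blast
  define b0 where "b0 = core_mass a0 (\<mu> a0)"
  have b0: "0 < b0" using fair_tent.core_mass_pos[OF fair0] by (simp add: b0_def)
  have ln0: "0 < ln a0" using a0_bounds by simp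
  \<comment> \<open>The slope b0 / (2 ln a0) comes from ln a - ln a0 >= (a - a0) / 2, the factor
    \<rho> (a0 - 1) from \<open>crit_diff_le\<close> at the separation time.\<close>
  define c where "c = b0 / (2 * ln a0) * (\<rho> * (a0 - 1))"
  have c: "0 < c" using b0 ln0 \<rho>(1) a0_bounds by (simp add: c_def)
  have lim: "(\<lambda>n. 1 / ratio n) \<longlonglongrightarrow> 0"
  proof (rule periodic_ratio_tendsto_0[OF q, of _ "max m 3" "a0 ^ q / 2 ^ visits_per_cycle"])
    show "1 / ratio (n + q) = a0 ^ q / 2 ^ visits_per_cycle * (1 / ratio n)" if "max m 3 \<le> n" for n
      using ratio_period[OF that] by simp
  qed (use ratio_pos flat a0_bounds in \<open>auto intro: less_imp_le\<close>)
  then obtain N where N: "\<And>n. N \<le> n \<Longrightarrow> 1 / ratio n < c"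
    using order_tendstoD(2)[OF lim c] unfolding eventually_sequentially by blast
  obtain \<epsilon> where \<epsilon>: "\<epsilon> > 0" "\<And>a n. \<bar>a - a0\<bar> < \<epsilon> \<Longrightarrow> separates \<rho> a n \<Longrightarrow> N < n"
    using separation_late[OF \<rho>(1)] by blast
  obtain a where a: "a0 < a" "a < a0 + min \<rho> \<epsilon>" "a \<le> r" "finite (range (crit a))"
    using markov_dense[of "min \<rho> \<epsilon>"] \<rho>(1) \<epsilon>(1) by auto
  have "a < a0 + \<rho>" using a(2) by simp
  then obtain n where n: "separates \<rho> a n" using exists_separation[OF \<rho> a(1,3)] by blast
  have "N < n" using \<epsilon>(2)[OF _ n] a by auto
  have alr: "a \<in> {l..r}" using a a0 by simp
  define b where "b = core_mass a (\<mu> a)"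
  have "b0 / ln a0 \<le> b / ln a"
    using mono[OF a(1,3,4)] by (simp add: dim_param_def b_def b0_def divide_le_cancel mult.commute[of _ "ln 2"] flip: times_divide_eq_right)
  moreover have lna: "0 < ln a" using a a0_bounds by simp
  ultimately have "b0 / ln a0 * ln a \<le> b" by (simp add: field_simps)
  then have "b0 / ln a0 * (ln a - ln a0) \<le> b - b0" using ln0 by (simp add: right_diff_distrib)
  moreover have "(a - a0) / 2 \<le> ln a - ln a0"
  proof -
    have "ln (a0 / a) \<le> a0 / a - 1" using a a0_bounds by (intro ln_le_minus_one) auto
    then have "1 - a0 / a \<le> ln a - ln a0" using a a0_bounds by (simp add: ln_div)
    moreover have "1 - a0 / a = (a - a0) / a" using a a0_bounds by (simp add: field_simps)
    moreover have "(a - a0) / 2 \<le> (a - a0) / a" using a a0_bounds r by (intro divide_left_mono) auto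
    ultimately show ?thesis by linarith
  qed
  then have "b0 / ln a0 * ((a - a0) / 2) \<le> b0 / ln a0 * (ln a - ln a0)"
    using b0 ln0 by (intro mult_left_mono) auto
  ultimately have "b0 / (2 * ln a0) * (a - a0) \<le> b - b0" by simp
  also have "\<dots> \<le> 1 / 2 ^ visits a0 n"
    using core_mass_diff_le[OF n alr] unfolding b_def b0_def by linarith
  finally have up: "b0 / (2 * ln a0) * (a - a0) \<le> 1 / 2 ^ visits a0 n" .
  have "\<rho> \<le> \<bar>crit a0 n - crit a n\<bar>" using n by (simp add: separates_def abs_minus_commute)
  also have "\<dots> \<le> a0 ^ n / (a0 - 1) * \<bar>a0 - a\<bar>" using a r a0_bounds by (intro crit_diff_le) auto
  finally have "\<rho> * (a0 - 1) / a0 ^ n \<le> a - a0" using a a0_bounds by (simp add: field_simps)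
  then have "b0 / (2 * ln a0) * (\<rho> * (a0 - 1) / a0 ^ n) \<le> b0 / (2 * ln a0) * (a - a0)"
    using b0 ln0 by (intro mult_left_mono) auto
  then have "c / a0 ^ n \<le> 1 / 2 ^ visits a0 n" using up by (simp add: c_def)
  then have "c \<le> 1 / ratio n" using a0_bounds by (simp add: ratio_def field_simps)
  then show False using N[of n] \<open>N < n\<close> by simp
qed

text \<open>The masses of the two orbits at time n belong to different measures, so their difference
  has no evident lower bound. Subtracting the same relation one period earlier removes the measure
  of \<open>a0\<close>, whose orbit is at the same point both times, and leaves two points of one
  orbit under the measure of \<open>a\<close>. These are far apart since the distance to the orbit
  of \<open>a0\<close> has grown meanwhile, and \<open>full_support\<close> applies. Thus b - b0 is
  positive and at least of order 2^(-visits), against a - a0 of order at most a0^(-n).\<close>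

lemma steep:
  assumes steep: "2 ^ visits_per_cycle < a0 ^ q" and \<nu>: "1 \<le> visits_per_cycle"
  shows "\<exists>a. a0 < a \<and> a \<le> r \<and> finite (range (crit a)) \<and> dim_param \<mu> a0 < dim_param \<mu> a"
proof (rule ccontr)
  assume "\<not> ?thesis"
  then have anti: "dim_param \<mu> a \<le> dim_param \<mu> a0" if "a0 < a" "a \<le> r" "finite (range (crit a))" for a
    using that by (meson not_le)
  obtain \<rho> where \<rho>: "0 < \<rho>" "\<And>a x i. \<bar>a - a0\<bar> < \<rho> \<Longrightarrow> 3 \<le> i \<Longrightarrow> \<bar>x - crit a0 i\<bar> < \<rho> \<Longrightarrow> symb a x = symb a0 (crit a0 i)"
    using separation_scale by blast
  obtain \<kappa> where \<kappa>: "0 < \<kappa>" "\<And>a M x y. fair_tent a M \<Longrightarrow> l \<le> a \<Longrightarrow> 1 - a \<le> x \<Longrightarrow> y \<le> 1 \<Longrightarrow> \<rho> / 5 \<le> y - x \<Longrightarrow>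
      \<kappa> \<le> cumul a M y - cumul a M x"
    using full_support[OF l, of "\<rho> / 5"] \<rho>(1) by auto
  note T' = transversalD[OF T]
  define b0 where "b0 = core_mass a0 (\<mu> a0)"
  have b0: "0 < b0" using fair_tent.core_mass_pos[OF fair0] by (simp add: b0_def)
  have ln0: "0 < ln a0" using a0_bounds by simp
  define C where "C = 3 * (b0 / ln a0) * (2 * a0 ^ m0 / \<eta>)"
  have C: "0 < C" using b0 ln0 T'(2) a0_bounds by (simp add: C_def)
  have lim: "ratio \<longlonglongrightarrow> 0"
    by (rule periodic_ratio_tendsto_0[OF q, of _ "max m 3" "2 ^ visits_per_cycle / a0 ^ q"])
      (use ratio_pos ratio_period steep a0_bounds in \<open>auto intro: less_imp_le\<close>)
  have "0 < \<kappa> / C" using \<kappa>(1) C by simp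
  then obtain N where N: "\<And>n. N \<le> n \<Longrightarrow> ratio n < \<kappa> / C"
    using order_tendstoD(2)[OF lim] unfolding eventually_sequentially by blast
  obtain \<epsilon> where \<epsilon>: "\<epsilon> > 0" "\<And>a n. \<bar>a - a0\<bar> < \<epsilon> \<Longrightarrow> separates \<rho> a n \<Longrightarrow> N + m + m0 + q + 3 < n"
    using separation_late[OF \<rho>(1), of "N + m + m0 + q + 3"] by blast
  define \<epsilon>' where "\<epsilon>' = min (min \<rho> \<epsilon>) (\<rho> * (a0 - 1) / 20)"
  have \<epsilon>': "0 < \<epsilon>'" using \<rho>(1) \<epsilon>(1) a0_bounds by (simp add: \<epsilon>'_def)
  obtain a where a: "a0 < a" "a < a0 + \<epsilon>'" "a \<le> r" "finite (range (crit a))"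
    using markov_dense[OF \<epsilon>'] by auto
  have a\<epsilon>: "a < a0 + \<rho>" "a - a0 < \<epsilon>" "a - a0 < \<rho> * (a0 - 1) / 20" using a(2) by (auto simp: \<epsilon>'_def)
  obtain n where n: "separates \<rho> a n" using exists_separation[OF \<rho> a(1,3) a\<epsilon>(1)] by blast
  have nN: "N + m + m0 + q + 3 < n" using \<epsilon>(2)[OF _ n] a a\<epsilon> by auto
  have alr: "a \<in> {l..r}" using a a0 by simp
  have sy: "symb a (crit a i) = symb a0 (crit a0 i)" if "3 \<le> i" "i < n" for i
    using n that by (auto simp: separates_def)
  define D where "D i = crit a i - crit a0 i" for i
  define n' where "n' = n - q"
  have n': "n = n' + q" "N + m + m0 + 3 < n'" using nN by (auto simp: n'_def)
  define \<tau> where "\<tau> = - orient a0 n"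
  have \<tau>: "\<tau> = 1 \<or> \<tau> = - 1" using orient_cases[of a0 n] by (auto simp: \<tau>_def)
  define e where "e = (a - a0) / (a0 - 1)"
  have e: "0 < e" "e < \<rho> / 20" using a(1) a\<epsilon>(3) a0_bounds by (auto simp: e_def field_simps)
  have Dn: "\<rho> \<le> \<bar>D n\<bar>" "\<bar>D n\<bar> \<le> 2"
  proof -
    show "\<rho> \<le> \<bar>D n\<bar>" using n by (simp add: separates_def D_def)
    show "\<bar>D n\<bar> \<le> 2" using abs_crit_le_1[of a n] abs_crit_le_1[of a0 n] a r a0_bounds unfolding D_def by linarith
  qed
  have gr: "\<eta> * a0 ^ (n - m0) * (a - a0) \<le> \<tau> * D n"
    unfolding D_def \<tau>_def using nN sy by (intro growth a) auto
  have oD: "\<tau> * D n = \<bar>D n\<bar>"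
  proof -
    have "0 < \<eta> * a0 ^ (n - m0) * (a - a0)" using T'(2) a a0_bounds by simp
    then have "0 < \<tau> * D n" using gr by linarith
    then show ?thesis using \<tau> by auto
  qed
  have close: "a - a0 \<le> 2 * a0 ^ m0 / \<eta> / a0 ^ n"
  proof -
    have "\<eta> * a0 ^ (n - m0) * (a - a0) \<le> 2" using gr oD Dn by linarith
    moreover have "a0 ^ (n - m0) = a0 ^ n / a0 ^ m0" using nN a0_bounds by (simp add: power_diff)
    ultimately show ?thesis using T'(2) a0_bounds by (simp add: field_simps)
  qed
  have "a0 ^ j * (\<bar>D n'\<bar> - e) \<le> \<bar>D (n' + j)\<bar> - e" if "j \<le> q" for j
    using that
  proof (induction j)
    case (Suc j)
    have "sg (crit a (n' + j)) = sg (crit a0 (n' + j))"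
      by (rule sg_eqI, rule sy) (use n' Suc.prems in auto)
    then have "crit a0 (n' + j) * crit a (n' + j) \<ge> 0"
      by (auto simp: sg_def zero_le_mult_iff split: if_splits)
    then have "a0 * \<bar>crit a0 (n' + j) - crit a (n' + j)\<bar> - \<bar>a0 - a\<bar> \<le> \<bar>crit a0 (Suc (n' + j)) - crit a (Suc (n' + j))\<bar>"
      using a r a0_bounds by (intro crit_diff_ge) auto
    then have "a0 * \<bar>D (n' + j)\<bar> - (a - a0) \<le> \<bar>D (n' + Suc j)\<bar>"
      using a by (simp add: D_def abs_minus_commute)
    moreover have "a - a0 = (a0 - 1) * e" using a0_bounds by (simp add: e_def)
    ultimately have "a0 * (\<bar>D (n' + j)\<bar> - e) \<le> \<bar>D (n' + Suc j)\<bar> - e" by (simp add: algebra_simps)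
    moreover have "a0 * (a0 ^ j * (\<bar>D n'\<bar> - e)) \<le> a0 * (\<bar>D (n' + j)\<bar> - e)"
      using Suc a0_bounds by (intro mult_left_mono) auto
    ultimately show ?case by simp
  qed simp
  from this[of q] have lag: "a0 ^ q * (\<bar>D n'\<bar> - e) \<le> \<bar>D n\<bar> - e" by (simp add: n'(1))
  have Dn': "\<bar>D n'\<bar> \<le> \<bar>D n\<bar> / 1.4 + e"
  proof (cases "\<bar>D n'\<bar> \<le> e")
    case False
    have "1.4 \<le> a0 ^ 1" using a0_bounds by simp
    also have "\<dots> \<le> a0 ^ q" using q a0_bounds by (intro power_increasing) auto
    finally have "1.4 * (\<bar>D n'\<bar> - e) \<le> a0 ^ q * (\<bar>D n'\<bar> - e)" using False by (intro mult_right_mono) auto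
    then show ?thesis using lag e by simp
  qed simp
  \<comment> \<open>Of |D n| >= \<rho> the fraction 1 - 1/1.4 = 2/7 remains, and subtracting e <
    \<rho> / 20 leaves more than \<rho> / 5.\<close>
  have far: "\<rho> / 5 \<le> \<tau> * (D n - D n')"
  proof -
    have "\<tau> * D n' \<le> \<bar>D n'\<bar>" using \<tau> by auto
    then have "\<bar>D n\<bar> - \<bar>D n'\<bar> \<le> \<tau> * (D n - D n')" using oD by (simp add: right_diff_distrib)
    then show ?thesis using Dn' Dn e by simp
  qed
  have c0: "crit a0 n = crit a0 n'" unfolding n'(1) using n' by (intro per) auto
  then have diff: "D n - D n' = crit a n - crit a n'" by (simp add: D_def)
  interpret A: fair_tent a "\<mu> a" by (rule fair[OF alr])
  have mem: "crit a i \<in> {1 - a..1}" for i using A.a_bounds by (intro crit_mem) auto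
  have \<kappa>le: "\<kappa> \<le> \<tau> * (A.F (crit a n) - A.F (crit a n'))"
    using \<tau>
  proof
    assume "\<tau> = 1"
    then show ?thesis using far unfolding diff
      using \<kappa>(2)[OF A.fair_tent_axioms, of "crit a n'" "crit a n"] mem[of n] mem[of n'] alr by auto
  next
    assume "\<tau> = - 1"
    then show ?thesis using far unfolding diff
      using \<kappa>(2)[OF A.fair_tent_axioms, of "crit a n" "crit a n'"] mem[of n] mem[of n'] alr by auto
  qed
  define b where "b = core_mass a (\<mu> a)"
  define P where "P = mass_coef a0 (n - 3)"
  define P' where "P' = mass_coef a0 (n' - 3)"
  have n3: "n - 3 + 3 = n" "n' - 3 + 3 = n'" "1 \<le> n - 3" using n' by auto
  have "cumul a0 (\<mu> a0) (crit a0 n) - A.F (crit a n) = P * (b0 - b)"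
    using cumul_crit_diff[OF fair0 A.fair_tent_axioms, where k = "n - 3"] sy unfolding n3 P_def b_def b0_def by simp
  moreover have "cumul a0 (\<mu> a0) (crit a0 n') - A.F (crit a n') = P' * (b0 - b)"
    using cumul_crit_diff[OF fair0 A.fair_tent_axioms, where k = "n' - 3"] sy n' unfolding n3 P'_def b_def b0_def by simp
  ultimately have FP: "A.F (crit a n) - A.F (crit a n') = (P - P') * (b - b0)"
    using c0 by (simp add: algebra_simps)
  have vis: "visits a0 n = visits a0 n' + visits_per_cycle"
    unfolding n'(1) using n' by (intro visits_period) auto
  \<comment> \<open>With at least one visit per period, the upper bound for P' stays strictly below
    the lower bound for the signed P, so P - P' has the sign \<tau>; this is also the sign of D
    n.\<close>
  have "\<bar>P'\<bar> \<le> 2 ^ visits a0 n - 1"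
  proof -
    have "\<bar>P'\<bar> = \<bar>- orient a0 n' * P'\<bar>" by (simp add: abs_mult)
    also have "\<dots> \<le> 2 * 2 ^ visits a0 n' - 1"
      using mass_coef_bounds(1,2)[OF a0_bounds(5), of "n' - 3"] zero_le_power[of "2::real" "visits a0 n'"]
      unfolding n3 P'_def by linarith
    also have "2 * 2 ^ visits a0 n' = (2::real) ^ (visits a0 n' + 1)" by simp
    also have "(2::real) ^ (visits a0 n' + 1) \<le> 2 ^ visits a0 n"
      unfolding vis using \<nu> by (intro power_increasing) auto
    finally show ?thesis by simp
  qed
  moreover have "2 ^ visits a0 n + 1 \<le> \<tau> * P" "\<tau> * P \<le> 2 * 2 ^ visits a0 n - 1"
    using mass_coef_bounds(2,3)[OF a0_bounds(5), of "n - 3"] n3 unfolding P_def \<tau>_def by simp_all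
  moreover have "\<bar>\<tau> * P'\<bar> = \<bar>P'\<bar>" using \<tau> by auto
  ultimately have oP: "0 < \<tau> * (P - P')" "\<tau> * (P - P') \<le> 3 * 2 ^ visits a0 n"
    unfolding right_diff_distrib by linarith+
  have "\<kappa> \<le> \<tau> * (P - P') * (b - b0)" using \<kappa>le unfolding FP by (simp add: mult.assoc)
  then have "0 < \<tau> * (P - P') * (b - b0)" using \<kappa>(1) by linarith
  then have bb: "0 < b - b0" using oP(1) by (simp add: zero_less_mult_iff)
  have "\<kappa> \<le> 3 * 2 ^ visits a0 n * (b - b0)"
    using mult_right_mono[OF oP(2), of "b - b0"] bb \<open>\<kappa> \<le> \<tau> * (P - P') * (b - b0)\<close> by linarith
  also have "b - b0 \<le> b0 / ln a0 * (a - a0)"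
  proof -
    have "b / ln a \<le> b0 / ln a0"
      using anti[OF a(1,3,4)] by (simp add: dim_param_def b_def b0_def divide_le_cancel mult.commute[of _ "ln 2"] flip: times_divide_eq_right)
    moreover have "0 < ln a" using a a0_bounds by simp
    ultimately have "b \<le> b0 / ln a0 * ln a" by (simp add: field_simps)
    then have "b - b0 \<le> b0 / ln a0 * (ln a - ln a0)" using ln0 by (simp add: right_diff_distrib)
    also have "\<dots> \<le> b0 / ln a0 * (a - a0)"
    proof (rule mult_left_mono)
      have "ln (a / a0) \<le> a / a0 - 1" using a a0_bounds by (intro ln_le_minus_one) auto
      then have "ln a - ln a0 \<le> (a - a0) / a0" using a a0_bounds by (simp add: ln_div diff_divide_distrib)
      also have "\<dots> \<le> (a - a0) / 1" using a a0_bounds by (intro divide_left_mono) auto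
      finally show "ln a - ln a0 \<le> a - a0" by simp
    qed (use b0 ln0 in simp)
    finally show ?thesis .
  qed
  also have "b0 / ln a0 * (a - a0) \<le> b0 / ln a0 * (2 * a0 ^ m0 / \<eta> / a0 ^ n)"
    using close b0 ln0 by (intro mult_left_mono) auto
  finally have "\<kappa> \<le> 3 * 2 ^ visits a0 n * (b0 / ln a0 * (2 * a0 ^ m0 / \<eta> / a0 ^ n))"
    by (simp add: mult_left_mono)
  also have "\<dots> = C * ratio n" by (simp add: C_def ratio_def mult_ac)
  finally have "\<kappa> / C \<le> ratio n" using C by (simp add: field_simps)
  then show False using N[of n] nN by simp
qed

end

section \<open>Both behaviours on every interval\<close>

lemma exists_preperiodic_param:
  assumes J: "sqrt 2 < l" "l < r" "r < 2" and fair: "\<And>a. a \<in> {l..r} \<Longrightarrow> fair_tent a (\<mu> a)"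
    and q: "1 \<le> q" "\<And>a. a \<in> {l..r} \<Longrightarrow> a ^ (q - 1) * (2 - a) < 1"
    and ne: "\<And>a. a \<in> {l..r} \<Longrightarrow> cycle_point q a \<noteq> a - 1"
  shows "\<exists>l' r' m0 \<eta> a0 m. l \<le> l' \<and> r' \<le> r \<and> preperiodic_param \<mu> l' r' \<eta> a0 m0 m q \<and> crit a0 m = cycle_point q a0"
proof -
  obtain l' r' m0 \<eta> where lr: "l \<le> l'" "l' < r'" "r' \<le> r" and T: "transversal l' r' m0 \<eta>"
    using exists_transversal[OF J] by blast
  \<comment> \<open>Searching in the left half [l', h] ensures a0 < r'.\<close>
  define h where "h = (l' + r') / 2"
  have h: "l' < h" "h < r'" using lr by (auto simp: h_def)
  have mem: "a \<in> {l..r}" "1 < a" if "a \<in> {l'..h}" for a using that lr h J sqrt2_bounds by auto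
  have "\<exists>m. \<exists>a\<in>{l'..h}. crit a m = cycle_point q a"
  proof (rule hit_continuous)
    show "sqrt 2 < l'" "l' < h" "h < 2" using J lr h by auto
    show "continuous_on {l'..h} (cycle_point q)" using mem by (intro continuous_on_cycle_point) auto
    fix a assume "a \<in> {l'..h}"
    then show "fixpt a \<le> cycle_point q a" "cycle_point q a \<le> 1"
      using cycle_point_ge_fixpt[of a q] cycle_point_less_1[of a q] mem[of a] q by auto
  qed
  then obtain m a0 where a0: "a0 \<in> {l'..h}" "crit a0 m = cycle_point q a0" by blast
  note m0 = mem[OF a0(1)]
  have "preperiodic_param \<mu> l' r' \<eta> a0 m0 m q"
  proof (rule preperiodic_param.intro)
    show "(tent a0 ^^ q) (crit a0 m) = crit a0 m"
      unfolding a0(2) using m0 q by (intro cycle_point_periodic) auto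
    show "0 < crit a0 m" unfolding a0(2) using m0 q by (intro cycle_point_pos) auto
    show "crit a0 m \<noteq> a0 - 1" unfolding a0(2) using ne m0 by blast
    show "(tent a0 ^^ i) (crit a0 m) < 0" if "1 \<le> i" "i < q" for i
      unfolding a0(2) using m0 q that by (intro cycle_point_neg) auto
    show "fair_tent a (\<mu> a)" if "a \<in> {l'..r'}" for a using fair that lr by auto
  qed (use T a0 h lr J q in auto)
  then show ?thesis using lr a0 by blast
qed

text \<open>Since a^2 > 2 the fixed point lies in the core. Its period of one step thus contains one
  visit, and the condition of \<open>flat\<close> is a0 < 2.\<close>

lemma dim_param_not_mono:
  assumes J: "sqrt 2 < l" "l < r" "r < 2" and fair: "\<And>a. a \<in> {l..r} \<Longrightarrow> fair_tent a (\<mu> a)"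
  shows "\<exists>a0\<in>{l..r}. \<exists>a\<in>{l..r}. a0 < a \<and> finite (range (crit a0)) \<and> finite (range (crit a)) \<and>
    dim_param \<mu> a < dim_param \<mu> a0"
proof -
  have fx: "cycle_point 1 a < a - 1" if "a \<in> {l..r}" for a
  proof -
    have a: "sqrt 2 < a" "1 < a" using that J sqrt2_bounds by auto
    have "sqrt 2 * sqrt 2 < a * a" using a by (intro mult_strict_mono) auto
    then show ?thesis unfolding cycle_point_1[OF a(2)] fixpt_def using a by (simp add: field_simps)
  qed
  obtain l' r' m0 \<eta> a0 m where lr: "l \<le> l'" "r' \<le> r" and "preperiodic_param \<mu> l' r' \<eta> a0 m0 m 1"
    and c: "crit a0 m = cycle_point 1 a0"
    using exists_preperiodic_param[OF J fair, of 1] fx J sqrt2_bounds by fastforce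
  then interpret preperiodic_param \<mu> l' r' \<eta> a0 m0 m 1 by simp
  have "visits_per_cycle = 1" unfolding visits_per_cycle_def c using fx[of a0] a0 lr by simp
  then obtain a where "a0 < a" "a \<le> r'" "finite (range (crit a))" "dim_param \<mu> a < dim_param \<mu> a0"
    using flat a0_bounds by auto
  then show ?thesis using finite0 a0 lr by (intro bexI[of _ a0] bexI[of _ a]) auto
qed

lemma dim_param_not_antimono:
  assumes J: "sqrt 2 < l" "l < r" "r < 2" and fair: "\<And>a. a \<in> {l..r} \<Longrightarrow> fair_tent a (\<mu> a)"
  shows "\<exists>a0\<in>{l..r}. \<exists>a\<in>{l..r}. a0 < a \<and> finite (range (crit a0)) \<and> finite (range (crit a)) \<and>
    dim_param \<mu> a0 < dim_param \<mu> a"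
proof -
  define s where "s = (l + r) / 2"
  have s: "l < s" "s < r" "1 < s" "s < 2" using J sqrt2_bounds by (auto simp: s_def)
  obtain q where q: "1 \<le> q" "s ^ (q - 1) * (2 - s) < 1" "1 \<le> s ^ q * (2 - s)"
    using exists_cycle_length[OF s(3,4)] by blast
  \<comment> \<open>The inequality 1 <= s^q (2 - s) may fail near \<open>s\<close>, but this strict
    consequence persists, so one \<open>q\<close> serves a whole neighbourhood.\<close>
  have "s - 1 < cycle_point q s" using s q by (intro cycle_point_gt) auto
  have cp: "continuous_on {l<..<r} (cycle_point q)"
    using J sqrt2_bounds by (intro continuous_on_cycle_point) auto
  have "open (({l<..<r} \<inter> (\<lambda>a. a ^ (q - 1) * (2 - a)) -` {..<1}) \<inter>
      ({l<..<r} \<inter> (\<lambda>a. cycle_point q a - (a - 1)) -` {0<..}))" (is "open ?S")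
    by (intro open_Int[OF continuous_open_preimage continuous_open_preimage] continuous_intros cp; simp)
  moreover have "s \<in> ?S" using s q \<open>s - 1 < cycle_point q s\<close> by simp
  ultimately obtain e where e: "e > 0" "cball s e \<subseteq> ?S"
    unfolding open_contains_cball by blast
  have J': "l < a \<and> a < r \<and> a ^ (q - 1) * (2 - a) < 1 \<and> a - 1 < cycle_point q a" if "a \<in> {s - e..s + e}" for a
  proof -
    have "a \<in> ?S" using e(2) that unfolding cball_eq_atLeastAtMost by blast
    then show ?thesis by simp
  qed
  have se: "l < s - e" "s + e < r" using J'[of "s - e"] J'[of "s + e"] e(1) by auto
  have "\<exists>l' r' m0 \<eta> a0 m. s - e \<le> l' \<and> r' \<le> s + e \<and> preperiodic_param \<mu> l' r' \<eta> a0 m0 m q \<and> crit a0 m = cycle_point q a0"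
  proof (rule exists_preperiodic_param)
    show "sqrt 2 < s - e" "s - e < s + e" "s + e < 2" using se J e(1) by auto
    show "fair_tent a (\<mu> a)" if "a \<in> {s - e..s + e}" for a using J'[OF that] by (intro fair) auto
    show "1 \<le> q" by (rule q)
    show "a ^ (q - 1) * (2 - a) < 1" "cycle_point q a \<noteq> a - 1" if "a \<in> {s - e..s + e}" for a using J'[OF that] by auto
  qed
  then obtain l' r' m0 \<eta> a0 m where lr: "s - e \<le> l'" "r' \<le> s + e" and pp: "preperiodic_param \<mu> l' r' \<eta> a0 m0 m q"
    and c: "crit a0 m = cycle_point q a0" by blast
  interpret preperiodic_param \<mu> l' r' \<eta> a0 m0 m q by (rule pp)
  have a0J: "a0 \<in> {s - e..s + e}" using a0 lr by auto
  have v: "visits_per_cycle = q - 1" unfolding visits_per_cycle_def c using J'[OF a0J] by simp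
  \<comment> \<open>For q = 1 the cycle would be the fixed point, which lies in the core.\<close>
  have "q \<noteq> 1"
  proof
    assume "q = 1"
    have "sqrt 2 * sqrt 2 < a0 * a0" using a0_bounds by (intro mult_strict_mono) auto
    then have "cycle_point 1 a0 < a0 - 1"
      unfolding cycle_point_1[OF a0_bounds(2)] fixpt_def using a0_bounds by (simp add: field_simps)
    then show False using J'[OF a0J] \<open>q = 1\<close> by simp
  qed
  then have "1 \<le> visits_per_cycle" using v q(1) by simp
  moreover have "2 ^ visits_per_cycle < a0 ^ q" unfolding v using J'[OF a0J] a0_bounds q by (intro two_power_less) auto
  ultimately obtain a where "a0 < a" "a \<le> r'" "finite (range (crit a))" "dim_param \<mu> a0 < dim_param \<mu> a"
    using steep by blast
  then show ?thesis using finite0 a0 lr se by (intro bexI[of _ a0] bexI[of _ a]) auto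
qed

theorem corollary1p4:
  fixes \<mu> :: "real \<Rightarrow> real measure" and I :: "real set"
  assumes "\<And>a. a \<in> {sqrt 2..2} \<Longrightarrow> fair_measure a (\<mu> a)"
    and "is_interval I" and "I \<subseteq> {sqrt 2..2}" and "\<exists>u\<in>I. \<exists>v\<in>I. u < v"
  shows "\<not> mono_on I (\<lambda>a. hausdorff_dim_measure (\<mu> a)) \<and>
         \<not> antimono_on I (\<lambda>a. hausdorff_dim_measure (\<mu> a)) \<and>
         \<not> mono_on I (\<lambda>a. measure_entropy (\<mu> a) (tent a) / ereal (ln a)) \<and>
         \<not> antimono_on I (\<lambda>a. measure_entropy (\<mu> a) (tent a) / ereal (ln a))"
proof -
  obtain u v where uv: "u \<in> I" "v \<in> I" "u < v" using assms(4) by blast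
  \<comment> \<open>The middle third is a closed interval away from the end parameters sqrt 2 and
    2.\<close>
  define l where "l = (2 * u + v) / 3"
  define r where "r = (u + 2 * v) / 3"
  have lr: "u < l" "l < r" "r < v" using uv by (auto simp: l_def r_def)
  have uv2: "sqrt 2 \<le> u" "v \<le> 2" using uv assms(3) by auto
  have J: "sqrt 2 < l" "l < r" "r < 2" using lr uv2 by auto
  have inI: "a \<in> I" if "a \<in> {l..r}" for a
    using assms(2) uv lr that unfolding is_interval_1 by (meson atLeastAtMost_iff less_imp_le order_trans)
  have fair: "fair_tent a (\<mu> a)" if "a \<in> {l..r}" for a
    using that J by (intro fair_tent.intro assms(1)) auto
  \<comment> \<open>Both expressions equal \<open>dim_param\<close> at Markov parameters, and the
    witnesses for and against monotonicity are of this kind.\<close>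
  have dim: "hausdorff_dim_measure (\<mu> a) = ereal (dim_param \<mu> a)"
    "measure_entropy (\<mu> a) (tent a) / ereal (ln a) = ereal (dim_param \<mu> a)"
    if "a \<in> {l..r}" "finite (range (crit a))" for a
  proof -
    interpret markov_tent a "\<mu> a"
      using fair[OF that(1)] that(2) by (intro markov_tent.intro markov_tent_axioms.intro)
    show "hausdorff_dim_measure (\<mu> a) = ereal (dim_param \<mu> a)"
      unfolding hausdorff_dim_measure_eq dim_param_def ..
    show "measure_entropy (\<mu> a) (tent a) / ereal (ln a) = ereal (dim_param \<mu> a)"
      using ln_a_pos by (simp add: measure_entropy_eq dim_param_def)
  qed
  obtain a0 a where A: "a0 \<in> {l..r}" "a \<in> {l..r}" "a0 < a" "finite (range (crit a0))" "finite (range (crit a))"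
    "dim_param \<mu> a < dim_param \<mu> a0"
    using dim_param_not_mono[OF J fair] by blast
  obtain b0 b where B: "b0 \<in> {l..r}" "b \<in> {l..r}" "b0 < b" "finite (range (crit b0))" "finite (range (crit b))"
    "dim_param \<mu> b0 < dim_param \<mu> b"
    using dim_param_not_antimono[OF J fair] by blast
  show ?thesis
  proof (intro conjI notI)
    assume "mono_on I (\<lambda>a. hausdorff_dim_measure (\<mu> a))"
    from mono_onD[OF this inI[OF A(1)] inI[OF A(2)]] show False using A by (simp add: dim)
  next
    assume "antimono_on I (\<lambda>a. hausdorff_dim_measure (\<mu> a))"
    from monotone_onD[OF this inI[OF B(1)] inI[OF B(2)]] show False using B by (simp add: dim)
  next
    assume "mono_on I (\<lambda>a. measure_entropy (\<mu> a) (tent a) / ereal (ln a))"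
    from mono_onD[OF this inI[OF A(1)] inI[OF A(2)]] show False using A by (simp add: dim)
  next
    assume "antimono_on I (\<lambda>a. measure_entropy (\<mu> a) (tent a) / ereal (ln a))"
    from monotone_onD[OF this inI[OF B(1)] inI[OF B(2)]] show False using B by (simp add: dim)
  qed
qed

end
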